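(* Let $\Omega\subset\mathbb{R}^m$ be an open set, let $n<m\le 2n$ and let $f\in W^{1,1}_{\mathrm{loc}}(\Omega,\mathbb{R}^{2n+1})$. Suppose that the Jacobian matrix $Df$ has rank equal to $m$ almost everywhere in $\Omega$ and set $\Sigma=f(\Omega)$. Then $\mathcal{H}^{m+1}_d(\Sigma)>0$.
   Context: The Heisenberg group $\mathbb{H}^n$ is identified with $\mathbb{R}^{2n+1}$ equipped with the left invariant vector fields $X_i=\partial_{x_i}-x_{n+i}\partial_{x_{2n+1}}$ and $X_{n+i}=\partial_{x_{n+i}}+x_i\partial_{x_{2n+1}}$, $i=1,\dots,n$. The sub-Riemannian distance $d$ of $\mathbb{H}^n$ is the Carnot–Carathéodory distance associated to $X_1,\dots,X_{2n}$: $d(p,q)$ is the infimum of $T$ over absolutely continuous curves $\gamma:[0,T]\to\mathbb{R}^{2n+1}$ with $\gamma(0)=p$, $\gamma(T)=q$ and $\dot\gamma=\sum_{i=1}^{2n}a_iX_i(\gamma)$ a.e. with $\sum a_i^2\le1$. $\mathcal{H}^{m+1}_d$ is the $(m+1)$-dimensional Hausdorff measure with respect to $d$. *)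

theory Defs
  imports "HOL-Analysis.Analysis"
begin

text \<open>A point (x, y, t) stands for (x_1..x_n, x_{n+1}..x_{2n}, x_{2n+1}).\<close>
type_synonym 'n heis = "(real^'n) \<times> (real^'n) \<times> real"

definition abs_cont_on :: "real \<Rightarrow> real \<Rightarrow> (real \<Rightarrow> 'a::metric_space) \<Rightarrow> bool" where
  "abs_cont_on a b g \<longleftrightarrow>
     (\<forall>\<epsilon>>0. \<exists>\<delta>>0. \<forall>(k::nat) (u::nat \<Rightarrow> real) (v::nat \<Rightarrow> real).
        (\<forall>i<k. a \<le> u i \<and> u i \<le> v i \<and> v i \<le> b) \<and>
        (\<forall>i<k. \<forall>j<k. i \<noteq> j \<longrightarrow> v i \<le> u j \<or> v j \<le> u i) \<and>
        (\<Sum>i<k. v i - u i) < \<delta>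
        \<longrightarrow> (\<Sum>i<k. dist (g (u i)) (g (v i))) < \<epsilon>)"

text \<open>Horizontal velocity: sum_i a_i X_i + b_i X_{n+i} at the point (x,y,t), where
  X_i = d/dx_i - y_i d/dt and X_{n+i} = d/dy_i + x_i d/dt.\<close>
definition horiz_field :: "'n::finite heis \<Rightarrow> real^'n \<Rightarrow> real^'n \<Rightarrow> 'n heis" where
  "horiz_field p a b = (a, b, (\<Sum>i\<in>UNIV. fst p $ i * b $ i - fst (snd p) $ i * a $ i))"

definition admissible_curve :: "real \<Rightarrow> (real \<Rightarrow> 'n::finite heis) \<Rightarrow> 'n heis \<Rightarrow> 'n heis \<Rightarrow> bool" where
  "admissible_curve T \<gamma> p q \<longleftrightarrow>
     0 \<le> T \<and> \<gamma> 0 = p \<and> \<gamma> T = q \<and> abs_cont_on 0 T \<gamma> \<and>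
     (AE t in lebesgue. t \<in> {0..T} \<longrightarrow>
        (\<exists>a b. (\<gamma> has_vector_derivative horiz_field (\<gamma> t) a b) (at t within {0..T}) \<and>
               (\<Sum>i\<in>UNIV. (a $ i)\<^sup>2) + (\<Sum>i\<in>UNIV. (b $ i)\<^sup>2) \<le> 1))"

definition cc_dist :: "'n::finite heis \<Rightarrow> 'n heis \<Rightarrow> real" where
  "cc_dist p q = Inf {T. \<exists>\<gamma>. admissible_curve T \<gamma> p q}"

definition diam_wrt :: "('a \<Rightarrow> 'a \<Rightarrow> real) \<Rightarrow> 'a set \<Rightarrow> ennreal" where
  "diam_wrt d C = (SUP p\<in>C. SUP q\<in>C. ennreal (d p q))"

definition hausdorff_pre :: "('a \<Rightarrow> 'a \<Rightarrow> real) \<Rightarrow> real \<Rightarrow> real \<Rightarrow> 'a set \<Rightarrow> ennreal" where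
  "hausdorff_pre d s \<delta> A =
     (INF C\<in>{C :: nat \<Rightarrow> 'a set. A \<subseteq> (\<Union>i. C i) \<and> (\<forall>i. diam_wrt d (C i) \<le> ennreal \<delta>)}.
        (\<Sum>i. ennreal (enn2real (diam_wrt d (C i)) powr s)))"

definition hausdorff_measure_wrt :: "('a \<Rightarrow> 'a \<Rightarrow> real) \<Rightarrow> real \<Rightarrow> 'a set \<Rightarrow> ennreal" where
  "hausdorff_measure_wrt d s A = (SUP \<delta>\<in>{0<..}. hausdorff_pre d s \<delta> A)"

fun iter_deriv :: "('m::euclidean_space) list \<Rightarrow> ('m \<Rightarrow> real) \<Rightarrow> 'm \<Rightarrow> real" where
  "iter_deriv [] \<phi> = \<phi>"
| "iter_deriv (v # vs) \<phi> = (\<lambda>x. frechet_derivative (iter_deriv vs \<phi>) (at x) v)"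

definition smooth_fun :: "('m::euclidean_space \<Rightarrow> real) \<Rightarrow> bool" where
  "smooth_fun \<phi> \<longleftrightarrow> (\<forall>vs x. iter_deriv vs \<phi> differentiable (at x))"

definition test_fun :: "'m::euclidean_space set \<Rightarrow> ('m \<Rightarrow> real) \<Rightarrow> bool" where
  "test_fun \<Omega> \<phi> \<longleftrightarrow> smooth_fun \<phi> \<and> compact (closure {x. \<phi> x \<noteq> 0}) \<and> closure {x. \<phi> x \<noteq> 0} \<subseteq> \<Omega>"

definition locally_integrable :: "'m::euclidean_space set \<Rightarrow> ('m \<Rightarrow> 'b::euclidean_space) \<Rightarrow> bool" where
  "locally_integrable \<Omega> g \<longleftrightarrow> (\<forall>K. compact K \<and> K \<subseteq> \<Omega> \<longrightarrow> set_integrable lebesgue K g)"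

definition weak_partial :: "(real^'m) set \<Rightarrow> (real^'m \<Rightarrow> 'b::euclidean_space) \<Rightarrow> 'm \<Rightarrow> (real^'m \<Rightarrow> 'b) \<Rightarrow> bool" where
  "weak_partial \<Omega> f j g \<longleftrightarrow>
     (\<forall>\<phi>. test_fun \<Omega> \<phi> \<longrightarrow>
        integral\<^sup>L lebesgue (\<lambda>x. frechet_derivative \<phi> (at x) (axis j 1) *\<^sub>R f x)
        = - integral\<^sup>L lebesgue (\<lambda>x. \<phi> x *\<^sub>R g x))"

definition W11_loc_weak_jacobian :: "(real^'m) set \<Rightarrow> (real^'m \<Rightarrow> 'b::euclidean_space) \<Rightarrow> (real^'m \<Rightarrow> 'm \<Rightarrow> 'b) \<Rightarrow> bool" where
  "W11_loc_weak_jacobian \<Omega> f Df \<longleftrightarrow>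
     locally_integrable \<Omega> f \<and>
     (\<forall>j. locally_integrable \<Omega> (\<lambda>x. Df x j) \<and> weak_partial \<Omega> f j (\<lambda>x. Df x j))"

definition jacobian_rank :: "(real^'m \<Rightarrow> 'm \<Rightarrow> 'b::euclidean_space) \<Rightarrow> real^'m \<Rightarrow> nat" where
  "jacobian_rank Df x = dim (range (Df x))"

end

theory Submission
  imports Defs
begin

text \<open>Write a point of the Heisenberg group as \<open>(z, t)\<close> with \<open>z\<close> in a symplectic space of dimension \<open>2n\<close>.
  The distance of \<open>p\<close> and \<open>q\<close> dominates the norm of \<open>z(q) - z(p)\<close> and the square root of
  \<open>t(q) - t(p) - \<omega>(z(p), z(q))\<close>. Suppose that the image of \<open>f\<close> is a null set.

  Near a Lebesgue point \<open>x\<close> of \<open>Df\<close>, the map \<open>f\<close> differs from the linear map \<open>Df(x)\<close> by a map of small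
  Lipschitz constant on a set of positive measure. If the range of \<open>Df(x)\<close> were not contained in the contact
  hyperplane at \<open>f(x)\<close>, then the part of this set sent into a set of diameter \<open>\<rho>\<close> would have measure
  \<open>O(\<rho>^(m-1) * \<rho>^2)\<close>, and efficient covers of the image would show that the set is null. Hence \<open>f\<close> satisfies the
  contact equation \<open>dt = \<omega>(z, dz)\<close> almost everywhere.

  Sobolev maps satisfy the fundamental theorem of calculus along almost every segment. Integrating the contact
  equation around a small parallelogram at a Lebesgue point of \<open>Df\<close> shows that \<open>Df\<close> maps it to a parallelogram of
  symplectic area zero. So the range of \<open>Df\<close> projects injectively to an isotropic subspace, whose dimension is at most
  \<open>n < m\<close>. Products of two first derivatives, which need not be integrable, never appear.\<close>

subsection \<open>Lower bounds for the sub-Riemannian distance\<close>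

text \<open>The exponent m + 1 comes from the anisotropy of the distance. Height above the contact
  hyperplane costs a square root, so a set of diameter rho meets a noncontact image in a slab of
  thickness rho^2, and the preimage measure rho^(m+1) matches one term of a Hausdorff sum of
  exponent m + 1. For smooth maps the second half is one exterior derivative: the contact equation
  forces the pullback of the symplectic form to vanish. That pullback is quadratic in Df. The loop
  survives because on an edge of length r one factor, the displacement of z, is controlled uniformly
  along the edge, and only the other factor in mean; the error is then a small multiple of r^2, the
  order of the area itself. Lower bounds for \<open>cc_dist\<close> have a hidden cost: an infimum
  over an empty set of reals carries no information, so any two points have to be joined by an
  admissible curve. Arbitrary images and pieces are treated through outer covers, f and Df through
  Borel representatives on a ball.\<close>

lemma abs_cont_on_small_increments:
  fixes g :: "real \<Rightarrow> 'a::real_normed_vector" and \<D> :: "(real \<times> real set) set"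
  assumes \<delta>: "\<And>(k::nat) u v. \<lbrakk>\<forall>i<k. a \<le> u i \<and> u i \<le> v i \<and> v i \<le> b;
        \<forall>i<k. \<forall>j<k. i \<noteq> j \<longrightarrow> v i \<le> u j \<or> v j \<le> u i; (\<Sum>i<k. v i - u i) < \<delta>\<rbrakk>
        \<Longrightarrow> (\<Sum>i<k. dist (g (u i)) (g (v i))) < \<epsilon>"
    and td: "\<D> tagged_partial_division_of {a..b}"
    and U: "U \<in> lmeasurable" "measure lebesgue U < \<delta>"
    and sub: "\<And>x K. (x,K) \<in> \<D> \<Longrightarrow> K \<subseteq> U"
  shows "norm (\<Sum>(x,K)\<in>\<D>. g (Sup K) - g (Inf K)) \<le> \<epsilon>"
proof -
  have fin: "finite \<D>" using td by (simp add: tagged_partial_division_of_def)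
  have int: "\<exists>c d. K = {c..d} \<and> c \<le> d \<and> a \<le> c \<and> d \<le> b" if "(x,K) \<in> \<D>" for x K
  proof -
    obtain c d where K: "K = cbox c d" and "x \<in> K" "K \<subseteq> {a..b}"
      using tagged_partial_division_ofD(2,3,4)[OF td] \<open>(x,K) \<in> \<D>\<close> by metis
    then show ?thesis by (intro exI[of _ c] exI[of _ d]) auto
  qed
  \<comment> \<open>A one-point interval can lie inside another interval although their interiors
    are disjoint. Dropping such intervals, whose increments vanish, makes disjointness of interiors
    imply the ordering that \<open>abs_cont_on\<close> asks for.\<close>
  define D where "D = {p\<in>\<D>. Inf (snd p) < Sup (snd p)}"
  have finD: "finite D" using fin by (simp add: D_def)
  obtain e where e: "bij_betw e {..<card D} D"
    using ex_bij_betw_nat_finite[OF finD] by (auto simp: atLeast0LessThan)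
  define u where "u i = Inf (snd (e i))" for i
  define v where "v i = Sup (snd (e i))" for i
  have ei: "e i \<in> D" if "i < card D" for i using e that by (auto simp: bij_betw_def)
  have uv: "snd (e i) = {u i..v i} \<and> u i < v i \<and> a \<le> u i \<and> v i \<le> b" if "i < card D" for i
  proof -
    have "(fst (e i), snd (e i)) \<in> \<D>" "Inf (snd (e i)) < Sup (snd (e i))" using ei[OF that] by (auto simp: D_def)
    moreover from int[OF this(1)] obtain c d where cd: "snd (e i) = {c..d}" "c \<le> d" "a \<le> c" "d \<le> b" by blast
    moreover have "u i = c" "v i = d" using cd(2) unfolding u_def v_def cd(1) by simp_all
    ultimately show ?thesis by simp
  qed
  have disj: "{u i<..<v i} \<inter> {u j<..<v j} = {}" if "i < card D" "j < card D" "i \<noteq> j" for i j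
  proof -
    have ne: "e i \<noteq> e j" using e that by (auto simp: bij_betw_def inj_on_def)
    have "(fst (e i), snd (e i)) \<in> \<D>" "(fst (e j), snd (e j)) \<in> \<D>"
      using ei[OF that(1)] ei[OF that(2)] by (auto simp: D_def)
    then have "interior (snd (e i)) \<inter> interior (snd (e j)) = {}"
      using ne by (intro tagged_partial_division_ofD(5)[OF td]) (auto simp: prod_eq_iff)
    then show ?thesis using uv[OF that(1)] uv[OF that(2)] by simp
  qed
  have sep: "v i \<le> u j \<or> v j \<le> u i" if "i < card D" "j < card D" "i \<noteq> j" for i j
  proof (rule ccontr)
    assume "\<not> ?thesis"
    then have *: "max (u i) (u j) < min (v i) (v j)" using uv[OF that(1)] uv[OF that(2)] by auto
    obtain w where "max (u i) (u j) < w" "w < min (v i) (v j)" using dense[OF *] by auto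
    then have "w \<in> {u i<..<v i} \<inter> {u j<..<v j}" by auto
    then show False using disj[OF that] by auto
  qed
  have "(\<Sum>i<card D. v i - u i) = (\<Sum>i<card D. measure lebesgue {u i<..<v i})"
    using uv by (intro sum.cong) (auto simp: less_imp_le)
  also have "\<dots> = measure lebesgue (\<Union>i<card D. {u i<..<v i})"
    using disj by (intro measure_UNION'[symmetric]) (auto simp: pairwise_def disjnt_def)
  also have "\<dots> \<le> measure lebesgue U"
  proof (rule measure_mono_fmeasurable)
    have "{u i<..<v i} \<subseteq> U" if "i < card D" for i
    proof -
      have "(fst (e i), snd (e i)) \<in> \<D>" using ei[OF that] by (auto simp: D_def)
      from sub[OF this] show ?thesis using uv[OF that] by auto
    qed
    then show "(\<Union>i<card D. {u i<..<v i}) \<subseteq> U" by blast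
  qed (use U in auto)
  finally have "(\<Sum>i<card D. v i - u i) < \<delta>" using U by simp
  then have *: "(\<Sum>i<card D. dist (g (u i)) (g (v i))) < \<epsilon>"
    using uv sep by (intro \<delta>) (auto simp: less_imp_le)
  have "(\<Sum>(x,K)\<in>\<D>. g (Sup K) - g (Inf K)) = (\<Sum>p\<in>D. g (Sup (snd p)) - g (Inf (snd p)))"
  proof (rule sum.mono_neutral_cong_right[OF fin])
    show "\<forall>i\<in>\<D> - D. (case i of (x, K) \<Rightarrow> g (Sup K) - g (Inf K)) = 0"
      using int by (fastforce simp: D_def)
  qed (auto simp: D_def)
  also have "\<dots> = (\<Sum>i<card D. g (v i) - g (u i))"
    unfolding u_def v_def by (rule sum.reindex_bij_betw[OF e, symmetric])
  also have "norm \<dots> \<le> (\<Sum>i<card D. dist (g (u i)) (g (v i)))"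
    by (rule order_trans[OF norm_sum]) (simp add: dist_norm norm_minus_commute)
  finally show ?thesis using * by simp
qed

text \<open>A gauge argument for the mean value inequality. Tags in the exceptional null set are
  given balls inside an open set of measure below \<open>\<delta>\<close>, so absolute continuity
  bounds their total increment; at the other tags in the interval the derivative bounds the
  increment over every interval straddling the tag. A fine tagged division adds up the two
  contributions.\<close>

lemma abs_cont_on_increment_bound:
  fixes g :: "real \<Rightarrow> 'a::real_normed_vector"
  assumes ac: "abs_cont_on a b g" and ab: "a \<le> b" and B: "0 \<le> B"
    and der: "AE t in lebesgue. t \<in> {a..b} \<longrightarrow>
        (\<exists>D. (g has_vector_derivative D) (at t within {a..b}) \<and> norm D \<le> B)"
  shows "norm (g b - g a) \<le> B * (b - a)"
proof (rule field_le_epsilon)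
  fix e :: real assume e: "e > 0"
  \<comment> \<open>Half of e goes to the exceptional tags; \<open>e1\<close> makes the derivative
    error over the whole interval at most the other half. The summand 1 keeps the denominator
    positive when a = b.\<close>
  define e1 where "e1 = e / (2 * (b - a + 1))"
  have e1: "e1 > 0" using e ab by (auto simp: e1_def)
  obtain \<delta> where \<delta>0: "\<delta> > 0" and \<delta>: "\<And>(k::nat) u v. \<lbrakk>\<forall>i<k. a \<le> u i \<and> u i \<le> v i \<and> v i \<le> b;
        \<forall>i<k. \<forall>j<k. i \<noteq> j \<longrightarrow> v i \<le> u j \<or> v j \<le> u i; (\<Sum>i<k. v i - u i) < \<delta>\<rbrakk>
        \<Longrightarrow> (\<Sum>i<k. dist (g (u i)) (g (v i))) < e/2"
  proof -
    have "e/2 > 0" using e by simp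
    from ac[unfolded abs_cont_on_def, rule_format, OF this]
    obtain \<delta> where "\<delta> > 0" and *: "\<forall>(k::nat) u v. (\<forall>i<k. a \<le> u i \<and> u i \<le> v i \<and> v i \<le> b) \<and>
        (\<forall>i<k. \<forall>j<k. i \<noteq> j \<longrightarrow> v i \<le> u j \<or> v j \<le> u i) \<and> (\<Sum>i<k. v i - u i) < \<delta>
        \<longrightarrow> (\<Sum>i<k. dist (g (u i)) (g (v i))) < e/2" by blast
    show ?thesis
    proof (rule that[OF \<open>\<delta> > 0\<close>])
      fix k :: nat and u v :: "nat \<Rightarrow> real"
      assume 1: "\<forall>i<k. a \<le> u i \<and> u i \<le> v i \<and> v i \<le> b"
        and 2: "\<forall>i<k. \<forall>j<k. i \<noteq> j \<longrightarrow> v i \<le> u j \<or> v j \<le> u i" and 3: "(\<Sum>i<k. v i - u i) < \<delta>"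
      show "(\<Sum>i<k. dist (g (u i)) (g (v i))) < e/2"
        by (rule *[rule_format, OF conjI, OF 1 conjI, OF 2 3])
    qed
  qed
  obtain N where N: "N \<in> null_sets lebesgue"
    and NB: "{t. \<not> (t \<in> {a..b} \<longrightarrow> (\<exists>D. (g has_vector_derivative D) (at t within {a..b}) \<and> norm D \<le> B))} \<subseteq> N"
    using der by (auto simp: eventually_ae_filter)
  obtain U where U: "open U" "N \<subseteq> U" "(U - N) \<in> lmeasurable" "emeasure lebesgue (U - N) < ennreal \<delta>"
    using sets_lebesgue_outer_open[of N \<delta>] N \<delta>0 by auto
  have "emeasure lebesgue U = emeasure lebesgue (U - N)"
    using N U by (intro emeasure_Diff_null_set[symmetric]) auto
  then have emU: "emeasure lebesgue U < ennreal \<delta>" using U by simp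
  then have Um: "U \<in> lmeasurable" using U(1) by (intro fmeasurableI) (auto intro: less_trans[OF _ ennreal_less_top])
  have mU: "measure lebesgue U < \<delta>"
    using emU Um \<delta>0 by (simp add: emeasure_eq_measure2 ennreal_less_iff)
  define good where "good t d \<longleftrightarrow> d > 0 \<and> (t \<in> N \<longrightarrow> ball t d \<subseteq> U) \<and> (t \<in> {a..b} - N \<longrightarrow>
      (\<forall>u v. u \<le> t \<longrightarrow> t \<le> v \<longrightarrow> {u..v} \<subseteq> ball t d \<inter> {a..b} \<longrightarrow> norm (g v - g u) \<le> (B + e1) * (v - u)))" for t d
  have "\<exists>d. good t d" for t
  proof (cases "t \<in> {a..b} - N")
    case True
    then obtain D where D: "(g has_vector_derivative D) (at t within {a..b})" "norm D \<le> B" using NB by auto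
    from D(1)[unfolded has_vector_derivative_def has_derivative_within_alt] e1
    obtain d where d: "d > 0" "\<And>y. y \<in> {a..b} \<Longrightarrow> norm (y - t) < d \<Longrightarrow> norm (g y - g t - (y - t) *\<^sub>R D) \<le> e1 * norm (y - t)"
      by metis
    have *: "norm (g y - g t) \<le> (B + e1) * \<bar>y - t\<bar>" if "y \<in> {a..b}" "\<bar>y - t\<bar> < d" for y
    proof -
      have "norm (g y - g t) \<le> norm (g y - g t - (y - t) *\<^sub>R D) + norm ((y - t) *\<^sub>R D)"
        using norm_triangle_ineq[of "g y - g t - (y - t) *\<^sub>R D" "(y - t) *\<^sub>R D"] by simp
      also have "\<dots> \<le> e1 * \<bar>y - t\<bar> + \<bar>y - t\<bar> * B"
        using d(2)[of y] that D(2) by (intro add_mono) (auto intro: mult_left_mono)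
      finally show ?thesis by (simp add: algebra_simps)
    qed
    show ?thesis unfolding good_def
    proof (intro exI[of _ d] conjI impI allI)
      fix u v assume uv: "u \<le> t" "t \<le> v" "{u..v} \<subseteq> ball t d \<inter> {a..b}"
      then have "u \<in> {u..v}" "v \<in> {u..v}" by auto
      with uv(3) have "u \<in> ball t d \<inter> {a..b}" "v \<in> ball t d \<inter> {a..b}" by blast+
      then have "norm (g u - g t) \<le> (B + e1) * \<bar>u - t\<bar>" "norm (g v - g t) \<le> (B + e1) * \<bar>v - t\<bar>"
        using *[of u] *[of v] by (auto simp: dist_real_def)
      then have "norm (g v - g u) \<le> (B + e1) * \<bar>u - t\<bar> + (B + e1) * \<bar>v - t\<bar>"
        using norm_triangle_ineq4[of "g v - g t" "g u - g t"] by simp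
      then show "norm (g v - g u) \<le> (B + e1) * (v - u)" using uv by (simp add: algebra_simps)
    qed (use d True in auto)
  next
    case False
    show ?thesis
    proof (cases "t \<in> N")
      case True
      then obtain d where "d > 0" "ball t d \<subseteq> U" using U(1,2) open_contains_ball by blast
      then show ?thesis using True by (auto simp: good_def)
    qed (use False in \<open>auto simp: good_def intro: exI[of _ 1]\<close>)
  qed
  then obtain d where gd: "\<And>t. good t (d t)" by metis
  have d: "\<And>t. d t > 0" "\<And>t. t \<in> N \<Longrightarrow> ball t (d t) \<subseteq> U"
    and dN: "\<And>t u v. t \<in> {a..b} - N \<Longrightarrow> u \<le> t \<Longrightarrow> t \<le> v \<Longrightarrow> {u..v} \<subseteq> ball t (d t) \<inter> {a..b} \<Longrightarrow> norm (g v - g u) \<le> (B + e1) * (v - u)"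
    using gd unfolding good_def by blast+
  have "gauge (\<lambda>t. ball t (d t))" using d(1) by (auto simp: gauge_def)
  then obtain p where p: "p tagged_division_of {a..b}" "(\<lambda>t. ball t (d t)) fine p"
    using fine_division_exists_real by blast
  define F where "F = (\<lambda>(x::real,K). g (Sup K) - g (Inf K))"
  have finp: "finite p" using p by auto
  have "g b - g a = sum F p" unfolding F_def using additive_tagged_division_1[OF ab p(1), of g] by simp
  also have "\<dots> = sum F {q\<in>p. fst q \<in> N} + sum F {q\<in>p. fst q \<notin> N}"
    using finp by (subst sum.union_disjoint[symmetric]) (auto intro: sum.cong)
  also have "norm \<dots> \<le> norm (sum F {q\<in>p. fst q \<in> N}) + norm (sum F {q\<in>p. fst q \<notin> N})"
    by (rule norm_triangle_ineq)
  also have "norm (sum F {q\<in>p. fst q \<in> N}) \<le> e/2" unfolding F_def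
  proof (rule abs_cont_on_small_increments[OF \<delta> _ Um mU])
    show "{q \<in> p. fst q \<in> N} tagged_partial_division_of {a..b}"
    proof (rule tagged_partial_division_subset)
      show "p tagged_partial_division_of {a..b}" using p(1) by (simp add: tagged_division_of_def)
    qed auto
    show "K \<subseteq> U" if "(x, K) \<in> {q \<in> p. fst q \<in> N}" for x K
    proof -
      have "K \<subseteq> ball x (d x)" using that p(2) by (auto simp: fine_def)
      also have "\<dots> \<subseteq> U" using d(2)[of x] that by auto
      finally show ?thesis .
    qed
  qed auto
  also have "norm (sum F {q\<in>p. fst q \<notin> N}) \<le> (\<Sum>(x,K)\<in>p. (B + e1) * measure lborel K)"
  proof -
    have len: "norm (F q) \<le> (B + e1) * measure lborel (snd q)" if q: "q \<in> p" "fst q \<notin> N" for q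
    proof -
      obtain x K where qq: "q = (x,K)" by (cases q)
      obtain u v where K: "K = cbox u v" "x \<in> K" "K \<subseteq> {a..b}"
        using tagged_division_ofD(2,3,4)[OF p(1)] q(1) qq by metis
      then have "u \<le> x" "x \<le> v" by auto
      moreover have "K \<subseteq> ball x (d x)" using p(2) q qq by (auto simp: fine_def)
      ultimately have "norm (g v - g u) \<le> (B + e1) * (v - u)"
        using K q qq by (intro dN[of x]) auto
      then show ?thesis using K \<open>u \<le> x\<close> \<open>x \<le> v\<close> by (auto simp: F_def qq)
    qed
    have "norm (sum F {q\<in>p. fst q \<notin> N}) \<le> (\<Sum>q\<in>{q\<in>p. fst q \<notin> N}. (B + e1) * measure lborel (snd q))"
      by (rule sum_norm_le) (use len in auto)
    also have "\<dots> \<le> (\<Sum>q\<in>p. (B + e1) * measure lborel (snd q))"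
      using finp B e1 by (intro sum_mono2) auto
    finally show ?thesis by (simp add: case_prod_beta)
  qed
  also have "(\<Sum>(x,K)\<in>p. (B + e1) * measure lborel K) = (B + e1) * (b - a)"
    using additive_content_tagged_division[of p a b] p(1) ab
    by (simp add: sum_distrib_left[symmetric] case_prod_unfold)
  also have "e/2 + (B + e1) * (b - a) \<le> B * (b - a) + e"
  proof -
    have "e1 * (b - a) \<le> e1 * (b - a + 1)" using e1 by simp
    also have "\<dots> = e/2"
    proof -
      have "b - a + 1 > 0" using ab by simp
      then show ?thesis unfolding e1_def by (simp only: divide_divide_eq_left[symmetric]) (simp add: field_simps)
    qed
    finally show ?thesis by (simp add: algebra_simps)
  qed
  finally show "norm (g b - g a) \<le> B * (b - a) + e" by simp
qed

section \<open>Horizontal and vertical coordinates and the symplectic form\<close>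

definition hpart :: "'n::finite heis \<Rightarrow> (real^'n) \<times> (real^'n)" where
  "hpart p = (fst p, fst (snd p))"

definition vpart :: "'n::finite heis \<Rightarrow> real" where
  "vpart p = snd (snd p)"

text \<open>The standard symplectic form, with the sign for which a velocity at p is horizontal
  exactly when its vertical component is \<open>sympl\<close> of \<open>hpart p\<close> and its
  horizontal component.\<close>

definition sympl :: "(real^'n::finite) \<times> (real^'n) \<Rightarrow> (real^'n) \<times> (real^'n) \<Rightarrow> real" where
  "sympl u v = fst u \<bullet> snd v - snd u \<bullet> fst v"

lemma norm_fst_le': "norm (fst p) \<le> norm p" and norm_snd_le': "norm (snd p) \<le> norm p"
  by (metis norm_fst_le norm_snd_le prod.collapse)+

lemma bounded_bilinear_sympl: "bounded_bilinear sympl"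
proof
  fix a a' b b' :: "(real^'n) \<times> (real^'n)" and r :: real
  show "sympl (a + a') b = sympl a b + sympl a' b" "sympl a (b + b') = sympl a b + sympl a b'"
    by (auto simp: sympl_def inner_add_left inner_add_right)
  show "sympl (r *\<^sub>R a) b = r *\<^sub>R sympl a b" "sympl a (r *\<^sub>R b) = r *\<^sub>R sympl a b"
    by (auto simp: sympl_def algebra_simps)
  show "\<exists>K. \<forall>a b::(real^'n) \<times> (real^'n). norm (sympl a b) \<le> norm a * norm b * K"
  proof (intro exI allI)
    fix a b :: "(real^'n) \<times> (real^'n)"
    have "\<bar>sympl a b\<bar> \<le> \<bar>fst a \<bullet> snd b\<bar> + \<bar>snd a \<bullet> fst b\<bar>" by (simp add: sympl_def)
    also have "\<dots> \<le> norm (fst a) * norm (snd b) + norm (snd a) * norm (fst b)"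
      by (intro add_mono Cauchy_Schwarz_ineq2)
    also have "\<dots> \<le> norm a * norm b + norm a * norm b"
      by (intro add_mono mult_mono) (auto simp: norm_fst_le' norm_snd_le')
    finally show "norm (sympl a b) \<le> norm a * norm b * 2" by simp
  qed
qed

interpretation sympl: bounded_bilinear sympl by (rule bounded_bilinear_sympl)

lemma sympl_self [simp]: "sympl u u = 0"
  by (simp add: sympl_def inner_commute)

lemma sympl_commute: "sympl u v = - sympl v u"
  by (simp add: sympl_def inner_commute)

text \<open>Composing one argument with the complex structure, an isometry, turns the form into the
  inner product. This gives the constant 1, hence the clean bound by the squared distance
  later.\<close>

lemma abs_sympl_le: "\<bar>sympl u v\<bar> \<le> norm u * norm v"
proof -
  have "sympl u v = u \<bullet> (snd v, - fst v)" by (simp add: sympl_def inner_prod_def)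
  then have "\<bar>sympl u v\<bar> \<le> norm u * norm (snd v, - fst v)" using Cauchy_Schwarz_ineq2 by metis
  also have "norm (snd v, - fst v) = norm v" by (simp add: norm_prod_def add.commute)
  finally show ?thesis .
qed

lemma bounded_linear_hpart: "bounded_linear hpart"
  unfolding hpart_def[abs_def] by (intro bounded_linear_intros)

lemma bounded_linear_vpart: "bounded_linear vpart"
  unfolding vpart_def[abs_def] by (intro bounded_linear_intros)

lemma hpart_simps [simp]: "hpart (p + q) = hpart p + hpart q" "hpart (p - q) = hpart p - hpart q"
  "hpart (c *\<^sub>R p) = c *\<^sub>R hpart p" "hpart 0 = 0"
  and vpart_simps [simp]: "vpart (p + q) = vpart p + vpart q" "vpart (p - q) = vpart p - vpart q"
  "vpart (c *\<^sub>R p) = c * vpart p" "vpart 0 = 0"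
  by (auto simp: hpart_def vpart_def zero_prod_def)

lemma heis_eqI: "hpart p = hpart q \<Longrightarrow> vpart p = vpart q \<Longrightarrow> p = q"
  by (auto simp: hpart_def vpart_def prod_eq_iff)

lemma norm_hpart_le: "norm (hpart p) \<le> norm p"
proof -
  have "(norm (hpart p))\<^sup>2 \<le> (norm p)\<^sup>2"
    by (simp add: hpart_def norm_prod_def)
  then show ?thesis by (rule power2_le_imp_le) simp
qed

lemma abs_vpart_le: "\<bar>vpart p\<bar> \<le> norm p"
  using norm_snd_le'[of "snd p"] norm_snd_le'[of p] by (simp add: vpart_def)

lemma hpart_horiz_field [simp]: "hpart (horiz_field p a b) = (a, b)"
  by (simp add: hpart_def horiz_field_def)

lemma vpart_horiz_field [simp]: "vpart (horiz_field p a b) = sympl (hpart p) (a, b)"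
  by (simp add: vpart_def horiz_field_def sympl_def hpart_def inner_vec_def sum_subtractf)

lemma norm_pair_vec: "(norm (a::real^'n::finite, b::real^'n))\<^sup>2 = (\<Sum>i\<in>UNIV. (a $ i)\<^sup>2) + (\<Sum>i\<in>UNIV. (b $ i)\<^sup>2)"
  by (simp add: norm_prod_def norm_vec_def L2_set_def sum_nonneg)

lemma norm_pair_le_1:
  "(\<Sum>i\<in>UNIV. (a $ i)\<^sup>2) + (\<Sum>i\<in>UNIV. (b $ i)\<^sup>2) \<le> 1 \<longleftrightarrow> norm (a::real^'n::finite, b::real^'n) \<le> 1"
proof -
  have "(norm (a, b))\<^sup>2 \<le> 1 \<longleftrightarrow> norm (a, b) \<le> 1"
    using abs_square_le_1[of "norm (a, b)"] by (simp only: abs_norm_cancel)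
  then show ?thesis by (simp only: norm_pair_vec)
qed

section \<open>Horizontal curves and the distance they define\<close>

lemma abs_cont_on_subinterval: "abs_cont_on a b g \<Longrightarrow> a \<le> c \<Longrightarrow> d \<le> b \<Longrightarrow> abs_cont_on c d g"
  unfolding abs_cont_on_def
  by (elim all_forward imp_forward ex_forward conj_forward) auto

lemma abs_cont_on_lipschitz_compose:
  assumes "abs_cont_on a b g" and "K > 0" and "\<And>x y. dist (h x) (h y) \<le> K * dist x y"
  shows "abs_cont_on a b (\<lambda>t. h (g t))"
  unfolding abs_cont_on_def
proof (intro allI impI)
  fix \<epsilon> :: real assume "\<epsilon> > 0"
  then have "\<epsilon> / K > 0" using assms by simp
  then obtain \<delta> where \<delta>: "\<delta> > 0" "\<forall>(k::nat) (u::nat \<Rightarrow> real) (v::nat \<Rightarrow> real).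
        (\<forall>i<k. a \<le> u i \<and> u i \<le> v i \<and> v i \<le> b) \<and>
        (\<forall>i<k. \<forall>j<k. i \<noteq> j \<longrightarrow> v i \<le> u j \<or> v j \<le> u i) \<and>
        (\<Sum>i<k. v i - u i) < \<delta>
        \<longrightarrow> (\<Sum>i<k. dist (g (u i)) (g (v i))) < \<epsilon> / K"
    using assms(1)[unfolded abs_cont_on_def, rule_format, of "\<epsilon> / K"] by blast
  show "\<exists>\<delta>>0. \<forall>(k::nat) (u::nat \<Rightarrow> real) (v::nat \<Rightarrow> real).
        (\<forall>i<k. a \<le> u i \<and> u i \<le> v i \<and> v i \<le> b) \<and>
        (\<forall>i<k. \<forall>j<k. i \<noteq> j \<longrightarrow> v i \<le> u j \<or> v j \<le> u i) \<and>
        (\<Sum>i<k. v i - u i) < \<delta>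
        \<longrightarrow> (\<Sum>i<k. dist (h (g (u i))) (h (g (v i)))) < \<epsilon>"
  proof (intro exI[of _ \<delta>] conjI allI impI)
    fix k :: nat and u v :: "nat \<Rightarrow> real"
    assume *: "(\<forall>i<k. a \<le> u i \<and> u i \<le> v i \<and> v i \<le> b) \<and>
        (\<forall>i<k. \<forall>j<k. i \<noteq> j \<longrightarrow> v i \<le> u j \<or> v j \<le> u i) \<and> (\<Sum>i<k. v i - u i) < \<delta>"
    have "(\<Sum>i<k. dist (h (g (u i))) (h (g (v i)))) \<le> K * (\<Sum>i<k. dist (g (u i)) (g (v i)))"
      unfolding sum_distrib_left by (intro sum_mono assms)
    also have "\<dots> < K * (\<epsilon> / K)" using \<delta>(2)[rule_format, OF *] assms(2) by (rule mult_strict_left_mono)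
    finally show "(\<Sum>i<k. dist (h (g (u i))) (h (g (v i)))) < \<epsilon>" using assms(2) by simp
  qed (use \<delta> in auto)
qed

lemma abs_cont_on_bounded_linear:
  assumes "abs_cont_on a b g" and "bounded_linear h"
  shows "abs_cont_on a b (\<lambda>t. h (g t))"
proof -
  interpret bounded_linear h by fact
  obtain K where K: "K > 0" "\<And>x. norm (h x) \<le> norm x * K" using pos_bounded by blast
  show ?thesis
    by (rule abs_cont_on_lipschitz_compose[OF assms(1) K(1)])
      (use K(2) in \<open>simp add: dist_norm diff[symmetric] mult.commute\<close>)
qed

text \<open>Unit speed bounds the horizontal displacement by the elapsed time. The quantity in the
  second bound is the height of q after left translation of p to the origin; its derivative along
  the curve is the symplectic product of a displacement of size at most T with a vector of size at
  most 1, so it changes by at most T^2.\<close>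

lemma admissible_curve_bounds:
  fixes \<gamma> :: "real \<Rightarrow> 'n::finite heis"
  assumes "admissible_curve T \<gamma> p q"
  shows "norm (hpart q - hpart p) \<le> T"
    and "\<bar>vpart q - vpart p - sympl (hpart p) (hpart q)\<bar> \<le> T\<^sup>2"
proof -
  have T: "0 \<le> T" "\<gamma> 0 = p" "\<gamma> T = q" and ac: "abs_cont_on 0 T \<gamma>"
    and der: "AE t in lebesgue. t \<in> {0..T} \<longrightarrow>
        (\<exists>a b. (\<gamma> has_vector_derivative horiz_field (\<gamma> t) a b) (at t within {0..T}) \<and> norm (a, b) \<le> 1)"
    using assms unfolding admissible_curve_def norm_pair_le_1 by blast+
  have h: "norm (hpart (\<gamma> s) - hpart p) \<le> s" if s: "s \<in> {0..T}" for s
  proof -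
    have "norm (hpart (\<gamma> s) - hpart (\<gamma> 0)) \<le> 1 * (s - 0)"
    proof (rule abs_cont_on_increment_bound)
      show "abs_cont_on 0 s (\<lambda>t. hpart (\<gamma> t))"
        using s by (intro abs_cont_on_bounded_linear[OF _ bounded_linear_hpart] abs_cont_on_subinterval[OF ac]) auto
      show "AE t in lebesgue. t \<in> {0..s} \<longrightarrow>
        (\<exists>D. ((\<lambda>t. hpart (\<gamma> t)) has_vector_derivative D) (at t within {0..s}) \<and> norm D \<le> 1)"
        using der
      proof eventually_elim
        case (elim t)
        show ?case
        proof
          assume t: "t \<in> {0..s}"
          then have "t \<in> {0..T}" using s by simp
          with elim obtain a b where "(\<gamma> has_vector_derivative horiz_field (\<gamma> t) a b) (at t within {0..T})"
            "norm (a,b) \<le> 1" by blast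
          then have "((\<lambda>t. hpart (\<gamma> t)) has_vector_derivative hpart (horiz_field (\<gamma> t) a b)) (at t within {0..s})"
            using s by (intro bounded_linear.has_vector_derivative[OF bounded_linear_hpart, of \<gamma>]
                has_vector_derivative_within_subset[of \<gamma> _ t "{0..T}" "{0..s}"]) auto
          then show "\<exists>D. ((\<lambda>t. hpart (\<gamma> t)) has_vector_derivative D) (at t within {0..s}) \<and> norm D \<le> 1"
            using \<open>norm (a,b) \<le> 1\<close> unfolding hpart_horiz_field by blast
        qed
      qed
    qed (use s in auto)
    then show ?thesis using T by simp
  qed
  from h[of T] T show "norm (hpart q - hpart p) \<le> T" by simp
  \<comment> \<open>Up to an additive constant, the vertical coordinate of the left translate by the
    inverse of p. It is linear in x, so it commutes with differentiation.\<close>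
  define k where "k = (\<lambda>x::'n heis. vpart x - sympl (hpart p) (hpart x))"
  have blk: "bounded_linear k" unfolding k_def
    by (rule bounded_linear_sub[OF bounded_linear_vpart bounded_linear_compose[OF sympl.bounded_linear_right bounded_linear_hpart]])
  have "norm (k (\<gamma> T) - k (\<gamma> 0)) \<le> T * (T - 0)"
  proof (rule abs_cont_on_increment_bound)
    show "abs_cont_on 0 T (\<lambda>t. k (\<gamma> t))"
      by (rule abs_cont_on_bounded_linear[OF ac blk])
    show "AE t in lebesgue. t \<in> {0..T} \<longrightarrow>
        (\<exists>D. ((\<lambda>t. k (\<gamma> t)) has_vector_derivative D) (at t within {0..T}) \<and> norm D \<le> T)"
      using der
    proof eventually_elim
      case (elim t)
      show ?case
      proof
        assume t: "t \<in> {0..T}"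
        with elim obtain a b where ab: "(\<gamma> has_vector_derivative horiz_field (\<gamma> t) a b) (at t within {0..T})"
          "norm (a,b) \<le> 1" by blast
        have "k (horiz_field (\<gamma> t) a b) = sympl (hpart (\<gamma> t) - hpart p) (a, b)"
          by (simp add: k_def sympl.diff_left)
        also have "\<bar>\<dots>\<bar> \<le> norm (hpart (\<gamma> t) - hpart p) * norm (a,b)" by (rule abs_sympl_le)
        also have "\<dots> \<le> T * 1" using h[OF t] t ab(2) by (intro mult_mono) auto
        finally have "norm (k (horiz_field (\<gamma> t) a b)) \<le> T" by simp
        with bounded_linear.has_vector_derivative[OF blk ab(1)]
        show "\<exists>D. ((\<lambda>t. k (\<gamma> t)) has_vector_derivative D) (at t within {0..T}) \<and> norm D \<le> T" by blast
      qed
    qed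
  qed (use T in auto)
  moreover have "k (\<gamma> T) - k (\<gamma> 0) = vpart q - vpart p - sympl (hpart p) (hpart q)"
    using T by (simp add: k_def)
  ultimately show "\<bar>vpart q - vpart p - sympl (hpart p) (hpart q)\<bar> \<le> T\<^sup>2"
    by (simp add: power2_eq_square)
qed

lemma lipschitz_imp_abs_cont_on:
  fixes g :: "real \<Rightarrow> 'a::metric_space"
  assumes lip: "\<And>s t. s \<in> {a..b} \<Longrightarrow> t \<in> {a..b} \<Longrightarrow> dist (g s) (g t) \<le> C * \<bar>s - t\<bar>" and C: "C > 0"
  shows "abs_cont_on a b g"
  unfolding abs_cont_on_def
proof (intro allI impI)
  fix \<epsilon> :: real assume "\<epsilon> > 0"
  show "\<exists>\<delta>>0. \<forall>(k::nat) (u::nat \<Rightarrow> real) (v::nat \<Rightarrow> real).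
        (\<forall>i<k. a \<le> u i \<and> u i \<le> v i \<and> v i \<le> b) \<and>
        (\<forall>i<k. \<forall>j<k. i \<noteq> j \<longrightarrow> v i \<le> u j \<or> v j \<le> u i) \<and>
        (\<Sum>i<k. v i - u i) < \<delta> \<longrightarrow> (\<Sum>i<k. dist (g (u i)) (g (v i))) < \<epsilon>"
  proof (intro exI[of _ "\<epsilon> / C"] conjI allI impI)
    fix k :: nat and u v :: "nat \<Rightarrow> real"
    assume *: "(\<forall>i<k. a \<le> u i \<and> u i \<le> v i \<and> v i \<le> b) \<and>
        (\<forall>i<k. \<forall>j<k. i \<noteq> j \<longrightarrow> v i \<le> u j \<or> v j \<le> u i) \<and> (\<Sum>i<k. v i - u i) < \<epsilon> / C"
    have "dist (g (u i)) (g (v i)) \<le> C * (v i - u i)" if "i < k" for i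
    proof -
      have "a \<le> u i" "u i \<le> v i" "v i \<le> b" using * that by blast+
      then show ?thesis using lip[of "u i" "v i"] by simp
    qed
    then have "(\<Sum>i<k. dist (g (u i)) (g (v i))) \<le> (\<Sum>i<k. C * (v i - u i))" by (intro sum_mono) simp
    also have "\<dots> = C * (\<Sum>i<k. v i - u i)" by (simp add: sum_distrib_left)
    also have "\<dots> < C * (\<epsilon> / C)" using * C by (intro mult_strict_left_mono) auto
    finally show "(\<Sum>i<k. dist (g (u i)) (g (v i))) < \<epsilon>" using C by simp
  qed (use \<open>\<epsilon> > 0\<close> C in auto)
qed

text \<open>Continuity bounds the horizontal speed on [0,1] by some M. Stretching time to [0,M]
  divides the velocity by M, and since \<open>horiz_field\<close> is linear in the velocity the
  curve stays horizontal. Absolute continuity comes from a Lipschitz bound.\<close>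

lemma horizontal_C1_imp_admissible_curve:
  fixes \<Gamma> :: "real \<Rightarrow> 'n::finite heis"
  assumes der: "\<And>s. (\<Gamma> has_vector_derivative horiz_field (\<Gamma> s) (a s) (b s)) (at s)"
    and cont: "continuous_on {0..1} a" "continuous_on {0..1} b"
  shows "\<exists>T \<gamma>. admissible_curve T \<gamma> (\<Gamma> 0) (\<Gamma> 1)"
proof -
  have contG: "continuous_on {0..1} \<Gamma>"
    by (rule continuous_on_vector_derivative) (rule has_vector_derivative_at_within[OF der])
  have "continuous_on {0..1} (\<lambda>s. (a s, b s))" by (intro continuous_intros cont)
  then have "bounded ((\<lambda>s. (a s, b s)) ` {0..1})"
    by (intro compact_imp_bounded compact_continuous_image) auto
  then obtain M where M: "M > 0" "\<And>s. s \<in> {0..1} \<Longrightarrow> norm (a s, b s) \<le> M"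
    unfolding bounded_pos by blast
  have "continuous_on {0..1} (\<lambda>s. horiz_field (\<Gamma> s) (a s) (b s))"
    unfolding horiz_field_def by (intro continuous_intros cont contG)
  then have "bounded ((\<lambda>s. horiz_field (\<Gamma> s) (a s) (b s)) ` {0..1})"
    by (intro compact_imp_bounded compact_continuous_image) auto
  then obtain C where C: "C > 0" "\<And>s. s \<in> {0..1} \<Longrightarrow> norm (horiz_field (\<Gamma> s) (a s) (b s)) \<le> C"
    unfolding bounded_pos by blast
  have lip: "norm (\<Gamma> s - \<Gamma> t) \<le> C * norm (s - t)" if "s \<in> {0..1}" "t \<in> {0..1}" for s t
  proof (rule differentiable_bound[of "{0..1}" \<Gamma> "\<lambda>s h. h *\<^sub>R horiz_field (\<Gamma> s) (a s) (b s)"])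
    fix s :: real assume s: "s \<in> {0..1}"
    show "(\<Gamma> has_derivative (\<lambda>h. h *\<^sub>R horiz_field (\<Gamma> s) (a s) (b s))) (at s within {0..1})"
      using has_vector_derivative_at_within[OF der] unfolding has_vector_derivative_def .
    show "onorm (\<lambda>h. h *\<^sub>R horiz_field (\<Gamma> s) (a s) (b s)) \<le> C"
      using C(2)[OF s] by (intro onorm_le) (simp add: mult.commute[of C] mult_left_mono)
  qed (use that in auto)
  define \<gamma> where "\<gamma> t = \<Gamma> (t / M)" for t
  have "admissible_curve M \<gamma> (\<Gamma> 0) (\<Gamma> 1)"
    unfolding admissible_curve_def
  proof (intro conjI)
    show "abs_cont_on 0 M \<gamma>"
    proof (rule lipschitz_imp_abs_cont_on[of _ _ _ "C / M"])
      fix s t assume st: "s \<in> {0..M}" "t \<in> {0..M}"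
      have "dist (\<gamma> s) (\<gamma> t) \<le> C * \<bar>s / M - t / M\<bar>"
        using lip[of "s / M" "t / M"] st M by (simp add: \<gamma>_def dist_norm)
      also have "s / M - t / M = (s - t) / M" by (simp add: diff_divide_distrib)
      finally show "dist (\<gamma> s) (\<gamma> t) \<le> C / M * \<bar>s - t\<bar>" using M by (simp add: abs_divide)
    qed (use C M in auto)
    show "AE t in lebesgue. t \<in> {0..M} \<longrightarrow>
        (\<exists>a b. (\<gamma> has_vector_derivative horiz_field (\<gamma> t) a b) (at t within {0..M}) \<and>
               (\<Sum>i\<in>UNIV. (a $ i)\<^sup>2) + (\<Sum>i\<in>UNIV. (b $ i)\<^sup>2) \<le> 1)"
    proof (intro AE_I2 impI)
      fix t assume t: "t \<in> {0..M}"
      let ?a = "(1 / M) *\<^sub>R a (t / M)" and ?b = "(1 / M) *\<^sub>R b (t / M)"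
      have "((\<lambda>t. \<Gamma> (t / M)) has_vector_derivative (1 / M) *\<^sub>R horiz_field (\<Gamma> (t / M)) (a (t / M)) (b (t / M))) (at t)"
      proof -
        have "((\<lambda>t. t / M) has_vector_derivative 1 / M) (at t)"
          unfolding has_real_derivative_iff_has_vector_derivative[symmetric]
          using M(1) by (auto intro!: derivative_eq_intros)
        from vector_diff_chain_at[OF this der[of "t / M"]] show ?thesis unfolding o_def .
      qed
      then have "(\<gamma> has_vector_derivative (1 / M) *\<^sub>R horiz_field (\<Gamma> (t / M)) (a (t / M)) (b (t / M))) (at t within {0..M})"
        unfolding \<gamma>_def[abs_def] by (rule has_vector_derivative_at_within)
      moreover have "(1 / M) *\<^sub>R horiz_field (\<Gamma> (t / M)) (a (t / M)) (b (t / M)) = horiz_field (\<gamma> t) ?a ?b"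
        by (simp add: horiz_field_def \<gamma>_def sum_divide_distrib diff_divide_distrib)
      moreover have "norm (?a, ?b) \<le> 1"
      proof -
        have "norm (?a, ?b) = norm (a (t / M), b (t / M)) / M"
          using norm_scaleR[of "1/M" "(a (t / M), b (t / M))"] M by simp
        then show ?thesis using M t by (simp add: divide_le_eq)
      qed
      ultimately show "\<exists>a b. (\<gamma> has_vector_derivative horiz_field (\<gamma> t) a b) (at t within {0..M}) \<and>
               (\<Sum>i\<in>UNIV. (a $ i)\<^sup>2) + (\<Sum>i\<in>UNIV. (b $ i)\<^sup>2) \<le> 1"
        unfolding norm_pair_le_1 by metis
    qed
  qed (use M in \<open>auto simp: \<gamma>_def\<close>)
  then show ?thesis by blast
qed

text \<open>The horizontal curve whose projection is the segment from \<open>hpart p\<close> to \<open>hpart q\<close>, perturbed in a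
  single symplectic plane by the loop \<open>(c P', (s P)')\<close> with \<open>P = s\<^sup>2 (1 - s)\<^sup>2\<close>. Both components of
  the loop have zero mean, so the loop only contributes its own signed area \<open>2 c / 35\<close> to the vertical coordinate.\<close>

lemma admissible_curve_exists: "\<exists>T \<gamma>. admissible_curve T \<gamma> (p :: 'n::finite heis) q"
proof -
  obtain x0 y0 t0 where p: "p = (x0, y0, t0)" by (cases p)
  obtain x1 y1 t1 where q: "q = (x1, y1, t1)" by (cases q)
  \<comment> \<open>Any index serves: the loop lives in the plane of the k-th x and y
    directions.\<close>
  define k :: 'n where "k = undefined"
  define e :: "real^'n" where "e = axis k 1"
  define a where "a = x1 - x0"
  define b where "b = y1 - y0"
  \<comment> \<open>The lift of the straight segment gains the height
    \<open>x0 \<bullet> b - y0 \<bullet> a\<close>; the area 2 c / 35 of the loop supplies the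
    rest.\<close>
  define c where "c = 35 / 2 * (t1 - t0 - (x0 \<bullet> b - y0 \<bullet> a))"
  define P :: "real \<Rightarrow> real" where "P s = s^2 - 2 * s^3 + s^4" for s
  define \<phi> :: "real \<Rightarrow> real" where "\<phi> s = 2 * s - 6 * s^2 + 4 * s^3" for s
  define \<phi>' :: "real \<Rightarrow> real" where "\<phi>' s = 2 - 12 * s + 12 * s^2" for s
  define \<psi> :: "real \<Rightarrow> real" where "\<psi> s = P s + s * \<phi> s" for s
  define \<psi>' :: "real \<Rightarrow> real" where "\<psi>' s = 2 * \<phi> s + s * \<phi>' s" for s
  \<comment> \<open>The antiderivative, vanishing at 0, of the signed area density of the loop with
    components \<open>\<phi>\<close> and \<open>\<psi>\<close>. Its value at 1 is 2/35.\<close>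
  define W :: "real \<Rightarrow> real" where "W s = 2 * s^3 - 8 * s^4 + 66 / 5 * s^5 - 10 * s^6 + 20 / 7 * s^7" for s
  have dP: "(P has_real_derivative \<phi> s) (at s)" for s
    unfolding P_def[abs_def] \<phi>_def by (auto intro!: derivative_eq_intros simp: algebra_simps power2_eq_square)
  have d\<phi>: "(\<phi> has_real_derivative \<phi>' s) (at s)" for s
    unfolding \<phi>'_def \<phi>_def[abs_def] by (auto intro!: derivative_eq_intros simp: algebra_simps power2_eq_square)
  have d\<psi>: "(\<psi> has_real_derivative \<psi>' s) (at s)" for s
    unfolding \<psi>_def[abs_def] \<psi>'_def by (auto intro!: derivative_eq_intros dP d\<phi> simp: algebra_simps)
  have dW: "(W has_real_derivative \<phi> s * \<psi>' s - \<psi> s * \<phi>' s) (at s)" for s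
    unfolding W_def[abs_def] \<psi>'_def \<psi>_def \<phi>_def \<phi>'_def P_def
    by (auto intro!: derivative_eq_intros simp: algebra_simps power2_eq_square power3_eq_cube power4_eq_xxxx eval_nat_numeral)
  define X where "X s = x0 + s *\<^sub>R a + (c * \<phi> s) *\<^sub>R e" for s
  define Y where "Y s = y0 + s *\<^sub>R b + \<psi> s *\<^sub>R e" for s
  \<comment> \<open>The height is written in closed form. The cross terms of segment and loop have
    densities \<open>s * \<psi>' s - \<psi> s\<close> and \<open>s * \<phi>' s - \<phi> s\<close>;
    because \<open>\<psi>\<close> and \<open>\<phi>\<close> are derivatives of s P and P, these
    integrate to expressions that vanish at both ends.\<close>
  define \<tau> where "\<tau> s = t0 + s * (x0 \<bullet> b - y0 \<bullet> a) + \<psi> s * (x0 \<bullet> e) + (a \<bullet> e) * (s * \<psi> s - 2 * (s * P s))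
    - c * ((y0 \<bullet> e) * \<phi> s + (b \<bullet> e) * (s * \<phi> s - 2 * P s)) + c * W s" for s
  define X' where "X' s = a + (c * \<phi>' s) *\<^sub>R e" for s
  define Y' where "Y' s = b + \<psi>' s *\<^sub>R e" for s
  have e1: "e \<bullet> e = 1" by (simp add: e_def inner_axis_axis)
  have dX: "(X has_vector_derivative X' s) (at s)" for s
    unfolding X_def[abs_def] X'_def
    by (rule has_vector_derivative_eq_rhs[OF has_vector_derivative_add[OF has_vector_derivative_add[OF
            has_vector_derivative_const has_vector_derivative_scaleR[OF DERIV_ident has_vector_derivative_const]]
          has_vector_derivative_scaleR[OF DERIV_cmult[OF d\<phi>] has_vector_derivative_const]]]) simp
  have dY: "(Y has_vector_derivative Y' s) (at s)" for s
    unfolding Y_def[abs_def] Y'_def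
    by (rule has_vector_derivative_eq_rhs[OF has_vector_derivative_add[OF has_vector_derivative_add[OF
            has_vector_derivative_const has_vector_derivative_scaleR[OF DERIV_ident has_vector_derivative_const]]
          has_vector_derivative_scaleR[OF d\<psi> has_vector_derivative_const]]]) simp
  have d\<tau>: "(\<tau> has_vector_derivative X s \<bullet> Y' s - Y s \<bullet> X' s) (at s)" for s
  proof -
    have "((\<lambda>s. t0 + s * (x0 \<bullet> b - y0 \<bullet> a) + \<psi> s * (x0 \<bullet> e) + (a \<bullet> e) * (s * \<psi> s - 2 * (s * P s))
      - c * ((y0 \<bullet> e) * \<phi> s + (b \<bullet> e) * (s * \<phi> s - 2 * P s)) + c * W s) has_real_derivative
      (x0 \<bullet> b - y0 \<bullet> a) + \<psi>' s * (x0 \<bullet> e) + (a \<bullet> e) * (\<psi> s + s * \<psi>' s - 2 * (P s + s * \<phi> s))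
      - c * ((y0 \<bullet> e) * \<phi>' s + (b \<bullet> e) * (\<phi> s + s * \<phi>' s - 2 * \<phi> s)) + c * (\<phi> s * \<psi>' s - \<psi> s * \<phi>' s)) (at s)"
      by (auto intro!: derivative_eq_intros dP d\<phi> d\<psi> dW simp: algebra_simps)
    moreover have "X s \<bullet> Y' s - Y s \<bullet> X' s = (x0 \<bullet> b - y0 \<bullet> a) + \<psi>' s * (x0 \<bullet> e) + (a \<bullet> e) * (\<psi> s + s * \<psi>' s - 2 * (P s + s * \<phi> s))
      - c * ((y0 \<bullet> e) * \<phi>' s + (b \<bullet> e) * (\<phi> s + s * \<phi>' s - 2 * \<phi> s)) + c * (\<phi> s * \<psi>' s - \<psi> s * \<phi>' s)"
    proof -
      have "X s \<bullet> Y' s - Y s \<bullet> X' s = (x0 \<bullet> b - y0 \<bullet> a) + \<psi>' s * (x0 \<bullet> e) + (a \<bullet> e) * (s * \<psi>' s - \<psi> s)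
        - c * ((y0 \<bullet> e) * \<phi>' s + (b \<bullet> e) * (s * \<phi>' s - \<phi> s)) + c * (\<phi> s * \<psi>' s - \<psi> s * \<phi>' s)"
        unfolding X_def Y_def X'_def Y'_def
        by (simp only: inner_add_left inner_add_right inner_scaleR_left inner_scaleR_right e1
            inner_commute[of e x0] inner_commute[of e y0] inner_commute[of e a] inner_commute[of e b] inner_commute[of b a])
          algebra
      then show ?thesis by (simp add: \<psi>_def algebra_simps)
    qed
    ultimately show ?thesis
      unfolding \<tau>_def[abs_def] has_real_derivative_iff_has_vector_derivative[symmetric] by simp
  qed
  define \<Gamma> where "\<Gamma> s = (X s, Y s, \<tau> s)" for s
  have "\<exists>T \<gamma>. admissible_curve T \<gamma> (\<Gamma> 0) (\<Gamma> 1)"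
  proof (rule horizontal_C1_imp_admissible_curve)
    fix s
    have "horiz_field (\<Gamma> s) (X' s) (Y' s) = (X' s, Y' s, X s \<bullet> Y' s - Y s \<bullet> X' s)"
      by (simp add: horiz_field_def \<Gamma>_def inner_vec_def sum_subtractf)
    then show "(\<Gamma> has_vector_derivative horiz_field (\<Gamma> s) (X' s) (Y' s)) (at s)"
      unfolding \<Gamma>_def[abs_def] by (simp add: has_vector_derivative_Pair dX dY d\<tau>)
  qed (auto simp: X'_def[abs_def] Y'_def[abs_def] \<phi>'_def \<psi>'_def \<phi>_def intro!: continuous_intros)
  moreover have "\<Gamma> 0 = p" by (simp add: \<Gamma>_def X_def Y_def \<tau>_def p \<phi>_def \<psi>_def P_def W_def)
  moreover have "\<Gamma> 1 = q"
    by (simp add: \<Gamma>_def X_def Y_def \<tau>_def q \<phi>_def \<psi>_def P_def W_def a_def b_def c_def)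
      (simp add: field_simps)
  ultimately show ?thesis by simp
qed

text \<open>The bounds for individual curves pass to the infimum because
  \<open>admissible_curve_exists\<close> makes the set of times nonempty. The vertical bound is
  taken in square root form, where it is a lower bound for the time T itself.\<close>

lemma
  fixes p q :: "'n::finite heis"
  shows norm_hpart_le_cc_dist: "norm (hpart q - hpart p) \<le> cc_dist p q"
    and vertical_le_cc_dist: "\<bar>vpart q - vpart p - sympl (hpart p) (hpart q)\<bar> \<le> (cc_dist p q)\<^sup>2"
    and cc_dist_nonneg: "0 \<le> cc_dist p q"
proof -
  have ne: "{T. \<exists>\<gamma>. admissible_curve T \<gamma> p q} \<noteq> {}" using admissible_curve_exists by blast
  show *: "norm (hpart q - hpart p) \<le> cc_dist p q"
    unfolding cc_dist_def by (rule cInf_greatest[OF ne]) (use admissible_curve_bounds(1) in blast)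
  then show nn: "0 \<le> cc_dist p q" by (rule order_trans[OF norm_ge_zero])
  let ?v = "\<bar>vpart q - vpart p - sympl (hpart p) (hpart q)\<bar>"
  have "sqrt ?v \<le> cc_dist p q"
    unfolding cc_dist_def
  proof (rule cInf_greatest[OF ne])
    fix T assume "T \<in> {T. \<exists>\<gamma>. admissible_curve T \<gamma> p q}"
    then obtain \<gamma> where \<gamma>: "admissible_curve T \<gamma> p q" by blast
    then have "0 \<le> T" by (simp add: admissible_curve_def)
    then show "sqrt ?v \<le> T" using admissible_curve_bounds(2)[OF \<gamma>] by (simp add: real_le_lsqrt)
  qed
  then show "?v \<le> (cc_dist p q)\<^sup>2" using nn by (simp add: real_sqrt_le_iff sqrt_le_D)
qed

subsection \<open>The Lebesgue differentiation theorem\<close>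

lemma nn_integral_disjoint_family_le:
  assumes "countable C" "pairwise (\<lambda>i j. disjnt (B i) (B j)) C" "\<And>i. i \<in> C \<Longrightarrow> B i \<in> sets M"
    and "\<And>i. i \<in> C \<Longrightarrow> B i \<subseteq> U" "U \<in> sets M"
  shows "(\<integral>\<^sup>+i. emeasure M (B i) \<partial>count_space C) \<le> emeasure M U"
proof -
  have "disjoint_family_on B C" using assms(2) by (auto simp: disjoint_family_on_def pairwise_def disjnt_def)
  then have "(\<integral>\<^sup>+i. emeasure M (B i) \<partial>count_space C) = emeasure M (\<Union>i\<in>C. B i)"
    using assms(1,3) by (intro emeasure_UN_countable[symmetric]) auto
  also have "\<dots> \<le> emeasure M U" using assms by (intro emeasure_mono) auto
  finally show ?thesis .
qed

text \<open>Vitali covering applied to the finite Borel measure \<open>h dx\<close>; the set is arbitrary, so its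
  outer measure is used.\<close>

lemma negligible_large_averages:
  fixes h :: "'a::euclidean_space \<Rightarrow> ennreal"
  assumes h[measurable]: "h \<in> borel_measurable borel" and fin: "(\<integral>\<^sup>+x. h x \<partial>lborel) < \<infinity>"
    and ab: "0 \<le> a" "a < b"
    and S: "\<And>x. x \<in> S \<Longrightarrow> h x \<le> ennreal a"
    and avg: "\<And>x d. x \<in> S \<Longrightarrow> 0 < d \<Longrightarrow>
      \<exists>r. 0 < r \<and> r < d \<and> ennreal b * emeasure lborel (cball x r) \<le> (\<integral>\<^sup>+y\<in>cball x r. h y \<partial>lborel)"
    and "bounded S"
  shows "negligible S"
proof -
  obtain E0 where E0: "E0 \<in> sets lborel" "S \<subseteq> E0" "outer_measure_of lborel S = emeasure lborel E0"
    using outer_measure_of_attain[of S lborel] by auto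
  obtain N where N: "N > 0" "S \<subseteq> ball 0 N" using \<open>bounded S\<close> bounded_subset_ballD by blast
  \<comment> \<open>A measurable hull of S, cut down to where h is at most a. It still contains S
    and, by \<open>oE\<close>, is no larger than any Borel set containing S, so estimates proved by
    covering S carry over to E.\<close>
  define E where "E = E0 \<inter> ball 0 N \<inter> {x. h x \<le> ennreal a}"
  have "{x \<in> space borel. h x \<le> ennreal a} \<in> sets borel" by measurable
  then have Em[measurable]: "E \<in> sets borel" using E0 unfolding E_def by (intro sets.Int) auto
  have SE: "S \<subseteq> E" using E0 N S by (auto simp: E_def)
  have oE: "emeasure lborel E \<le> emeasure lborel F" if "S \<subseteq> F" "F \<in> sets borel" for F
  proof -
    have "emeasure lborel E \<le> emeasure lborel E0" using E0 by (intro emeasure_mono) (auto simp: E_def)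
    also have "\<dots> = outer_measure_of lborel S" using E0 by simp
    also have "\<dots> \<le> emeasure lborel F" using that unfolding outer_measure_of_def by (intro INF_lower) auto
    finally show ?thesis .
  qed
  have Efin: "emeasure lborel E < \<infinity>"
    using emeasure_lborel_ball_finite[of 0 N]
    by (intro le_less_trans[OF emeasure_mono[of E "ball 0 N"]]) (auto simp: E_def)
  define M where "M = density lborel h"
  have sM[simp]: "sets M = sets borel" by (simp add: M_def)
  have eM: "emeasure M A = (\<integral>\<^sup>+y\<in>A. h y \<partial>lborel)" if "A \<in> sets borel" for A
    using that by (simp add: M_def emeasure_density)
  have Mfin: "emeasure M (space M) \<noteq> \<infinity>"
    using fin by (simp add: eM M_def emeasure_density)
  have bd: "ennreal b * emeasure lborel E \<le> emeasure M U" if U: "open U" "E \<subseteq> U" for U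
  proof -
    define K where "K = {i::'a\<times>real. 0 < snd i \<and> cball (fst i) (snd i) \<subseteq> U \<and>
      ennreal b * emeasure lborel (cball (fst i) (snd i)) \<le> emeasure M (cball (fst i) (snd i))}"
    obtain C where C: "countable C" "C \<subseteq> K"
      "pairwise (\<lambda>i j. disjnt (cball (fst i) (snd i)) (cball (fst j) (snd j))) C"
      "negligible(S - (\<Union>i \<in> C. cball (fst i) (snd i)))"
    proof (rule Vitali_covering_theorem_cballs[of K snd S fst])
      fix x and d :: real assume x: "x \<in> S" "0 < d"
      then have "x \<in> U" using SE U by auto
      then obtain d' where d': "d' > 0" "ball x d' \<subseteq> U" using U(1) open_contains_ball by blast
      obtain r where r: "0 < r" "r < min d d'" "ennreal b * emeasure lborel (cball x r) \<le> (\<integral>\<^sup>+y\<in>cball x r. h y \<partial>lborel)"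
        using avg[OF x(1), of "min d d'"] x(2) d'(1) by auto
      have "cball x r \<subseteq> U" using r d' by (auto simp: subset_eq)
      then show "\<exists>i. i \<in> K \<and> x \<in> cball (fst i) (snd i) \<and> snd i < d"
        using r by (intro exI[of _ "(x, r)"]) (auto simp: K_def eM)
    qed (auto simp: K_def)
    define B where "B i = cball (fst i) (snd i)" for i :: "'a \<times> real"
    have "(S - (\<Union>i \<in> C. B i)) \<in> null_sets lebesgue" using C(4) by (simp add: negligible_iff_null_sets B_def)
    then obtain Z where Z: "Z \<in> null_sets lborel" "(S - (\<Union>i \<in> C. B i)) \<subseteq> Z"
      by (auto simp: null_sets_completion_iff2)
    \<comment> \<open>The Vitali balls cover only S, up to a null set; minimality of the hull
      transfers the estimate to E.\<close>
    have "emeasure lborel E \<le> emeasure lborel ((\<Union>i \<in> C. B i) \<union> Z)"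
      using Z C(1) by (intro oE) (auto simp: B_def null_sets_def intro!: sets.countable_UN'')
    also have "\<dots> \<le> emeasure lborel (\<Union>i \<in> C. B i) + emeasure lborel Z"
      using Z C(1) by (intro emeasure_subadditive) (auto simp: B_def null_sets_def intro!: sets.countable_UN'')
    also have "\<dots> = emeasure lborel (\<Union>i \<in> C. B i)" using Z by (auto simp: null_sets_def)
    also have "\<dots> = (\<integral>\<^sup>+i. emeasure lborel (B i) \<partial>count_space C)"
      using C(1,3) by (intro emeasure_UN_countable) (auto simp: B_def disjoint_family_on_def pairwise_def disjnt_def)
    finally have "ennreal b * emeasure lborel E \<le> ennreal b * (\<integral>\<^sup>+i. emeasure lborel (B i) \<partial>count_space C)"
      by (rule mult_left_mono) simp
    also have "\<dots> = (\<integral>\<^sup>+i. ennreal b * emeasure lborel (B i) \<partial>count_space C)"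
      by (rule nn_integral_cmult[symmetric]) simp
    also have "\<dots> \<le> (\<integral>\<^sup>+i. emeasure M (B i) \<partial>count_space C)"
      using C(2) by (intro nn_integral_mono) (auto simp: K_def B_def)
    also have "\<dots> \<le> emeasure M U"
      using C U by (intro nn_integral_disjoint_family_le) (auto simp: B_def K_def)
    finally show ?thesis .
  qed
  \<comment> \<open>Outer regularity replaces the open sets U by E itself. Then b |E| is at most the
    mass of E, which is at most a |E| since h is at most a there, and a < b leaves only |E| =
    0.\<close>
  have "emeasure M E = (INF U \<in> {U. E \<subseteq> U \<and> open U}. emeasure M U)"
    by (rule outer_regular) (use Mfin in auto)
  then have "ennreal b * emeasure lborel E \<le> emeasure M E"
    using bd by (auto intro!: INF_greatest)
  also have "emeasure M E \<le> (\<integral>\<^sup>+y\<in>E. ennreal a \<partial>lborel)"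
    unfolding eM[OF Em] by (intro nn_integral_mono) (auto simp: E_def indicator_def)
  also have "\<dots> = ennreal a * emeasure lborel E" by (simp add: nn_integral_cmult_indicator)
  finally have le: "ennreal b * emeasure lborel E \<le> ennreal a * emeasure lborel E" .
  have "emeasure lborel E = 0"
  proof (rule ccontr)
    assume "emeasure lborel E \<noteq> 0"
    then obtain e where e: "emeasure lborel E = ennreal e" "e > 0"
      using Efin by (cases "emeasure lborel E") (auto simp: ennreal_eq_0_iff)
    from le have "b * e \<le> a * e" using ab e(2) unfolding e(1)
      by (simp add: ennreal_mult[symmetric] ennreal_le_iff)
    with ab e(2) show False by simp
  qed
  then have "E \<in> null_sets lborel" by (auto simp: null_sets_def)
  then have "negligible E" by (simp add: negligible_iff_null_sets null_sets_completionI)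
  then show ?thesis using SE negligible_subset by blast
qed

text \<open>The average bound is multiplied out by the volume, which avoids division of extended
  reals. It covers all radii below R because segment averages involve all the smaller concentric
  balls.\<close>

abbreviation averages_le :: "('a::euclidean_space \<Rightarrow> ennreal) \<Rightarrow> 'a \<Rightarrow> real \<Rightarrow> real \<Rightarrow> bool" where
  "averages_le h x e R \<equiv> \<forall>r. 0 < r \<and> r < R \<longrightarrow>
    (\<integral>\<^sup>+y\<in>cball x r. h y \<partial>lborel) \<le> ennreal e * emeasure lborel (cball x r)"

definition lebesgue_point :: "('a::euclidean_space \<Rightarrow> 'b::real_normed_vector) \<Rightarrow> 'a \<Rightarrow> bool" where
  "lebesgue_point g x \<longleftrightarrow> (\<forall>e>0. \<exists>R>0. averages_le (\<lambda>y. ennreal (norm (g y - g x))) x e R)"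

text \<open>For each q in a countable dense set, the points where g is within 1/(n+1) of q although
  the mean of |g - q| reaches 2/(n+1) on arbitrarily small balls form a null set. Elsewhere,
  comparing g with a nearby q gives a mean oscillation of at most 3/(n+1).\<close>

theorem lebesgue_differentiation:
  fixes g :: "'a::euclidean_space \<Rightarrow> 'b::euclidean_space"
  assumes g: "integrable lborel g"
  shows "AE x in lborel. lebesgue_point g x"
proof -
  have gm[measurable]: "g \<in> borel_measurable borel" using g by (simp add: borel_measurable_integrable)
  obtain Q :: "'b set" where Q: "countable Q" "\<And>X. open X \<Longrightarrow> X \<noteq> {} \<Longrightarrow> \<exists>d\<in>Q. d \<in> X"
    using countable_dense_exists by blast
  define S where "S q n N = {x \<in> ball 0 (real N). ennreal (norm (g x - q)) \<le> ennreal (1 / Suc n) \<and>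
    (\<forall>d>0. \<exists>r. 0 < r \<and> r < d \<and>
      ennreal (2 / Suc n) * emeasure lborel (cball x r) \<le> (\<integral>\<^sup>+y\<in>cball x r. ennreal (norm (g y - q)) \<partial>lborel))}"
    for q n N
  have neg: "negligible (S q n N)" for q n N
  proof -
    \<comment> \<open>The deviation from a nonzero constant q is not integrable over the whole
      space. The cutoff at radius N + 1 repairs this and changes nothing on balls of radius below 1
      centred in \<open>ball 0 N\<close>.\<close>
    define h where "h y = ennreal (norm (g y - q)) * indicator (ball 0 (real N + 1)) y" for y
    have [measurable]: "ball (0::'a) (real N + 1) \<in> sets borel" by simp
    have hm: "h \<in> borel_measurable borel" unfolding h_def by measurable
    have "(\<integral>\<^sup>+y. h y \<partial>lborel) \<le> (\<integral>\<^sup>+y. ennreal (norm (g y)) + ennreal (norm q) * indicator (ball 0 (real N + 1)) y \<partial>lborel)"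
    proof (rule nn_integral_mono)
      fix y show "h y \<le> ennreal (norm (g y)) + ennreal (norm q) * indicator (ball 0 (real N + 1)) y"
        using norm_triangle_ineq4[of "g y" q]
        by (auto simp: h_def indicator_def ennreal_plus[symmetric] simp del: ennreal_plus intro!: ennreal_leI)
    qed
    also have "\<dots> = (\<integral>\<^sup>+y. ennreal (norm (g y)) \<partial>lborel) + ennreal (norm q) * emeasure lborel (ball (0::'a) (real N + 1))"
      by (subst nn_integral_add) (auto simp: nn_integral_cmult_indicator)
    also have "\<dots> < \<infinity>"
      using g emeasure_lborel_ball_finite[of "0::'a" "real N + 1"]
      by (auto simp: integrable_iff_bounded ennreal_mult_less_top)
    finally have fin: "(\<integral>\<^sup>+y. h y \<partial>lborel) < \<infinity>" .
    show ?thesis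
    proof (rule negligible_large_averages[OF hm fin, of "1 / Suc n" "2 / Suc n"])
      show "h x \<le> ennreal (1 / Suc n)" if "x \<in> S q n N" for x
        using that by (auto simp: S_def h_def indicator_def)
      show "bounded (S q n N)" by (rule bounded_subset[of "ball 0 (real N)"]) (auto simp: S_def)
      fix x and d :: real assume x: "x \<in> S q n N" "0 < d"
      have "\<forall>d>0. \<exists>r. 0 < r \<and> r < d \<and>
          ennreal (2 / Suc n) * emeasure lborel (cball x r) \<le> (\<integral>\<^sup>+y\<in>cball x r. ennreal (norm (g y - q)) \<partial>lborel)"
        using x(1) unfolding S_def by blast
      from this[rule_format, of "min d 1"] x(2) obtain r where r: "0 < r" "r < min d 1"
        "ennreal (2 / Suc n) * emeasure lborel (cball x r) \<le> (\<integral>\<^sup>+y\<in>cball x r. ennreal (norm (g y - q)) \<partial>lborel)"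
        by auto
      have "(\<integral>\<^sup>+y\<in>cball x r. ennreal (norm (g y - q)) \<partial>lborel) \<le> (\<integral>\<^sup>+y\<in>cball x r. h y \<partial>lborel)"
      proof (rule nn_integral_mono)
        fix y
        have "y \<in> ball 0 (real N + 1)" if "y \<in> cball x r"
          using that x(1) r(2) norm_triangle_ineq[of x "y - x"] by (auto simp: S_def dist_norm norm_minus_commute)
        then show "ennreal (norm (g y - q)) * indicator (cball x r) y \<le> h y * indicator (cball x r) y"
          by (auto simp: h_def indicator_def)
      qed
      with r show "\<exists>r. 0 < r \<and> r < d \<and>
          ennreal (2 / Suc n) * emeasure lborel (cball x r) \<le> (\<integral>\<^sup>+y\<in>cball x r. h y \<partial>lborel)"
        by (intro exI[of _ r]) auto
    qed (auto simp: divide_strict_right_mono)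
  qed
  define Z where "Z = (\<Union>q\<in>Q. \<Union>n. \<Union>N. S q n N)"
  have "Z \<in> null_sets lebesgue"
    unfolding Z_def using neg Q(1) by (intro null_sets_UN' null_sets_UN) (auto simp: negligible_iff_null_sets)
  then have "AE x in lebesgue. x \<notin> Z" by (rule AE_not_in)
  then have "AE x in lborel. x \<notin> Z" by (simp add: AE_completion_iff)
  then show ?thesis unfolding lebesgue_point_def
  proof (rule AE_mp, intro AE_I2 impI allI)
    fix x and e :: real assume xZ: "x \<notin> Z" and e: "e > 0"
    obtain n where n: "1 / real (Suc n) < e / 3" using e nat_approx_posE[of "e/3"] by auto
    have "ball (g x) (1 / Suc n) \<noteq> {}" by simp
    then obtain q where q: "q \<in> Q" "q \<in> ball (g x) (1 / Suc n)" using Q(2)[OF open_ball] by blast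
    obtain N :: nat where N: "norm x < N" using reals_Archimedean2 by blast
    have "x \<notin> S q n N" using xZ q by (auto simp: Z_def)
    moreover have dq: "norm (g x - q) \<le> 1 / Suc n" using q(2) by (simp add: dist_norm)
    ultimately obtain R where R: "R > 0" "\<And>r. 0 < r \<Longrightarrow> r < R \<Longrightarrow>
      \<not> ennreal (2 / Suc n) * emeasure lborel (cball x r) \<le> (\<integral>\<^sup>+y\<in>cball x r. ennreal (norm (g y - q)) \<partial>lborel)"
      using N unfolding S_def by (auto simp: ennreal_leI)
    show "\<exists>R>0. averages_le (\<lambda>y. ennreal (norm (g y - g x))) x e R"
    proof (intro exI[of _ R] conjI allI impI)
      fix r assume r: "0 < r \<and> r < R"
      have [measurable]: "cball x r \<in> sets borel" by simp
      have "(\<integral>\<^sup>+y\<in>cball x r. ennreal (norm (g y - g x)) \<partial>lborel) \<le>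
        (\<integral>\<^sup>+y. ennreal (norm (g y - q)) * indicator (cball x r) y + ennreal (1 / Suc n) * indicator (cball x r) y \<partial>lborel)"
      proof (rule nn_integral_mono)
        fix y
        have "norm (g y - g x) \<le> norm (g y - q) + 1 / Suc n"
          using dq norm_triangle_ineq4[of "g y - q" "g x - q"] by simp
        then show "ennreal (norm (g y - g x)) * indicator (cball x r) y \<le>
          ennreal (norm (g y - q)) * indicator (cball x r) y + ennreal (1 / Suc n) * indicator (cball x r) y"
          by (auto simp: indicator_def ennreal_plus[symmetric] simp del: ennreal_plus intro!: ennreal_leI)
      qed
      also have "\<dots> = (\<integral>\<^sup>+y\<in>cball x r. ennreal (norm (g y - q)) \<partial>lborel) + ennreal (1 / Suc n) * emeasure lborel (cball x r)"
        by (subst nn_integral_add) (measurable, auto simp: nn_integral_cmult_indicator)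
      also have "\<dots> \<le> ennreal (2 / Suc n) * emeasure lborel (cball x r) + ennreal (1 / Suc n) * emeasure lborel (cball x r)"
        using R(2)[of r] r by (intro add_right_mono) auto
      also have "\<dots> = ennreal (3 / Suc n) * emeasure lborel (cball x r)"
        by (simp add: distrib_right[symmetric] ennreal_plus[symmetric] add_divide_distrib[symmetric] del: ennreal_plus)
      also have "\<dots> \<le> ennreal e * emeasure lborel (cball x r)"
        using n by (intro mult_right_mono ennreal_leI) auto
      finally show "(\<integral>\<^sup>+y\<in>cball x r. ennreal (norm (g y - g x)) \<partial>lborel) \<le> ennreal e * emeasure lborel (cball x r)" .
    qed (use R in auto)
  qed
qed

subsection \<open>Smooth bump functions\<close>

text \<open>The flat function exp(-1/s), extended by 0, is the case k = 0. The powers of 1/s make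
  the family closed under differentiation up to linear combinations.\<close>

definition expinv :: "nat \<Rightarrow> real \<Rightarrow> real" where
  "expinv k s = (if s > 0 then exp (- inverse s) * inverse s ^ k else 0)"

lemma power_div_fact_le_exp:
  fixes x :: real
  assumes "x \<ge> 0"
  shows "x ^ n / fact n \<le> exp x"
proof -
  have "(\<lambda>n. x ^ n / fact n) sums exp x" using exp_converges[of x] by (simp add: scaleR_conv_of_real divide_inverse mult.commute)
  from sum_le_suminf[of "\<lambda>n. x ^ n / fact n" "{n}"] sums_unique[OF this] sums_summable[OF this] assms
  show ?thesis by simp
qed

text \<open>A single term of the exponential series dominates the pole of order k and leaves a
  factor s^2, which yields differentiability at 0 with derivative 0.\<close>

lemma expinv_bound: "s > 0 \<Longrightarrow> expinv k s \<le> fact (k + 2) * s\<^sup>2"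
proof -
  assume s: "s > 0"
  have "inverse s ^ (k + 2) / fact (k + 2) \<le> exp (inverse s)"
    using s by (intro power_div_fact_le_exp) auto
  then have "inverse s ^ (k + 2) \<le> exp (inverse s) * fact (k + 2)"
    by (rule pos_divide_le_eq[THEN iffD1, rotated]) (rule fact_gt_zero)
  then have "inverse s ^ (k + 2) * exp (- inverse s) \<le> exp (inverse s) * fact (k + 2) * exp (- inverse s)"
    by (rule mult_right_mono) simp
  also have "\<dots> = (exp (inverse s) * exp (- inverse s)) * fact (k + 2)" by (simp only: mult_ac)
  also have "\<dots> = fact (k + 2)" by (simp only: exp_minus_inverse mult_1_left)
  finally have "inverse s ^ (k + 2) * exp (- inverse s) \<le> fact (k + 2)" .
  then have "(inverse s ^ (k + 2) * exp (- inverse s)) * s\<^sup>2 \<le> fact (k + 2) * s\<^sup>2"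
    by (rule mult_right_mono) simp
  also have "(inverse s ^ (k + 2) * exp (- inverse s)) * s\<^sup>2 = expinv k s * (inverse s * s)\<^sup>2"
    using s unfolding expinv_def power_add power2_eq_square by (simp only: if_True mult_ac)
  also have "inverse s * s = 1" using s by simp
  finally show ?thesis by simp
qed

lemma expinv_nonneg: "0 \<le> expinv k s"
  by (auto simp: expinv_def)

lemma expinv_has_derivative:
  "(expinv k has_real_derivative expinv (k + 2) s - k * expinv (k + 1) s) (at s)"
proof -
  consider "s > 0" | "s < 0" | "s = 0" by linarith
  then show ?thesis
  proof cases
    case 1
    have "((\<lambda>s. exp (- inverse s) * inverse s ^ k) has_real_derivative
        expinv (k + 2) s - k * expinv (k + 1) s) (at s)"
    proof (cases k)
      case 0
      then show ?thesis using 1 by (auto intro!: derivative_eq_intros simp: expinv_def power2_eq_square)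
    next
      case (Suc n)
      then show ?thesis using 1
        by (auto intro!: derivative_eq_intros DERIV_power_Suc[THEN DERIV_cong] simp: expinv_def power2_eq_square algebra_simps simp del: power_Suc)
          (simp add: algebra_simps)
    qed
    then show ?thesis
      by (rule has_field_derivative_transform_within_open[of _ _ _ "{0<..}"]) (use 1 in \<open>auto simp: expinv_def\<close>)
  next
    case 2
    have "((\<lambda>_. 0) has_real_derivative expinv (k + 2) s - k * expinv (k + 1) s) (at s)"
      using 2 by (simp add: expinv_def)
    then show ?thesis
      by (rule has_field_derivative_transform_within_open[of _ _ _ "{..<0}"]) (use 2 in \<open>auto simp: expinv_def\<close>)
  next
    case 3
    have "((\<lambda>y. (expinv k y - expinv k 0) / (y - 0)) \<longlongrightarrow> 0) (at 0)"
    proof (rule Lim_null_comparison[of _ "\<lambda>y. fact (k + 2) * \<bar>y\<bar>"])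
      have "norm ((expinv k y - expinv k 0) / (y - 0)) \<le> fact (k + 2) * \<bar>y\<bar>" for y
      proof (cases "y > 0")
        case True
        then show ?thesis using expinv_bound[of y k] expinv_nonneg[of k y]
          by (auto simp: expinv_def[of k 0] divide_le_eq power2_eq_square abs_mult mult.assoc)
      qed (simp add: expinv_def mult_nonneg_nonpos del: fact_Suc add_2_eq_Suc')
      then show "eventually (\<lambda>y. norm ((expinv k y - expinv k 0) / (y - 0)) \<le> fact (k + 2) * \<bar>y\<bar>) (at 0)" by simp
      show "((\<lambda>y. fact (k + 2) * \<bar>y\<bar>) \<longlongrightarrow> (0::real)) (at 0)"
        by (intro tendsto_eq_intros) auto
    qed
    then show ?thesis using 3 by (simp add: has_field_derivative_iff expinv_def[of _ 0])
  qed
qed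

text \<open>\<open>smooth_fun\<close> quantifies over all iterated directional derivatives. A class
  of expressions closed under directional differentiation whose members are all differentiable
  reduces this to an induction on the list of directions.\<close>

inductive exp_poly :: "('m::euclidean_space \<Rightarrow> real) \<Rightarrow> bool" where
  const: "exp_poly (\<lambda>_. c)"
| lin: "exp_poly (\<lambda>y. y \<bullet> a)"
| add: "exp_poly f \<Longrightarrow> exp_poly g \<Longrightarrow> exp_poly (\<lambda>y. f y + g y)"
| mult: "exp_poly f \<Longrightarrow> exp_poly g \<Longrightarrow> exp_poly (\<lambda>y. f y * g y)"
| expinv: "exp_poly f \<Longrightarrow> exp_poly (\<lambda>y. expinv k (f y))"

lemma exp_poly_has_derivative:
  "exp_poly f \<Longrightarrow> \<exists>f'. (\<forall>y. (f has_derivative f' y) (at y)) \<and> (\<forall>v. exp_poly (\<lambda>y. f' y v))"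
proof (induction rule: exp_poly.induct)
  case (const c)
  show ?case by (intro exI[of _ "\<lambda>_ _. 0"]) (auto intro: exp_poly.const)
next
  case (lin a)
  show ?case
    by (intro exI[of _ "\<lambda>_ v. v \<bullet> a"]) (auto intro: exp_poly.const has_derivative_inner_left has_derivative_ident)
next
  case (add f g)
  then obtain f' g' where *: "\<And>y. (f has_derivative f' y) (at y)" "\<And>v. exp_poly (\<lambda>y. f' y v)"
    "\<And>y. (g has_derivative g' y) (at y)" "\<And>v. exp_poly (\<lambda>y. g' y v)" by blast
  show ?case
    by (intro exI[of _ "\<lambda>y v. f' y v + g' y v"] conjI allI has_derivative_add exp_poly.add *)
next
  case (mult f g)
  then obtain f' g' where *: "\<And>y. (f has_derivative f' y) (at y)" "\<And>v. exp_poly (\<lambda>y. f' y v)"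
    "\<And>y. (g has_derivative g' y) (at y)" "\<And>v. exp_poly (\<lambda>y. g' y v)" by blast
  show ?case
    by (intro exI[of _ "\<lambda>y v. f y * g' y v + f' y v * g y"] conjI allI has_derivative_mult
        exp_poly.add exp_poly.mult * mult.hyps)
next
  case (expinv f k)
  then obtain f' where *: "\<And>y. (f has_derivative f' y) (at y)" "\<And>v. exp_poly (\<lambda>y. f' y v)" by blast
  let ?d = "\<lambda>y. expinv (k + 2) (f y) + (- real k) * expinv (k + 1) (f y)"
  show ?case
  proof (intro exI[of _ "\<lambda>y v. ?d y * f' y v"] conjI allI)
    fix y
    have "(expinv k has_derivative (\<lambda>v. ?d y * v)) (at (f y))"
      using expinv_has_derivative[of k "f y"] by (simp add: has_field_derivative_def)
    from has_derivative_compose[OF *(1) this] show "((\<lambda>y. expinv k (f y)) has_derivative (\<lambda>v. ?d y * f' y v)) (at y)" .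
  next
    fix v show "exp_poly (\<lambda>y. ?d y * f' y v)"
      by (intro exp_poly.mult exp_poly.add exp_poly.const exp_poly.expinv * expinv.hyps)
  qed
qed

lemma exp_poly_differentiable: "exp_poly f \<Longrightarrow> f differentiable (at y)"
  using exp_poly_has_derivative unfolding differentiable_def by blast

lemma exp_poly_frechet_derivative:
  assumes "exp_poly f" shows "exp_poly (\<lambda>y. frechet_derivative f (at y) v)"
proof -
  obtain f' where f': "\<And>y. (f has_derivative f' y) (at y)" "\<And>v. exp_poly (\<lambda>y. f' y v)"
    using exp_poly_has_derivative[OF assms] by blast
  have "f' y = frechet_derivative f (at y)" for y by (rule frechet_derivative_at[OF f'(1)])
  with f'(2)[of v] show ?thesis by simp
qed

lemma exp_poly_smooth: assumes "exp_poly f" shows "smooth_fun f"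
proof -
  have "exp_poly (iter_deriv vs f)" for vs
    by (induction vs) (auto intro: assms exp_poly_frechet_derivative)
  then show ?thesis by (auto simp: smooth_fun_def intro: exp_poly_differentiable)
qed

lemma exp_poly_continuous: "exp_poly f \<Longrightarrow> continuous_on S f"
  by (meson differentiable_imp_continuous_on differentiable_at_imp_differentiable_on exp_poly_differentiable)

lemma exp_poly_sum: "finite I \<Longrightarrow> (\<And>i. i \<in> I \<Longrightarrow> exp_poly (f i)) \<Longrightarrow> exp_poly (\<lambda>y. \<Sum>i\<in>I. f i y)"
  by (induction I rule: finite_induct) (auto intro: exp_poly.intros)

text \<open>The classical bump exp(-1/(1 - |y - x|^2/\<open>\<epsilon>\<close>^2)). The squared norm
  is polynomial in the coordinates, so the function belongs to \<open>exp_poly\<close>. It is not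
  normalised: its lower bound exp(-4/3) on the half ball, where 1 - 1/4 = 3/4, takes over that
  role.\<close>

definition bump :: "'m::euclidean_space \<Rightarrow> real \<Rightarrow> 'm \<Rightarrow> real" where
  "bump x \<epsilon> y = expinv 0 (1 - (norm (y - x) / \<epsilon>)\<^sup>2)"

lemma exp_poly_bump: "exp_poly (bump x \<epsilon>)"
proof -
  have "bump x \<epsilon> = (\<lambda>y. expinv 0 (1 + (- inverse (\<epsilon>\<^sup>2)) * (\<Sum>i\<in>Basis. (y \<bullet> i + - (x \<bullet> i)) * (y \<bullet> i + - (x \<bullet> i)))))"
  proof
    fix y
    have "(norm (y - x))\<^sup>2 = (\<Sum>i\<in>Basis. (y \<bullet> i + - (x \<bullet> i)) * (y \<bullet> i + - (x \<bullet> i)))"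
      unfolding power2_norm_eq_inner euclidean_inner[of "y - x" "y - x"] by (simp only: inner_diff_left add_uminus_conv_diff)
    then show "bump x \<epsilon> y = expinv 0 (1 + (- inverse (\<epsilon>\<^sup>2)) * (\<Sum>i\<in>Basis. (y \<bullet> i + - (x \<bullet> i)) * (y \<bullet> i + - (x \<bullet> i))))"
      by (simp only: bump_def power_divide) (simp add: divide_inverse mult.commute)
  qed
  then show ?thesis by (simp only:) (intro exp_poly.intros exp_poly_sum finite_Basis)
qed

lemma bump_nonneg: "0 \<le> bump x \<epsilon> y"
  by (simp add: bump_def expinv_nonneg)

lemma bump_le_1: "bump x \<epsilon> y \<le> 1"
  by (simp add: bump_def expinv_def)

lemma bump_eq_0: "\<epsilon> > 0 \<Longrightarrow> y \<notin> cball x \<epsilon> \<Longrightarrow> bump x \<epsilon> y = 0"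
  by (auto simp: bump_def expinv_def dist_norm norm_minus_commute not_less one_le_power)

lemma bump_ge_half: "\<epsilon> > 0 \<Longrightarrow> y \<in> cball x (\<epsilon> / 2) \<Longrightarrow> exp (- 4 / 3) \<le> bump x \<epsilon> y"
proof -
  assume e: "\<epsilon> > 0" and y: "y \<in> cball x (\<epsilon> / 2)"
  have "norm (y - x) / \<epsilon> \<le> 1 / 2" using e y by (simp add: dist_norm norm_minus_commute divide_le_eq)
  then have "(norm (y - x) / \<epsilon>)\<^sup>2 \<le> (1 / 2)\<^sup>2" using e by (intro power_mono) auto
  then have *: "3 / 4 \<le> 1 - (norm (y - x) / \<epsilon>)\<^sup>2" by (simp add: power2_eq_square)
  then have "inverse (1 - (norm (y - x) / \<epsilon>)\<^sup>2) \<le> inverse (3 / 4)" by (intro le_imp_inverse_le) auto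
  then show ?thesis using * by (simp add: bump_def expinv_def)
qed

lemma bump_translate: "bump (x + w) \<epsilon> y = bump x \<epsilon> (y - w)"
  by (simp add: bump_def algebra_simps)

lemma test_fun_bump:
  assumes "\<epsilon> > 0" "cball x \<epsilon> \<subseteq> \<Omega>"
  shows "test_fun \<Omega> (bump x \<epsilon>)"
proof -
  have *: "closure {y. bump x \<epsilon> y \<noteq> 0} \<subseteq> cball x \<epsilon>"
    using bump_eq_0[OF assms(1)] by (intro closure_minimal closed_cball) blast
  then have "compact (closure {y. bump x \<epsilon> y \<noteq> 0})"
    using compact_cball closed_closure by (metis compact_Int_closed inf.absorb_iff2)
  then show ?thesis using * assms exp_poly_smooth[OF exp_poly_bump] by (auto simp: test_fun_def)
qed

lemma bump_has_derivative: "(bump x \<epsilon> has_derivative frechet_derivative (bump x \<epsilon>) (at y)) (at y)"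
  using exp_poly_differentiable[OF exp_poly_bump] by (simp add: frechet_derivative_works)

lemma bump_derivative_eq_0:
  assumes "\<epsilon> > 0" "y \<notin> cball x \<epsilon>" shows "frechet_derivative (bump x \<epsilon>) (at y) v = 0"
proof -
  have "((\<lambda>_. 0) has_derivative (\<lambda>_. 0)) (at y)" by simp
  then have "(bump x \<epsilon> has_derivative (\<lambda>_. 0)) (at y)"
    by (rule has_derivative_transform_within_open[of _ _ _ UNIV "- cball x \<epsilon>"])
      (use assms bump_eq_0[OF assms(1)] in \<open>auto simp: open_Compl\<close>)
  from frechet_derivative_at[OF this] show ?thesis by metis
qed

lemma bump_derivative_continuous: "continuous_on S (\<lambda>y. frechet_derivative (bump x \<epsilon>) (at y) v)"
  by (intro exp_poly_continuous exp_poly_frechet_derivative exp_poly_bump)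

lemma bump_derivative_bounded:
  assumes "\<epsilon> > 0"
  shows "\<exists>B\<ge>0. \<forall>y. \<bar>frechet_derivative (bump x \<epsilon>) (at y) v\<bar> \<le> B"
proof -
  have "bounded ((\<lambda>y. frechet_derivative (bump x \<epsilon>) (at y) v) ` cball x \<epsilon>)"
    by (intro compact_imp_bounded compact_continuous_image bump_derivative_continuous compact_cball)
  then obtain B where "B > 0" "\<And>y. y \<in> cball x \<epsilon> \<Longrightarrow> \<bar>frechet_derivative (bump x \<epsilon>) (at y) v\<bar> \<le> B"
    by (auto simp: bounded_pos)
  then show ?thesis using bump_derivative_eq_0[OF assms] by (metis abs_zero less_imp_le)
qed

subsection \<open>Weakly differentiable functions along segments\<close>

lemma nn_integral_translate:
  fixes h :: "'a::euclidean_space \<Rightarrow> ennreal"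
  assumes [measurable]: "h \<in> borel_measurable borel"
  shows "(\<integral>\<^sup>+x. h (x + c) \<partial>lborel) = (\<integral>\<^sup>+x. h x \<partial>lborel)"
proof -
  have "(\<integral>\<^sup>+x. h x \<partial>lborel) = (\<integral>\<^sup>+x. h x \<partial>distr lborel borel ((+) c))" by (simp add: lborel_distr_plus)
  also have "\<dots> = (\<integral>\<^sup>+x. h (x + c) \<partial>lborel)" by (subst nn_integral_distr) (auto simp: add.commute)
  finally show ?thesis by simp
qed

lemma integrable_translate:
  fixes h :: "'a::euclidean_space \<Rightarrow> 'b::euclidean_space"
  assumes h: "integrable lborel h"
  shows "integrable lborel (\<lambda>x. h (x + c))"
proof -
  have [measurable]: "h \<in> borel_measurable borel" using h by (simp add: borel_measurable_integrable)
  have "(\<integral>\<^sup>+x. ennreal (norm (h (x + c))) \<partial>lborel) = (\<integral>\<^sup>+x. ennreal (norm (h x)) \<partial>lborel)"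
    by (rule nn_integral_translate[of "\<lambda>x. ennreal (norm (h x))"]) measurable
  then show ?thesis using h by (simp add: integrable_iff_bounded)
qed

lemma integral_translate:
  fixes h :: "'a::euclidean_space \<Rightarrow> 'b::euclidean_space"
  assumes [measurable]: "h \<in> borel_measurable borel"
  shows "(\<integral>x. h (x + c) \<partial>lborel) = (\<integral>x. h x \<partial>lborel)"
proof -
  have "(\<integral>x. h x \<partial>lborel) = (\<integral>x. h x \<partial>distr lborel borel ((+) c))" by (simp add: lborel_distr_plus)
  also have "\<dots> = (\<integral>x. h (x + c) \<partial>lborel)" by (subst integral_distr) (auto simp: add.commute)
  finally show ?thesis by simp
qed

lemma AE_translate:
  fixes c :: "'a::euclidean_space"
  assumes "AE x in lborel. P x"
  shows "AE x in lborel. P (x + c)"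
proof -
  obtain N where N: "N \<in> null_sets lborel" "{x. \<not> P x} \<subseteq> N" using assms by (auto simp: eventually_ae_filter)
  have "emeasure lborel ((\<lambda>x. x + c) -` N) = emeasure lborel N"
  proof -
    have "emeasure lborel N = emeasure (distr lborel borel ((+) c)) N" by (simp add: lborel_distr_plus)
    also have "\<dots> = emeasure lborel ((\<lambda>x. x + c) -` N)"
      using N by (subst emeasure_distr) (auto simp: vimage_def add.commute[of c])
    finally show ?thesis by simp
  qed
  moreover have "(\<lambda>x. x + c) -` N \<in> sets borel"
    using measurable_sets[of "\<lambda>x. x + c" borel borel N] N by auto
  ultimately have "(\<lambda>x. x + c) -` N \<in> null_sets lborel" using N by (auto simp: null_sets_def)
  then show ?thesis by (rule AE_I') (use N in auto)
qed

lemma emeasure_cball_scale: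
  fixes x y :: "'a::euclidean_space"
  assumes "r \<ge> 0" "c \<ge> 0"
  shows "emeasure lborel (cball x (c * r)) = ennreal (c ^ DIM('a)) * emeasure lborel (cball y r)"
  using assms by (simp add: emeasure_cball ennreal_mult'[symmetric] power_mult_distrib mult_ac)

text \<open>By Tonelli and translation invariance every s in [0,1] contributes the same norm
  integral. In particular h is integrable along almost every segment with direction v.\<close>

lemma integrable_segment:
  fixes h :: "'a::euclidean_space \<Rightarrow> 'b::euclidean_space"
  assumes h: "integrable lborel h"
  shows "integrable (lborel \<Otimes>\<^sub>M lborel) (\<lambda>(x, s). indicator {0..1::real} s *\<^sub>R h (x + s *\<^sub>R v))"
proof -
  have hm[measurable]: "h \<in> borel_measurable borel" using h by (simp add: borel_measurable_integrable)
  have m: "(\<lambda>(x, s). indicator {0..1::real} s *\<^sub>R h (x + s *\<^sub>R v)) \<in> borel_measurable (lborel \<Otimes>\<^sub>M lborel)"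
    by measurable
  have "(\<integral>\<^sup>+z. ennreal (norm (case z of (x, s) \<Rightarrow> indicator {0..1::real} s *\<^sub>R h (x + s *\<^sub>R v))) \<partial>(lborel \<Otimes>\<^sub>M lborel))
    = (\<integral>\<^sup>+s. \<integral>\<^sup>+x. ennreal (norm (indicator {0..1::real} s *\<^sub>R h (x + s *\<^sub>R v))) \<partial>lborel \<partial>lborel)"
    using m by (subst lborel_pair.nn_integral_snd[symmetric]) auto
  also have "\<dots> = (\<integral>\<^sup>+s. indicator {0..1::real} s * (\<integral>\<^sup>+x. ennreal (norm (h x)) \<partial>lborel) \<partial>lborel)"
  proof (rule nn_integral_cong)
    fix s :: real
    have "(\<integral>\<^sup>+x. ennreal (norm (indicator {0..1::real} s *\<^sub>R h (x + s *\<^sub>R v))) \<partial>lborel)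
       = (\<integral>\<^sup>+x. indicator {0..1} s * ennreal (norm (h (x + s *\<^sub>R v))) \<partial>lborel)"
      by (intro nn_integral_cong) (auto simp: indicator_def)
    also have "\<dots> = indicator {0..1} s * (\<integral>\<^sup>+x. ennreal (norm (h x)) \<partial>lborel)"
      by (subst nn_integral_cmult) (auto simp: nn_integral_translate[of "\<lambda>x. ennreal (norm (h x))"])
    finally show "(\<integral>\<^sup>+x. ennreal (norm (indicator {0..1::real} s *\<^sub>R h (x + s *\<^sub>R v))) \<partial>lborel)
       = indicator {0..1} s * (\<integral>\<^sup>+x. ennreal (norm (h x)) \<partial>lborel)" .
  qed
  also have "\<dots> = (\<integral>\<^sup>+x. ennreal (norm (h x)) \<partial>lborel)" by (subst nn_integral_multc) auto
  also have "\<dots> < \<infinity>" using h by (simp add: integrable_iff_bounded)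
  finally show ?thesis using m by (simp add: integrable_iff_bounded)
qed

lemma integrable_bounded_mult:
  fixes h :: "'a \<Rightarrow> 'b::{banach, second_countable_topology}" and c :: "'a \<Rightarrow> real"
  assumes h: "integrable M h" and [measurable]: "c \<in> borel_measurable M" and B: "\<And>x. \<bar>c x\<bar> \<le> B"
  shows "integrable M (\<lambda>x. c x *\<^sub>R h x)"
proof (rule Bochner_Integration.integrable_bound[of M "\<lambda>x. B *\<^sub>R h x"])
  show "integrable M (\<lambda>x. B *\<^sub>R h x)" using h by simp
  have [measurable]: "h \<in> borel_measurable M" using h by simp
  show "(\<lambda>x. c x *\<^sub>R h x) \<in> borel_measurable M" by measurable
  have "0 \<le> B" using B abs_ge_zero order_trans by blast
  then show "AE x in M. norm (c x *\<^sub>R h x) \<le> norm (B *\<^sub>R h x)"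
    using B by (auto intro!: AE_I2 mult_right_mono)
qed

text \<open>For a convex \<open>U\<close>, the functions \<open>bump (y + s v) \<epsilon>\<close>, \<open>0 \<le> s \<le> 1\<close>, are test functions on \<open>U\<close>;
  integrating the weak derivative identity over \<open>s\<close> gives the fundamental theorem of calculus, averaged against a bump.\<close>

lemma weak_derivative_bump_average:
  fixes F G :: "'a::euclidean_space \<Rightarrow> 'b::euclidean_space"
  assumes F: "integrable lborel F" and G: "integrable lborel G"
    and weak: "\<And>\<phi>. test_fun U \<phi> \<Longrightarrow>
      (\<integral>x. frechet_derivative \<phi> (at x) v *\<^sub>R F x \<partial>lborel) = - (\<integral>x. \<phi> x *\<^sub>R G x \<partial>lborel)"
    and U: "convex U" and \<epsilon>: "\<epsilon> > 0" and y: "cball y \<epsilon> \<subseteq> U" "cball (y + v) \<epsilon> \<subseteq> U"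
  shows "(\<integral>x. bump y \<epsilon> x *\<^sub>R (F (x + v) - F x - (\<integral>s. indicator {0..1} s *\<^sub>R G (x + s *\<^sub>R v) \<partial>lborel)) \<partial>lborel) = 0"
proof -
  have Fm[measurable]: "F \<in> borel_measurable borel" using F by (simp add: borel_measurable_integrable)
  have Gm[measurable]: "G \<in> borel_measurable borel" using G by (simp add: borel_measurable_integrable)
  define d where "d x = frechet_derivative (bump y \<epsilon>) (at x) v" for x
  obtain B where B: "\<And>x. \<bar>d x\<bar> \<le> B" using bump_derivative_bounded[OF \<epsilon>] unfolding d_def by metis
  have [measurable]: "d \<in> borel_measurable borel" unfolding d_def
    by (intro borel_measurable_continuous_onI bump_derivative_continuous)
  have [measurable]: "bump z \<epsilon> \<in> borel_measurable borel" for z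
    by (intro borel_measurable_continuous_onI exp_poly_continuous exp_poly_bump)
  have b1: "\<bar>bump z \<epsilon> x\<bar> \<le> 1" for z x using bump_nonneg[of z \<epsilon> x] bump_le_1[of z \<epsilon> x] by simp
  have dB: "integrable lborel (\<lambda>x. bump z \<epsilon> x *\<^sub>R h x)" if "integrable lborel h" for z and h :: "'a \<Rightarrow> 'b"
    using that b1 by (intro integrable_bounded_mult[where B=1]) auto
  have test: "test_fun U (bump (y + s *\<^sub>R v) \<epsilon>)" if "s \<in> {0..1}" for s
  proof (rule test_fun_bump[OF \<epsilon>], rule subsetI)
    fix x assume x: "x \<in> cball (y + s *\<^sub>R v) \<epsilon>"
    define w where "w = x - (y + s *\<^sub>R v)"
    have "norm w \<le> \<epsilon>" using x by (simp add: w_def dist_norm norm_minus_commute)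
    then have "y + w \<in> U" "y + v + w \<in> U" using y by (auto simp: subset_eq dist_norm)
    then have "(1 - s) *\<^sub>R (y + w) + s *\<^sub>R (y + v + w) \<in> U" using U that by (intro convexD) auto
    moreover have "(1 - s) *\<^sub>R (y + w) + s *\<^sub>R (y + v + w) = x" by (simp add: w_def algebra_simps)
    ultimately show "x \<in> U" by simp
  qed
  have der: "frechet_derivative (bump (y + s *\<^sub>R v) \<epsilon>) (at x) v = d (x - s *\<^sub>R v)" for x s
  proof -
    have "((\<lambda>x. bump y \<epsilon> (x - s *\<^sub>R v)) has_derivative (\<lambda>h. frechet_derivative (bump y \<epsilon>) (at (x - s *\<^sub>R v)) h)) (at x)"
      by (rule has_derivative_compose[OF _ bump_has_derivative]) (auto intro!: derivative_eq_intros)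
    then have "(bump (y + s *\<^sub>R v) \<epsilon> has_derivative (\<lambda>h. frechet_derivative (bump y \<epsilon>) (at (x - s *\<^sub>R v)) h)) (at x)"
      by (simp add: bump_translate[abs_def, symmetric] bump_translate[symmetric])
    from frechet_derivative_at[OF this] show ?thesis by (metis d_def)
  qed
  \<comment> \<open>Moving the bump along v is written as an integral over s of its directional
    derivative; at each s the weak identity can then be applied.\<close>
  have ftc: "bump (y + v) \<epsilon> x - bump y \<epsilon> x = (\<integral>s. indicator {0..1} s *\<^sub>R - d (x - s *\<^sub>R v) \<partial>lborel)" for x
  proof -
    have "((\<lambda>s. bump y \<epsilon> (x - s *\<^sub>R v)) has_vector_derivative - d (x - s *\<^sub>R v)) (at s within {0..1})" for s
    proof -
      have "((\<lambda>s. bump y \<epsilon> (x - s *\<^sub>R v)) has_derivative (\<lambda>h. frechet_derivative (bump y \<epsilon>) (at (x - s *\<^sub>R v)) (- (h *\<^sub>R v)))) (at s within {0..1})"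
        by (rule has_derivative_compose[OF _ bump_has_derivative]) (auto intro!: derivative_eq_intros)
      moreover have "frechet_derivative (bump y \<epsilon>) (at (x - s *\<^sub>R v)) (- (h *\<^sub>R v)) = h *\<^sub>R - d (x - s *\<^sub>R v)" for h
      proof -
        interpret L: bounded_linear "frechet_derivative (bump y \<epsilon>) (at (x - s *\<^sub>R v))"
          by (rule has_derivative_bounded_linear[OF bump_has_derivative])
        show ?thesis by (simp only: L.neg L.scaleR d_def scaleR_minus_right)
      qed
      ultimately show ?thesis by (simp add: has_vector_derivative_def)
    qed
    moreover have "continuous_on {0..1} (\<lambda>s. - d (x - s *\<^sub>R v))"
      unfolding d_def by (intro continuous_intros continuous_on_compose2[OF bump_derivative_continuous[of UNIV]]) auto
    ultimately have "(\<integral>s. indicator {0..1} s *\<^sub>R - d (x - s *\<^sub>R v) \<partial>lborel) = bump y \<epsilon> (x - 1 *\<^sub>R v) - bump y \<epsilon> (x - 0 *\<^sub>R v)"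
      by (intro integral_FTC_atLeastAtMost) auto
    then show ?thesis by (simp add: bump_translate)
  qed
  have intG: "integrable (lborel \<Otimes>\<^sub>M lborel) (\<lambda>(x, s). bump y \<epsilon> x *\<^sub>R (indicator {0..1::real} s *\<^sub>R G (x + s *\<^sub>R v)))"
  proof -
    have "integrable (lborel \<Otimes>\<^sub>M lborel) (\<lambda>z. bump y \<epsilon> (fst z) *\<^sub>R (case z of (x, s) \<Rightarrow> indicator {0..1::real} s *\<^sub>R G (x + s *\<^sub>R v)))"
      by (rule integrable_bounded_mult[OF integrable_segment[OF G], where B=1]) (use b1 in auto)
    then show ?thesis by (simp add: case_prod_unfold)
  qed
  have intF: "integrable (lborel \<Otimes>\<^sub>M lborel) (\<lambda>(x, s). (indicator {0..1::real} s * - d (x - s *\<^sub>R v)) *\<^sub>R F x)"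
  proof -
    have "integrable (lborel \<Otimes>\<^sub>M lborel) (\<lambda>z. (- d (fst z - snd z *\<^sub>R v)) *\<^sub>R (case z of (x, s) \<Rightarrow> indicator {0..1::real} s *\<^sub>R F (x + s *\<^sub>R (0::'a))))"
      by (rule integrable_bounded_mult[OF integrable_segment[OF F], where B=B]) (use B in auto)
    then show ?thesis by (simp add: case_prod_unfold mult.commute)
  qed
  have "(\<integral>x. bump y \<epsilon> x *\<^sub>R F (x + v) \<partial>lborel) = (\<integral>x. bump (y + v) \<epsilon> (x + v) *\<^sub>R F (x + v) \<partial>lborel)"
    by (simp add: bump_translate)
  also have "\<dots> = (\<integral>x. bump (y + v) \<epsilon> x *\<^sub>R F x \<partial>lborel)"
    by (rule integral_translate[of "\<lambda>x. bump (y + v) \<epsilon> x *\<^sub>R F x"]) measurable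
  finally have "(\<integral>x. bump y \<epsilon> x *\<^sub>R F (x + v) \<partial>lborel) - (\<integral>x. bump y \<epsilon> x *\<^sub>R F x \<partial>lborel)
    = (\<integral>x. (bump (y + v) \<epsilon> x - bump y \<epsilon> x) *\<^sub>R F x \<partial>lborel)"
    using dB[OF F] by (simp add: scaleR_diff_left Bochner_Integration.integral_diff)
  also have "\<dots> = (\<integral>x. (\<integral>s. (indicator {0..1} s * - d (x - s *\<^sub>R v)) *\<^sub>R F x \<partial>lborel) \<partial>lborel)"
  proof (rule Bochner_Integration.integral_cong[OF refl])
    fix x
    have "integrable lborel (\<lambda>s. indicator {0..1} s *\<^sub>R - d (x - s *\<^sub>R v))"
      unfolding d_def using borel_integrable_atLeastAtMost'[of 0 1 "\<lambda>s. - d (x - s *\<^sub>R v)"]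
      unfolding d_def set_integrable_def
      by (elim meta_mp) (intro continuous_intros continuous_on_compose2[OF bump_derivative_continuous[of UNIV]], auto)
    then show "(bump (y + v) \<epsilon> x - bump y \<epsilon> x) *\<^sub>R F x = (\<integral>s. (indicator {0..1} s * - d (x - s *\<^sub>R v)) *\<^sub>R F x \<partial>lborel)"
      unfolding ftc by (subst integral_scaleR_left) (auto simp: real_scaleR_def)
  qed
  also have "\<dots> = (\<integral>s. (\<integral>x. (indicator {0..1} s * - d (x - s *\<^sub>R v)) *\<^sub>R F x \<partial>lborel) \<partial>lborel)"
    by (rule lborel_pair.Fubini_integral[symmetric]) (rule intF)
  \<comment> \<open>For fixed s the weak identity is tested with the bump centred at
    \<open>y + s *\<^sub>R v\<close>; translating x by \<open>s *\<^sub>R v\<close> then moves the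
    shift from the bump to G.\<close>
  also have "\<dots> = (\<integral>s. (\<integral>x. bump y \<epsilon> x *\<^sub>R (indicator {0..1} s *\<^sub>R G (x + s *\<^sub>R v)) \<partial>lborel) \<partial>lborel)"
  proof (rule Bochner_Integration.integral_cong[OF refl])
    fix s :: real
    show "(\<integral>x. (indicator {0..1} s * - d (x - s *\<^sub>R v)) *\<^sub>R F x \<partial>lborel) = (\<integral>x. bump y \<epsilon> x *\<^sub>R (indicator {0..1} s *\<^sub>R G (x + s *\<^sub>R v)) \<partial>lborel)"
    proof (cases "s \<in> {0..1}")
      case True
      have "(\<integral>x. (indicator {0..1} s * - d (x - s *\<^sub>R v)) *\<^sub>R F x \<partial>lborel) = - (\<integral>x. d (x - s *\<^sub>R v) *\<^sub>R F x \<partial>lborel)"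
        using True by simp
      also have "\<dots> = (\<integral>x. bump (y + s *\<^sub>R v) \<epsilon> x *\<^sub>R G x \<partial>lborel)"
        using weak[OF test[OF True]] by (simp add: der)
      also have "\<dots> = (\<integral>x. bump (y + s *\<^sub>R v) \<epsilon> (x + s *\<^sub>R v) *\<^sub>R G (x + s *\<^sub>R v) \<partial>lborel)"
        by (rule integral_translate[of "\<lambda>x. bump (y + s *\<^sub>R v) \<epsilon> x *\<^sub>R G x", symmetric]) measurable
      finally show ?thesis using True by (simp add: bump_translate)
    qed simp
  qed
  also have "\<dots> = (\<integral>x. (\<integral>s. bump y \<epsilon> x *\<^sub>R (indicator {0..1} s *\<^sub>R G (x + s *\<^sub>R v)) \<partial>lborel) \<partial>lborel)"
    by (rule lborel_pair.Fubini_integral) (rule intG)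
  also have "\<dots> = (\<integral>x. bump y \<epsilon> x *\<^sub>R (\<integral>s. indicator {0..1} s *\<^sub>R G (x + s *\<^sub>R v) \<partial>lborel) \<partial>lborel)"
    by (simp only: integral_scaleR_right)
  finally have *: "(\<integral>x. bump y \<epsilon> x *\<^sub>R F (x + v) \<partial>lborel) - (\<integral>x. bump y \<epsilon> x *\<^sub>R F x \<partial>lborel)
    = (\<integral>x. bump y \<epsilon> x *\<^sub>R (\<integral>s. indicator {0..1} s *\<^sub>R G (x + s *\<^sub>R v) \<partial>lborel) \<partial>lborel)" .
  show ?thesis
    using * dB[OF F] dB[OF integrable_translate[OF F, of v]] dB[OF lborel_pair.integrable_fst[OF integrable_segment[OF G, of v]]]
    by (simp add: scaleR_diff_right Bochner_Integration.integral_diff)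
qed

text \<open>The defect H of the identity has zero integral against all small bumps. At a Lebesgue
  point H is nearly constant on a small ball, and a bump carries a fixed fraction of the volume of
  the ball, so H vanishes there. The exceptional set depends on v.\<close>

theorem weak_derivative_AE_FTC:
  fixes F G :: "'a::euclidean_space \<Rightarrow> 'b::euclidean_space"
  assumes F: "integrable lborel F" and G: "integrable lborel G"
    and weak: "\<And>\<phi>. test_fun U \<phi> \<Longrightarrow>
      (\<integral>x. frechet_derivative \<phi> (at x) v *\<^sub>R F x \<partial>lborel) = - (\<integral>x. \<phi> x *\<^sub>R G x \<partial>lborel)"
    and U: "convex U" "open U"
  shows "AE x in lborel. x \<in> U \<and> x + v \<in> U \<longrightarrow>
    F (x + v) - F x = (\<integral>s. indicator {0..1} s *\<^sub>R G (x + s *\<^sub>R v) \<partial>lborel)"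
proof -
  define H where "H x = F (x + v) - F x - (\<integral>s. indicator {0..1} s *\<^sub>R G (x + s *\<^sub>R v) \<partial>lborel)" for x
  have H: "integrable lborel H" unfolding H_def
    using integrable_translate[OF F, of v] F lborel_pair.integrable_fst[OF integrable_segment[OF G, of v]]
    by simp
  have Hm[measurable]: "H \<in> borel_measurable borel" using H by (simp add: borel_measurable_integrable)
  show ?thesis
    using lebesgue_differentiation[OF H]
  proof (rule AE_mp, intro AE_I2 impI)
    fix x assume leb: "lebesgue_point H x"
    assume x: "x \<in> U \<and> x + v \<in> U"
    have "H x = 0"
    proof (rule ccontr)
      assume "H x \<noteq> 0"
      \<comment> \<open>The fraction of the ball volume carried by a bump: at least exp(-4/3) on the
        half ball, whose relative volume is (1/2)^\<open>DIM('a)\<close>.\<close>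
      define \<kappa> :: real where "\<kappa> = exp (- 4 / 3) * (1 / 2) ^ DIM('a)"
      have \<kappa>: "\<kappa> > 0" by (simp add: \<kappa>_def)
      \<comment> \<open>Half of the mean that a constant value \<open>H x\<close> would produce
        against the bump, hence a contradiction.\<close>
      define e where "e = norm (H x) * \<kappa> / 2"
      have e: "e > 0" using \<open>H x \<noteq> 0\<close> \<kappa> by (simp add: e_def)
      obtain R where R: "R > 0" "\<And>r. 0 < r \<Longrightarrow> r < R \<Longrightarrow>
        (\<integral>\<^sup>+y\<in>cball x r. ennreal (norm (H y - H x)) \<partial>lborel) \<le> ennreal e * emeasure lborel (cball x r)"
        using leb e unfolding lebesgue_point_def by blast
      obtain e1 where e1: "e1 > 0" "cball x e1 \<subseteq> U" using U(2) x open_contains_cball by blast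
      obtain e2 where e2: "e2 > 0" "cball (x + v) e2 \<subseteq> U" using U(2) x open_contains_cball by blast
      define \<epsilon> where "\<epsilon> = min (R / 2) (min e1 e2)"
      have \<epsilon>: "\<epsilon> > 0" "\<epsilon> < R" using R e1 e2 by (auto simp: \<epsilon>_def)
      have sub: "cball x \<epsilon> \<subseteq> U" "cball (x + v) \<epsilon> \<subseteq> U"
        using e1 e2 by (auto simp: \<epsilon>_def subset_eq)
      define b where "b = bump x \<epsilon>"
      define m where "m = measure lborel (cball x \<epsilon>)"
      have m: "m > 0" "emeasure lborel (cball x \<epsilon>) = ennreal m"
        using \<epsilon> by (simp_all add: m_def emeasure_cball content_cball)
      have bm[measurable]: "b \<in> borel_measurable borel" unfolding b_def
        by (intro borel_measurable_continuous_onI exp_poly_continuous exp_poly_bump)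
      have b01: "0 \<le> b y" "b y \<le> 1" "b y \<le> indicator (cball x \<epsilon>) y" for y
        using bump_nonneg[of x \<epsilon> y] bump_le_1[of x \<epsilon> y] bump_eq_0[OF \<epsilon>(1), of y x] by (auto simp: b_def indicator_def)
      have bint: "integrable lborel b"
      proof (rule Bochner_Integration.integrable_bound[of lborel "indicator (cball x \<epsilon>) :: 'a \<Rightarrow> real"])
        show "integrable lborel (indicator (cball x \<epsilon>) :: 'a \<Rightarrow> real)"
          using emeasure_lborel_cball_finite[of x \<epsilon>] by simp
      qed (use b01 in auto)
      have bH: "integrable lborel (\<lambda>y. b y *\<^sub>R H y)"
        using b01 by (intro integrable_bounded_mult[OF H, where B=1]) auto
      have bHx: "integrable lborel (\<lambda>y. b y *\<^sub>R H x)" using bint by simp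
      have zero: "(\<integral>y. b y *\<^sub>R H y \<partial>lborel) = 0"
        unfolding H_def b_def
        by (rule weak_derivative_bump_average[OF F G weak U(1) \<epsilon>(1) sub])
      have "(\<integral>y. b y *\<^sub>R (H y - H x) \<partial>lborel) = - (integral\<^sup>L lborel b *\<^sub>R H x)"
        using bH bHx zero integral_scaleR_left[of "H x" lborel b] bint
        by (simp add: scaleR_diff_right Bochner_Integration.integral_diff)
      then have "ennreal (integral\<^sup>L lborel b * norm (H x)) = ennreal (norm (\<integral>y. b y *\<^sub>R (H y - H x) \<partial>lborel))"
        using b01 by (simp add: integral_nonneg_AE)
      also have "\<dots> \<le> (\<integral>\<^sup>+y. ennreal (norm (b y *\<^sub>R (H y - H x))) \<partial>lborel)"
        using bH bHx by (intro integral_norm_bound_ennreal) (simp add: scaleR_diff_right)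
      also have "\<dots> \<le> (\<integral>\<^sup>+y\<in>cball x \<epsilon>. ennreal (norm (H y - H x)) \<partial>lborel)"
      proof (rule nn_integral_mono)
        fix y
        show "ennreal (norm (b y *\<^sub>R (H y - H x))) \<le> ennreal (norm (H y - H x)) * indicator (cball x \<epsilon>) y"
          using b01[of y] mult_right_mono[of "b y" 1 "norm (H y - H x)"] by (auto simp: indicator_def split: if_splits)
      qed
      also have "\<dots> \<le> ennreal e * emeasure lborel (cball x \<epsilon>)" using R(2) \<epsilon> by blast
      also have "\<dots> = ennreal (e * m)" using m e by (simp add: ennreal_mult)
      finally have le: "integral\<^sup>L lborel b * norm (H x) \<le> e * m"
        using e m by (subst (asm) ennreal_le_iff) auto
      have "\<kappa> * m = (\<integral>y. exp (- 4 / 3) * indicator (cball x (\<epsilon> / 2)) y \<partial>lborel)"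
        using \<epsilon> by (simp add: \<kappa>_def m_def content_cball power_divide)
      also have "\<dots> \<le> integral\<^sup>L lborel b"
      proof (rule integral_mono)
        show "integrable lborel (\<lambda>y. exp (- 4 / 3) * indicat_real (cball x (\<epsilon> / 2)) y)"
          using emeasure_lborel_cball_finite[of x "\<epsilon> / 2"] by simp
        show "exp (- 4 / 3) * indicat_real (cball x (\<epsilon> / 2)) y \<le> b y" for y
          using bump_ge_half[OF \<epsilon>(1), of y x] b01[of y] by (auto simp: b_def indicator_def)
      qed (rule bint)
      finally have "\<kappa> * m * norm (H x) \<le> e * m" using le \<open>H x \<noteq> 0\<close>
        by (meson mult_right_mono norm_ge_zero order_trans)
      then show False using m(1) \<kappa> \<open>H x \<noteq> 0\<close> by (simp add: e_def)
    qed
    then show "F (x + v) - F x = (\<integral>s. indicator {0..1} s *\<^sub>R G (x + s *\<^sub>R v) \<partial>lborel)"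
      by (simp add: H_def)
  qed
qed

subsection \<open>Lipschitz estimates at points of small average oscillation\<close>

lemma nn_integral_affine:
  fixes h :: "'a::euclidean_space \<Rightarrow> ennreal"
  assumes [measurable]: "h \<in> borel_measurable borel" and s: "s > 0"
  shows "ennreal (s ^ DIM('a)) * (\<integral>\<^sup>+v. h (x + s *\<^sub>R v) \<partial>lborel) = (\<integral>\<^sup>+y. h y \<partial>lborel)"
proof -
  have "(\<integral>\<^sup>+y. h y \<partial>lborel) = (\<integral>\<^sup>+y. h y \<partial>density (distr lborel borel (\<lambda>v. x + s *\<^sub>R v)) (\<lambda>_. ennreal (\<bar>s\<bar> ^ DIM('a))))"
    using lborel_affine[of s x] s by simp
  also have "\<dots> = (\<integral>\<^sup>+y. ennreal (\<bar>s\<bar> ^ DIM('a)) * h y \<partial>distr lborel borel (\<lambda>v. x + s *\<^sub>R v))"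
    by (subst nn_integral_density) auto
  also have "\<dots> = (\<integral>\<^sup>+v. ennreal (\<bar>s\<bar> ^ DIM('a)) * h (x + s *\<^sub>R v) \<partial>lborel)"
    by (subst nn_integral_distr) auto
  also have "\<dots> = ennreal (s ^ DIM('a)) * (\<integral>\<^sup>+v. h (x + s *\<^sub>R v) \<partial>lborel)"
    using s by (subst nn_integral_cmult) auto
  finally show ?thesis by simp
qed

text \<open>After exchanging the integrals, the inner one at a fixed s > 0 runs over the ball of
  radius s r. The Jacobian of the dilation cancels the factor s^\<open>DIM('a)\<close> in its
  volume, so \<open>\<eta>\<close> is preserved without loss.\<close>

lemma nn_integral_cball_segments_le:
  fixes g :: "'a::euclidean_space \<Rightarrow> ennreal"
  assumes g[measurable]: "g \<in> borel_measurable borel" and r: "0 < r" "r < R"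
    and avg: "\<And>r. 0 < r \<Longrightarrow> r < R \<Longrightarrow> (\<integral>\<^sup>+y\<in>cball x r. g y \<partial>lborel) \<le> ennreal \<eta> * emeasure lborel (cball x r)"
  shows "(\<integral>\<^sup>+v\<in>cball 0 r. (\<integral>\<^sup>+s\<in>{0..1::real}. g (x + s *\<^sub>R v) \<partial>lborel) \<partial>lborel) \<le> ennreal \<eta> * emeasure lborel (cball x r)"
proof -
  have [measurable]: "cball (z::'a) t \<in> sets borel" for z t by simp
  have "(\<integral>\<^sup>+v\<in>cball 0 r. (\<integral>\<^sup>+s\<in>{0..1::real}. g (x + s *\<^sub>R v) \<partial>lborel) \<partial>lborel) =
    (\<integral>\<^sup>+v. (\<integral>\<^sup>+s. g (x + s *\<^sub>R v) * indicator {0..1::real} s * indicator (cball 0 r) v \<partial>lborel) \<partial>lborel)"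
    by (intro nn_integral_cong nn_integral_multc[symmetric]) measurable
  also have "\<dots> = (\<integral>\<^sup>+s. (\<integral>\<^sup>+v. g (x + s *\<^sub>R v) * indicator {0..1::real} s * indicator (cball 0 r) v \<partial>lborel) \<partial>lborel)"
    by (rule lborel_pair.Fubini'[symmetric]) measurable
  also have "\<dots> \<le> (\<integral>\<^sup>+s. ennreal \<eta> * emeasure lborel (cball x r) * indicator {0..1::real} s \<partial>lborel)"
  proof (rule nn_integral_mono_AE)
    have "AE s in lborel. s \<noteq> (0::real)" by (rule AE_lborel_singleton)
    then show "AE s in lborel. (\<integral>\<^sup>+v. g (x + s *\<^sub>R v) * indicator {0..1::real} s * indicator (cball 0 r) v \<partial>lborel)
      \<le> ennreal \<eta> * emeasure lborel (cball x r) * indicator {0..1::real} s"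
    proof eventually_elim
      case (elim s)
      show ?case
      proof (cases "s \<in> {0..1}")
        case True
        then have s: "0 < s" "s \<le> 1" using elim by auto
        have "ennreal (s ^ DIM('a)) * (\<integral>\<^sup>+v. g (x + s *\<^sub>R v) * indicator (cball x (s * r)) (x + s *\<^sub>R v) \<partial>lborel)
          = (\<integral>\<^sup>+y. g y * indicator (cball x (s * r)) y \<partial>lborel)"
          using s by (intro nn_integral_affine[of "\<lambda>y. g y * indicator (cball x (s * r)) y"]) auto
        also have "\<dots> \<le> ennreal \<eta> * emeasure lborel (cball x (s * r))"
        proof (rule avg)
          show "0 < s * r" using s r by simp
          have "s * r \<le> 1 * r" using s r by (intro mult_right_mono) auto
          then show "s * r < R" using r(2) by linarith
        qed
        also have "\<dots> = ennreal (s ^ DIM('a)) * (ennreal \<eta> * emeasure lborel (cball x r))"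
          using s r by (subst emeasure_cball_scale[of _ _ x x]) (auto simp: mult_ac)
        finally have "(\<integral>\<^sup>+v. g (x + s *\<^sub>R v) * indicator (cball x (s * r)) (x + s *\<^sub>R v) \<partial>lborel)
          \<le> ennreal \<eta> * emeasure lborel (cball x r)"
          using s by (subst (asm) ennreal_mult_le_mult_iff) auto
        moreover have "indicator (cball x (s * r)) (x + s *\<^sub>R v) = (indicator (cball 0 r) v :: ennreal)" for v
          using s by (auto simp: indicator_def dist_norm)
        ultimately show ?thesis using True by simp
      qed simp
    qed
  qed
  also have "\<dots> = ennreal \<eta> * emeasure lborel (cball x r)" by (simp add: nn_integral_cmult_indicator)
  finally show ?thesis .
qed

text \<open>Averaging the triangle inequality through a common point of the two balls replaces the usual maximal function argument.\<close>

lemma lipschitz_at_good_points: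
  fixes u :: "'a::euclidean_space \<Rightarrow> 'b::euclidean_space"
  assumes u[measurable]: "u \<in> borel_measurable borel"
    and good: "\<And>z. z \<in> {x, x'} \<Longrightarrow>
      (\<integral>\<^sup>+v\<in>cball 0 (dist x x'). ennreal (norm (u (z + v) - u z)) \<partial>lborel) \<le> ennreal (dist x x' * \<eta>) * emeasure lborel (cball z (dist x x'))"
    and \<eta>: "\<eta> \<ge> 0"
  shows "norm (u x - u x') \<le> 2 ^ (DIM('a) + 1) * \<eta> * dist x x'"
proof (cases "x = x'")
  case False
  define r where "r = dist x x'"
  have r: "r > 0" using False by (simp add: r_def)
  define c where "c = midpoint x x'"
  have c: "cball c (r / 2) \<subseteq> cball x r" "cball c (r / 2) \<subseteq> cball x' r"
  proof -
    have "dist x c = r / 2" "dist x' c = r / 2" by (simp_all add: c_def r_def dist_midpoint)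
    then have *: "dist x y \<le> r" "dist x' y \<le> r" if "dist c y \<le> r / 2" for y
      using that dist_triangle[of x y c] dist_triangle[of x' y c] by linarith+
    then show "cball c (r / 2) \<subseteq> cball x r" "cball c (r / 2) \<subseteq> cball x' r"
      by (auto simp: subset_eq)
  qed
  have [measurable]: "cball (z::'a) t \<in> sets borel" for z t by simp
  have ball: "(\<integral>\<^sup>+y\<in>cball c (r / 2). ennreal (norm (u y - u z)) \<partial>lborel) \<le> ennreal (r * \<eta>) * emeasure lborel (cball x r)"
    if z: "z \<in> {x, x'}" for z
  proof -
    have "(\<integral>\<^sup>+y\<in>cball c (r / 2). ennreal (norm (u y - u z)) \<partial>lborel) \<le> (\<integral>\<^sup>+y\<in>cball z r. ennreal (norm (u y - u z)) \<partial>lborel)"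
      using c z by (intro nn_integral_mono) (auto simp: indicator_def)
    also have "\<dots> = (\<integral>\<^sup>+v. ennreal (norm (u (v + z) - u z)) * indicator (cball z r) (v + z) \<partial>lborel)"
      by (rule nn_integral_translate[of "\<lambda>y. ennreal (norm (u y - u z)) * indicator (cball z r) y", symmetric]) measurable
    also have "\<dots> = (\<integral>\<^sup>+v\<in>cball 0 r. ennreal (norm (u (z + v) - u z)) \<partial>lborel)"
      by (intro nn_integral_cong) (auto simp: indicator_def dist_norm add.commute)
    also have "\<dots> \<le> ennreal (r * \<eta>) * emeasure lborel (cball z r)"
      using good[OF z] by (simp add: r_def)
    also have "emeasure lborel (cball z r) = emeasure lborel (cball x r)"
      using r by (simp add: emeasure_cball)
    finally show ?thesis .
  qed
  have "ennreal (norm (u x - u x')) * emeasure lborel (cball c (r / 2)) = (\<integral>\<^sup>+y\<in>cball c (r / 2). ennreal (norm (u x - u x')) \<partial>lborel)"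
    by (simp add: nn_integral_cmult_indicator)
  also have "\<dots> \<le> (\<integral>\<^sup>+y. ennreal (norm (u y - u x)) * indicator (cball c (r / 2)) y + ennreal (norm (u y - u x')) * indicator (cball c (r / 2)) y \<partial>lborel)"
  proof (rule nn_integral_mono)
    fix y
    have "norm (u x - u x') \<le> norm (u y - u x) + norm (u y - u x')"
      using norm_triangle_ineq4[of "u y - u x'" "u y - u x"] by simp
    then show "ennreal (norm (u x - u x')) * indicator (cball c (r / 2)) y \<le>
      ennreal (norm (u y - u x)) * indicator (cball c (r / 2)) y + ennreal (norm (u y - u x')) * indicator (cball c (r / 2)) y"
      by (auto simp: indicator_def ennreal_plus[symmetric] simp del: ennreal_plus intro!: ennreal_leI)
  qed
  also have "\<dots> \<le> ennreal (r * \<eta>) * emeasure lborel (cball x r) + ennreal (r * \<eta>) * emeasure lborel (cball x r)"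
    by (subst nn_integral_add) (measurable, intro add_mono ball, simp_all)
  \<comment> \<open>The balls around x and x' have 2^\<open>DIM('a)\<close> times the volume of the
    common half ball, and there are two of them; hence the exponent
    \<open>DIM('a) + 1\<close>.\<close>
  also have "emeasure lborel (cball x r) = ennreal (2 ^ DIM('a)) * emeasure lborel (cball c (r / 2))"
    using emeasure_cball_scale[of "r / 2" 2 x c] r by simp
  also have "ennreal (r * \<eta>) * (ennreal (2 ^ DIM('a)) * emeasure lborel (cball c (r / 2))) +
      ennreal (r * \<eta>) * (ennreal (2 ^ DIM('a)) * emeasure lborel (cball c (r / 2)))
    = ennreal (2 ^ (DIM('a) + 1) * \<eta> * r) * emeasure lborel (cball c (r / 2))"
  proof -
    have "ennreal (2 ^ (DIM('a) + 1) * \<eta> * r) = ennreal (r * \<eta>) * ennreal (2 ^ DIM('a)) + ennreal (r * \<eta>) * ennreal (2 ^ DIM('a))"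
      using \<eta> r by (simp add: ennreal_mult[symmetric] ennreal_plus[symmetric] mult_ac del: ennreal_plus)
    then show ?thesis by (simp add: distrib_right mult.assoc)
  qed
  finally have le: "ennreal (norm (u x - u x')) * emeasure lborel (cball c (r / 2))
     \<le> ennreal (2 ^ (DIM('a) + 1) * \<eta> * r) * emeasure lborel (cball c (r / 2))" .
  obtain m where m: "m > 0" "emeasure lborel (cball c (r / 2)) = ennreal m"
    using r that[of "measure lborel (cball c (r / 2))"] by (auto simp: emeasure_cball content_cball)
  from le have "norm (u x - u x') * m \<le> 2 ^ (DIM('a) + 1) * \<eta> * r * m"
    unfolding m using m(1) \<eta> r by (simp add: ennreal_mult[symmetric])
  then show ?thesis using m(1) by (simp add: r_def)
qed simp

text \<open>The hypothesis has a null set of x for every v. Fubini exchanges the quantifiers: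
  outside a single null set N the bound holds for almost every v, which is enough because v is only
  averaged. N depends neither on the points nor on \<open>\<eta>\<close> and R.\<close>

theorem lipschitz_of_segment_bound:
  fixes u :: "'a::euclidean_space \<Rightarrow> 'b::euclidean_space" and g :: "'a \<Rightarrow> ennreal"
  assumes u[measurable]: "u \<in> borel_measurable borel" and g[measurable]: "g \<in> borel_measurable borel"
    and U: "open U"
    and seg: "\<And>v. AE x in lborel. x \<in> U \<and> x + v \<in> U \<longrightarrow>
      ennreal (norm (u (x + v) - u x)) \<le> ennreal (norm v) * (\<integral>\<^sup>+s\<in>{0..1::real}. g (x + s *\<^sub>R v) \<partial>lborel)"
  shows "\<exists>N. N \<in> null_sets lborel \<and> (\<forall>\<eta> R x x'. x \<notin> N \<and> x' \<notin> N \<and> 0 \<le> \<eta> \<and> dist x x' < R \<and>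
      ball x R \<subseteq> U \<and> ball x' R \<subseteq> U \<and>
      averages_le g x \<eta> R \<and>
      averages_le g x' \<eta> R
      \<longrightarrow> norm (u x - u x') \<le> 2 ^ (DIM('a) + 1) * \<eta> * dist x x')"
proof -
  let ?P = "\<lambda>x v. x \<in> U \<and> x + v \<in> U \<longrightarrow>
      ennreal (norm (u (x + v) - u x)) \<le> ennreal (norm v) * (\<integral>\<^sup>+s\<in>{0..1::real}. g (x + s *\<^sub>R v) \<partial>lborel)"
  have [measurable]: "U \<in> sets borel" using U by simp
  have m: "Measurable.pred (lborel \<Otimes>\<^sub>M lborel) (\<lambda>z. ?P (fst z) (snd z))" by measurable
  have "AE v in lborel. AE x in lborel. ?P x v" using seg by simp
  then have "AE x in lborel. AE v in lborel. ?P x v"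
    using lborel_pair.AE_commute[of ?P] m by (simp add: case_prod_unfold pred_def space_pair_measure)
  then obtain N where N: "N \<in> null_sets lborel" "{x. \<not> (AE v in lborel. ?P x v)} \<subseteq> N"
    by (auto simp: eventually_ae_filter)
  show ?thesis
  proof (intro exI[of _ N] conjI allI impI N(1), elim conjE)
    fix \<eta> R :: real and x x' :: 'a
    assume NN: "x \<notin> N" "x' \<notin> N" and \<eta>: "0 \<le> \<eta>" and R: "dist x x' < R" and BU: "ball x R \<subseteq> U" "ball x' R \<subseteq> U"
      and avg: "averages_le g x \<eta> R"
       "averages_le g x' \<eta> R"
    show "norm (u x - u x') \<le> 2 ^ (DIM('a) + 1) * \<eta> * dist x x'"
    proof (cases "x = x'")
      case False
      define r where "r = dist x x'"
      have r: "0 < r" "r < R" using False R by (auto simp: r_def)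
      have [measurable]: "cball (z::'a) t \<in> sets borel" for z t by simp
      show ?thesis
      proof (rule lipschitz_at_good_points[OF u _ \<eta>], fold r_def)
        fix z assume z: "z \<in> {x, x'}"
        then have zN: "AE v in lborel. ?P z v" using N NN by auto
        have avz: "(\<integral>\<^sup>+y\<in>cball z r. g y \<partial>lborel) \<le> ennreal \<eta> * emeasure lborel (cball z r)" if "0 < r" "r < R" for r
          using z avg that by auto
        have zU: "z \<in> U" "\<And>v. v \<in> cball 0 r \<Longrightarrow> z + v \<in> U"
          using z BU r by (auto simp: subset_eq dist_norm)
        have "(\<integral>\<^sup>+v\<in>cball 0 r. ennreal (norm (u (z + v) - u z)) \<partial>lborel)
          \<le> (\<integral>\<^sup>+v. ennreal r * ((\<integral>\<^sup>+s\<in>{0..1::real}. g (z + s *\<^sub>R v) \<partial>lborel) * indicator (cball 0 r) v) \<partial>lborel)"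
        proof (rule nn_integral_mono_AE, use zN in eventually_elim)
          case (elim v)
          show ?case
          proof (cases "v \<in> cball 0 r")
            case True
            then have "ennreal (norm (u (z + v) - u z)) \<le> ennreal (norm v) * (\<integral>\<^sup>+s\<in>{0..1::real}. g (z + s *\<^sub>R v) \<partial>lborel)"
              using elim zU by auto
            also have "\<dots> \<le> ennreal r * (\<integral>\<^sup>+s\<in>{0..1::real}. g (z + s *\<^sub>R v) \<partial>lborel)"
              using True by (intro mult_right_mono ennreal_leI) auto
            finally show ?thesis using True by simp
          qed simp
        qed
        also have "\<dots> = ennreal r * (\<integral>\<^sup>+v\<in>cball 0 r. (\<integral>\<^sup>+s\<in>{0..1::real}. g (z + s *\<^sub>R v) \<partial>lborel) \<partial>lborel)"
          by (rule nn_integral_cmult) measurable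
        also have "\<dots> \<le> ennreal r * (ennreal \<eta> * emeasure lborel (cball z r))"
          by (intro mult_left_mono nn_integral_cball_segments_le[OF g r] avz) auto
        also have "\<dots> = ennreal (r * \<eta>) * emeasure lborel (cball z r)"
          using r \<eta> by (simp add: ennreal_mult mult.assoc)
        finally show "(\<integral>\<^sup>+v\<in>cball 0 r. ennreal (norm (u (z + v) - u z)) \<partial>lborel) \<le> ennreal (r * \<eta>) * emeasure lborel (cball z r)" .
      qed
    qed simp
  qed
qed

subsection \<open>Images of noncontact pieces\<close>

text \<open>Columns of width rho^2 parallel to axis k: the other coordinates vary over a range of
  order rho, so each of these m - 1 directions meets O(1/rho) cells, while direction k is collapsed
  to a single index.\<close>

lemma card_grid_cells_le:
  fixes A :: "(real^'m) set" and y0 :: "real^'m" and k :: 'm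
  assumes \<rho>: "0 < \<rho>" "\<rho> \<le> 1" and c: "c \<ge> 0" and A: "\<And>y j. y \<in> A \<Longrightarrow> \<bar>y $ j - y0 $ j\<bar> \<le> c * \<rho>"
  defines "\<kappa> \<equiv> \<lambda>y j. if j = k then 0 else \<lfloor>y $ j / \<rho>\<^sup>2\<rfloor>"
  shows "finite (\<kappa> ` A)" "real (card (\<kappa> ` A)) \<le> ((2 * c + 2) / \<rho>) ^ (CARD('m) - 1)"
proof -
  define lo where "lo j = \<lfloor>y0 $ j / \<rho>\<^sup>2 - c / \<rho>\<rfloor>" for j
  define hi where "hi j = \<lfloor>y0 $ j / \<rho>\<^sup>2 + c / \<rho>\<rfloor>" for j
  define I where "I j = (if j = k then {0} else {lo j..hi j})" for j
  have sub: "\<kappa> ` A \<subseteq> Pi\<^sub>E UNIV I"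
  proof
    fix f assume "f \<in> \<kappa> ` A"
    then obtain y where y: "y \<in> A" "f = \<kappa> y" by blast
    have "f j \<in> I j" for j
    proof (cases "j = k")
      case False
      have "c * \<rho> / \<rho>\<^sup>2 = c / \<rho>" using \<rho> by (simp add: power2_eq_square)
      then have 1: "(y0 $ j - c * \<rho>) / \<rho>\<^sup>2 = y0 $ j / \<rho>\<^sup>2 - c / \<rho>" "(y0 $ j + c * \<rho>) / \<rho>\<^sup>2 = y0 $ j / \<rho>\<^sup>2 + c / \<rho>"
        by (simp_all add: diff_divide_distrib add_divide_distrib)
      have "y0 $ j - c * \<rho> \<le> y $ j" "y $ j \<le> y0 $ j + c * \<rho>" using A[OF y(1), of j] by auto
      then have "(y0 $ j - c * \<rho>) / \<rho>\<^sup>2 \<le> y $ j / \<rho>\<^sup>2" "y $ j / \<rho>\<^sup>2 \<le> (y0 $ j + c * \<rho>) / \<rho>\<^sup>2"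
        by (auto intro: divide_right_mono)
      then have "lo j \<le> \<lfloor>y $ j / \<rho>\<^sup>2\<rfloor>" "\<lfloor>y $ j / \<rho>\<^sup>2\<rfloor> \<le> hi j"
        unfolding 1 lo_def hi_def by (auto intro: floor_mono)
      then show ?thesis using False y by (simp add: I_def \<kappa>_def)
    qed (simp add: I_def \<kappa>_def y)
    then show "f \<in> Pi\<^sub>E UNIV I" by auto
  qed
  have finI: "finite (Pi\<^sub>E UNIV I)" by (intro finite_PiE) (auto simp: I_def)
  then show "finite (\<kappa> ` A)" using sub finite_subset by blast
  have cI: "real (card (I j)) \<le> (2 * c + 2) / \<rho>" if "j \<noteq> k" for j
  proof -
    have "of_int (hi j) \<le> y0 $ j / \<rho>\<^sup>2 + c / \<rho>" "y0 $ j / \<rho>\<^sup>2 - c / \<rho> < of_int (lo j) + 1"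
      unfolding hi_def lo_def by linarith+
    then have "real_of_int (hi j - lo j + 1) \<le> 2 * c / \<rho> + 2" by simp
    moreover have "2 \<le> 2 / \<rho>" using \<rho> by (simp add: le_divide_eq)
    moreover have "0 \<le> 2 * c / \<rho>" using \<rho> c by simp
    ultimately have "max 0 (real_of_int (hi j - lo j + 1)) \<le> (2 * c + 2) / \<rho>" using \<rho>
      by (simp add: add_divide_distrib)
    moreover have "real (nat z) = max 0 (real_of_int z)" for z by linarith
    ultimately show ?thesis using that by (simp only: I_def if_False card_atLeastAtMost_int add.commute diff_add_eq)
  qed
  have "card (\<kappa> ` A) \<le> card (Pi\<^sub>E UNIV I)" by (rule card_mono[OF finI sub])
  also have "\<dots> = (\<Prod>j\<in>UNIV. card (I j))" by (simp add: card_PiE)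
  finally have "real (card (\<kappa> ` A)) \<le> real (\<Prod>j\<in>UNIV. card (I j))" by (simp only: of_nat_le_iff)
  also have "\<dots> = real (card (I k)) * (\<Prod>j\<in>UNIV - {k}. real (card (I j)))"
    by (simp add: prod.remove[of UNIV k])
  also have "\<dots> \<le> 1 * (\<Prod>j\<in>UNIV - {k}. (2 * c + 2) / \<rho>)"
    by (intro mult_mono prod_mono prod_nonneg) (use cI in \<open>auto simp: I_def\<close>)
  also have "\<dots> = ((2 * c + 2) / \<rho>) ^ (CARD('m) - 1)" by (simp add: card_Diff_singleton)
  finally show "real (card (\<kappa> ` A)) \<le> ((2 * c + 2) / \<rho>) ^ (CARD('m) - 1)" .
qed

text \<open>One ball of radius K rho^2 about a chosen point of A covers all of A in its column.
  O(rho^(1-m)) columns, each of volume O(rho^(2m)), give rho^(m+1).\<close>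

lemma thin_set_cover:
  fixes A :: "(real^'m) set"
  assumes \<rho>: "0 < \<rho>" "\<rho> \<le> 1" and c: "c \<ge> 0" and K: "K \<ge> 0"
    and diam: "\<And>y y'. y \<in> A \<Longrightarrow> y' \<in> A \<Longrightarrow> dist y y' \<le> c * \<rho>"
    and thin: "\<And>y y'. y \<in> A \<Longrightarrow> y' \<in> A \<Longrightarrow> (\<And>j. j \<noteq> k \<Longrightarrow> \<bar>y $ j - y' $ j\<bar> \<le> \<rho>\<^sup>2) \<Longrightarrow> dist y y' \<le> K * \<rho>\<^sup>2"
  shows "\<exists>B\<in>sets borel. A \<subseteq> B \<and>
    emeasure lborel B \<le> ennreal (unit_ball_vol (CARD('m)) * K ^ CARD('m) * (2 * c + 2) ^ (CARD('m) - 1) * \<rho> ^ (CARD('m) + 1))"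
proof (cases "A = {}")
  case False
  then obtain y0 where y0: "y0 \<in> A" by blast
  define \<kappa> where "\<kappa> = (\<lambda>y j. if j = k then 0 else \<lfloor>y $ j / \<rho>\<^sup>2\<rfloor>)"
  have A: "\<bar>y $ j - y0 $ j\<bar> \<le> c * \<rho>" if "y \<in> A" for y j
    using diam[OF that y0] component_le_norm_cart[of "y - y0" j] by (simp add: dist_norm)
  note grid = card_grid_cells_le[OF \<rho> c A, of A k, simplified, folded \<kappa>_def]
  define rep where "rep f = (SOME y. y \<in> A \<and> \<kappa> y = f)" for f
  have rep: "rep (\<kappa> y) \<in> A" "\<kappa> (rep (\<kappa> y)) = \<kappa> y" if "y \<in> A" for y
    using someI[of "\<lambda>z. z \<in> A \<and> \<kappa> z = \<kappa> y" y] that by (auto simp: rep_def)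
  define B where "B = (\<Union>f\<in>\<kappa> ` A. cball (rep f) (K * \<rho>\<^sup>2))"
  have "A \<subseteq> B"
  proof
    fix y assume y: "y \<in> A"
    have "dist (rep (\<kappa> y)) y \<le> K * \<rho>\<^sup>2"
    proof (rule thin[OF rep(1)[OF y] y])
      fix j assume "j \<noteq> k"
      then have "\<lfloor>rep (\<kappa> y) $ j / \<rho>\<^sup>2\<rfloor> = \<lfloor>y $ j / \<rho>\<^sup>2\<rfloor>" using fun_cong[OF rep(2)[OF y], of j] by (simp add: \<kappa>_def)
      then have "\<bar>rep (\<kappa> y) $ j / \<rho>\<^sup>2 - y $ j / \<rho>\<^sup>2\<bar> \<le> 1" by linarith
      then have "\<bar>rep (\<kappa> y) $ j - y $ j\<bar> / \<rho>\<^sup>2 \<le> 1"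
        by (simp only: diff_divide_distrib[symmetric] abs_divide) simp
      then show "\<bar>rep (\<kappa> y) $ j - y $ j\<bar> \<le> \<rho>\<^sup>2" using \<rho> by (simp add: divide_le_eq)
    qed
    then show "y \<in> B" using y by (auto simp: B_def)
  qed
  moreover have "B \<in> sets borel" unfolding B_def using grid(1) by (intro sets.finite_UN) auto
  moreover have "emeasure lborel B \<le> ennreal (unit_ball_vol (CARD('m)) * K ^ CARD('m) * (2 * c + 2) ^ (CARD('m) - 1) * \<rho> ^ (CARD('m) + 1))"
  proof -
    define w where "w = unit_ball_vol (CARD('m)) * (K * \<rho>\<^sup>2) ^ CARD('m)"
    have w0: "w \<ge> 0" using K by (auto simp: w_def)
    have "emeasure lborel B \<le> (\<Sum>f\<in>\<kappa> ` A. emeasure lborel (cball (rep f) (K * \<rho>\<^sup>2)))"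
      unfolding B_def using grid(1) by (intro emeasure_subadditive_finite) auto
    also have "\<dots> = (\<Sum>f\<in>\<kappa> ` A. ennreal w)"
      using K by (simp add: emeasure_cball w_def)
    also have "\<dots> = ennreal (real (card (\<kappa> ` A)) * w)" using w0
      by (simp add: ennreal_mult ennreal_of_nat_eq_real_of_nat)
    also have "\<dots> \<le> ennreal (((2 * c + 2) / \<rho>) ^ (CARD('m) - 1) * w)"
      using grid(2) w0 by (intro ennreal_leI mult_right_mono) simp_all
    also have "((2 * c + 2) / \<rho>) ^ (CARD('m) - 1) * w =
      unit_ball_vol (CARD('m)) * K ^ CARD('m) * (2 * c + 2) ^ (CARD('m) - 1) * \<rho> ^ (CARD('m) + 1)"
    proof -
      obtain n where n: "CARD('m) = Suc n" using zero_less_card_finite[where 'a='m] gr0_conv_Suc by metis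
      have eq: "(\<rho>\<^sup>2) ^ Suc n = \<rho> ^ n * \<rho> ^ (Suc n + 1)" by (simp add: power2_eq_square power_mult_distrib)
      show ?thesis unfolding w_def n power_mult_distrib eq power_divide
        using \<rho> by (simp del: power_Suc)
    qed
    finally show ?thesis .
  qed
  ultimately show ?thesis by blast
qed (auto intro!: bexI[of _ "{}"])

text \<open>Two points with images in a set of diameter \<open>\<rho>\<close> are \<open>O(\<rho>)\<close>-close because \<open>L\<close> is injective. The vertical bound on the
  distance confines \<open>vpart (L w) - sympl z0 (hpart (L w))\<close> to order \<open>\<rho>\<^sup>2\<close>, which determines the coordinate \<open>k\<close>
  up to \<open>O(\<rho>\<^sup>2)\<close> once the other coordinates are known with this precision.\<close>

theorem noncontact_cover:
  fixes L :: "real^'m \<Rightarrow> 'n::finite heis" and k :: 'm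
  assumes L: "linear L" "inj L" and \<lambda>: "vpart (L (axis k 1)) \<noteq> sympl z0 (hpart (L (axis k 1)))"
  shows "\<exists>\<epsilon>>0. \<exists>K\<ge>0. \<forall>(f :: real^'m \<Rightarrow> 'n heis) E C \<rho>.
    (\<forall>x\<in>E. norm (hpart (f x) - z0) \<le> \<epsilon>) \<and> (\<forall>x\<in>E. \<forall>y\<in>E. norm (f x - f y - L (x - y)) \<le> \<epsilon> * norm (x - y)) \<and>
    0 < \<rho> \<and> \<rho> \<le> 1 \<and> (\<forall>p\<in>C. \<forall>q\<in>C. cc_dist p q \<le> \<rho>) \<longrightarrow>
    (\<exists>B\<in>sets borel. {x\<in>E. f x \<in> C} \<subseteq> B \<and> emeasure lborel B \<le> ennreal (K * \<rho> ^ (CARD('m) + 1)))"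
proof -
  \<comment> \<open>The pullback under L of the contact form frozen at the horizontal position z0.
    The hypothesis says that it does not vanish in direction k.\<close>
  define l where "l w = vpart (L w) - sympl z0 (hpart (L w))" for w
  have blL: "bounded_linear L" using L(1) by (rule linear_conv_bounded_linear[THEN iffD1])
  have linl: "linear l"
    unfolding l_def[abs_def]
    by (intro bounded_linear.linear bounded_linear_sub bounded_linear_compose[OF bounded_linear_vpart blL]
        bounded_linear_compose[OF sympl.bounded_linear_right bounded_linear_compose[OF bounded_linear_hpart blL]])
  have lk: "l (axis k 1) \<noteq> 0" using \<lambda> by (simp add: l_def)
  define lk where "lk = \<bar>l (axis k 1)\<bar>"
  have lk0: "lk > 0" using lk by (simp add: lk_def)
  have linP: "linear (\<lambda>w. (hpart (L w), l w))"
    using linl bounded_linear.linear[OF bounded_linear_compose[OF bounded_linear_hpart blL]]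
    by (auto simp: linear_iff)
  \<comment> \<open>The height of \<open>L w\<close> can be recovered from \<open>l w\<close> and
    the horizontal part, so replacing it by \<open>l w\<close> keeps injectivity. The resulting
    lower bound yields the diameter O(rho).\<close>
  have "inj (\<lambda>w. (hpart (L w), l w))"
  proof (subst linear_injective_0[OF linP], intro allI impI)
    fix w assume "(hpart (L w), l w) = 0"
    then have "hpart (L w) = 0" "l w = 0" by (auto simp: zero_prod_def)
    then have "L w = 0" by (intro heis_eqI) (auto simp: l_def sympl.zero_right)
    then show "w = 0" using L linear_injective_0 by blast
  qed
  then obtain b where b: "b > 0" "\<And>w. b * norm w \<le> norm (hpart (L w), l w)"
    using linear_inj_bounded_below_pos[OF linP] by blast
  define c0 where "c0 = 1 / b"
  have c0: "c0 > 0" "\<And>w. norm w \<le> c0 * (norm (hpart (L w)) + \<bar>l w\<bar>)"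
  proof -
    show "c0 > 0" using b by (simp add: c0_def)
    fix w
    have "b * norm w \<le> norm (hpart (L w)) + \<bar>l w\<bar>" using b(2)[of w] norm_Pair_le[of "hpart (L w)" "l w"] by simp
    then show "norm w \<le> c0 * (norm (hpart (L w)) + \<bar>l w\<bar>)" using b(1) by (simp add: c0_def field_simps)
  qed
  obtain M where M: "M > 0" "\<And>w. norm (L w) \<le> norm w * M" using bounded_linear.pos_bounded[OF blL] by blast
  obtain Ml where Ml: "Ml > 0" "\<And>w. \<bar>l w\<bar> \<le> norm w * Ml"
    using bounded_linear.pos_bounded[of l] linl by (auto simp: linear_conv_bounded_linear)
  \<comment> \<open>Collects three error coefficients: 1 from the height of the defect e, M from the
    variation of the horizontal position about z0, and |z0| + 1 from pairing that position with
    e.\<close>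
  define M1 where "M1 = 2 + M + norm z0"
  have M1: "M1 > 0" using M by (simp add: M1_def add_pos_nonneg)
  define m where "m = real CARD('m)"
  \<comment> \<open>The second entry absorbs half of |w| in the diameter estimate, the third half of
    the coefficient \<open>lk\<close> in the estimate of the k-th coordinate. The first bounds the
    horizontal position by |z0| + 1.\<close>
  define \<epsilon> where "\<epsilon> = Min {1, 1 / (2 * c0 * (1 + M1)), lk / (2 * M1)}"
  have \<epsilon>: "\<epsilon> > 0" "\<epsilon> \<le> 1" "\<epsilon> \<le> 1 / (2 * c0 * (1 + M1))" "\<epsilon> \<le> lk / (2 * M1)"
    using c0(1) M1 lk0 by (auto simp: \<epsilon>_def)
  have \<epsilon>c: "c0 * (1 + M1) * \<epsilon> \<le> 1 / 2"
  proof -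
    have "c0 * (1 + M1) * \<epsilon> \<le> c0 * (1 + M1) * (1 / (2 * c0 * (1 + M1)))"
      using \<epsilon>(3) c0(1) M1 by (intro mult_left_mono) auto
    also have "\<dots> = 1 / 2" using c0(1) M1 by (simp add: divide_simps)
    finally show ?thesis .
  qed
  have \<epsilon>l: "M1 * \<epsilon> \<le> lk / 2" using \<epsilon>(4) M1 by (simp add: field_simps)
  define Kt where "Kt = 2 * (1 + m * Ml + m * M1 ) / lk + m"
  have Kt: "Kt \<ge> 0" using lk0 Ml M1 by (auto simp: Kt_def m_def)
  define K where "K = unit_ball_vol (CARD('m)) * Kt ^ CARD('m) * (2 * (4 * c0) + 2) ^ (CARD('m) - 1)"
  have K: "K \<ge> 0" using Kt c0 by (auto simp: K_def)
  show ?thesis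
  proof (rule exI[of _ \<epsilon>], rule conjI[OF \<epsilon>(1)], rule exI[of _ K], rule conjI[OF K], intro allI impI, elim conjE)
    fix f :: "real^'m \<Rightarrow> 'n heis" and E and C :: "'n heis set" and \<rho>
    assume z: "\<forall>x\<in>E. norm (hpart (f x) - z0) \<le> \<epsilon>" and lip: "\<forall>x\<in>E. \<forall>y\<in>E. norm (f x - f y - L (x - y)) \<le> \<epsilon> * norm (x - y)"
      and \<rho>: "0 < \<rho>" "\<rho> \<le> 1" and C: "\<forall>p\<in>C. \<forall>q\<in>C. cc_dist p q \<le> \<rho>"
    define A where "A = {x\<in>E. f x \<in> C}"
    have est: "\<bar>l (y - y')\<bar> \<le> \<rho>\<^sup>2 + \<epsilon> * M1 * norm (y - y')" "norm (hpart (L (y - y'))) \<le> \<rho> + \<epsilon> * norm (y - y')"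
      if y: "y \<in> A" "y' \<in> A" for y y'
    proof -
      define w where "w = y - y'"
      define e where "e = f y - f y' - L w"
      have e: "norm e \<le> \<epsilon> * norm w" using lip y by (auto simp: A_def e_def w_def)
      have d: "0 \<le> cc_dist (f y') (f y)" "cc_dist (f y') (f y) \<le> \<rho>" using C y cc_dist_nonneg[of "f y'" "f y"] unfolding A_def by blast+
      have h: "norm (hpart (f y) - hpart (f y')) \<le> \<rho>" using norm_hpart_le_cc_dist[of "f y" "f y'"] d by simp
      have hLe: "hpart (f y) - hpart (f y') = hpart (L w) + hpart e" by (simp add: e_def)
      have "norm (hpart (L w)) \<le> norm (hpart (f y) - hpart (f y')) + norm (hpart e)"
        using norm_triangle_ineq4[of "hpart (f y) - hpart (f y')" "hpart e"] by (simp add: hLe)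
      also have "\<dots> \<le> \<rho> + \<epsilon> * norm w" using h e norm_hpart_le[of e] by simp
      finally show "norm (hpart (L (y - y'))) \<le> \<rho> + \<epsilon> * norm (y - y')" by (simp add: w_def)
      have "(cc_dist (f y') (f y))\<^sup>2 \<le> \<rho>\<^sup>2" using d by (intro power_mono) auto
      with vertical_le_cc_dist[of "f y" "f y'"]
      have v: "\<bar>vpart (f y) - vpart (f y') - sympl (hpart (f y')) (hpart (f y))\<bar> \<le> \<rho>\<^sup>2" by simp
      have "hpart (f y) = hpart (f y') + (hpart (L w) + hpart e)" using hLe by (simp add: algebra_simps)
      then have "sympl (hpart (f y')) (hpart (f y)) = sympl (hpart (f y')) (hpart (L w)) + sympl (hpart (f y')) (hpart e)"
        by (simp add: sympl.add_right)
      moreover have "vpart (f y) - vpart (f y') = vpart (L w) + vpart e" by (simp add: e_def)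
      ultimately have eq: "vpart (f y) - vpart (f y') - sympl (hpart (f y')) (hpart (f y)) =
        l w + vpart e - sympl (hpart (f y') - z0) (hpart (L w)) - sympl (hpart (f y')) (hpart e)"
        by (simp add: l_def sympl.diff_left)
      have y'E: "y' \<in> E" using y by (simp add: A_def)
      have 1: "\<bar>vpart e\<bar> \<le> \<epsilon> * norm w" using abs_vpart_le[of e] e by simp
      have 2: "\<bar>sympl (hpart (f y') - z0) (hpart (L w))\<bar> \<le> \<epsilon> * (M * norm w)"
      proof -
        have "\<bar>sympl (hpart (f y') - z0) (hpart (L w))\<bar> \<le> norm (hpart (f y') - z0) * norm (hpart (L w))" by (rule abs_sympl_le)
        also have "\<dots> \<le> \<epsilon> * (M * norm w)"
          using z y'E norm_hpart_le[of "L w"] M(2)[of w] \<epsilon> by (intro mult_mono) (auto simp: mult.commute)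
        finally show ?thesis .
      qed
      have 3: "\<bar>sympl (hpart (f y')) (hpart e)\<bar> \<le> (norm z0 + 1) * (\<epsilon> * norm w)"
      proof -
        have "norm (hpart (f y')) \<le> norm z0 + norm (hpart (f y') - z0)" using norm_triangle_ineq[of z0 "hpart (f y') - z0"] by simp
        also have "\<dots> \<le> norm z0 + 1" using z y'E \<epsilon> by force
        finally have "norm (hpart (f y')) \<le> norm z0 + 1" .
        then have "norm (hpart (f y')) * norm (hpart e) \<le> (norm z0 + 1) * (\<epsilon> * norm w)"
          using norm_hpart_le[of e] e by (intro mult_mono) auto
        then show ?thesis using abs_sympl_le[of "hpart (f y')" "hpart e"] by simp
      qed
      have "\<bar>l w\<bar> \<le> \<rho>\<^sup>2 + \<epsilon> * norm w + \<epsilon> * (M * norm w) + (norm z0 + 1) * (\<epsilon> * norm w)"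
        using v 1 2 3 unfolding eq by linarith
      also have "\<dots> = \<rho>\<^sup>2 + \<epsilon> * M1 * norm w" by (simp add: M1_def algebra_simps)
      finally show "\<bar>l (y - y')\<bar> \<le> \<rho>\<^sup>2 + \<epsilon> * M1 * norm (y - y')" by (simp add: w_def)
    qed
    have "\<exists>B\<in>sets borel. A \<subseteq> B \<and>
      emeasure lborel B \<le> ennreal (unit_ball_vol (CARD('m)) * Kt ^ CARD('m) * (2 * (4 * c0) + 2) ^ (CARD('m) - 1) * \<rho> ^ (CARD('m) + 1))"
    proof (rule thin_set_cover[OF \<rho> _ Kt, where k=k])
      show "4 * c0 \<ge> 0" using c0 by simp
      fix y y' assume y: "y \<in> A" "y' \<in> A"
      define w where "w = y - y'"
      have \<rho>2: "\<rho>\<^sup>2 \<le> \<rho>" using \<rho> by (simp add: power2_eq_square mult_left_le)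
      have "norm w \<le> c0 * (norm (hpart (L w)) + \<bar>l w\<bar>)" by (rule c0(2))
      also have "\<dots> \<le> c0 * ((\<rho> + \<epsilon> * norm w) + (\<rho> + \<epsilon> * M1 * norm w))"
        using est[OF y] \<rho>2 c0(1) unfolding w_def by (intro mult_left_mono add_mono) auto
      also have "\<dots> = 2 * c0 * \<rho> + (c0 * (1 + M1) * \<epsilon>) * norm w" by (simp add: algebra_simps)
      also have "\<dots> \<le> 2 * c0 * \<rho> + 1 / 2 * norm w" using \<epsilon>c by (intro add_left_mono mult_right_mono) auto
      finally show "dist y y' \<le> 4 * c0 * \<rho>" by (simp add: w_def dist_norm)
      assume col: "\<And>j. j \<noteq> k \<Longrightarrow> \<bar>y $ j - y' $ j\<bar> \<le> \<rho>\<^sup>2"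
      define w' where "w' = w - (w $ k) *\<^sub>R axis k 1"
      have "norm w' \<le> (\<Sum>j\<in>UNIV. \<bar>w' $ j\<bar>)" by (rule norm_le_l1_cart)
      also have "\<dots> \<le> (\<Sum>j\<in>(UNIV :: 'm set). \<rho>\<^sup>2)"
        using col by (intro sum_mono) (auto simp: w'_def w_def axis_def)
      finally have w': "norm w' \<le> m * \<rho>\<^sup>2" by (simp add: m_def)
      have ww: "norm w \<le> \<bar>w $ k\<bar> + m * \<rho>\<^sup>2"
        using norm_triangle_ineq[of w' "(w $ k) *\<^sub>R axis k 1"] w' by (simp add: w'_def)
      have "l w = l w' + w $ k * l (axis k 1)"
        using linl by (simp add: w'_def linear_diff linear_scale)
      then have "\<bar>w $ k\<bar> * lk \<le> \<bar>l w\<bar> + \<bar>l w'\<bar>" by (simp add: lk_def abs_mult[symmetric])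
      also have "\<dots> \<le> (\<rho>\<^sup>2 + \<epsilon> * M1 * norm w) + m * \<rho>\<^sup>2 * Ml"
        using est(1)[OF y] Ml(2)[of w'] mult_right_mono[OF w', of Ml] Ml(1) unfolding w_def by linarith
      also have "\<dots> \<le> (\<rho>\<^sup>2 + \<epsilon> * M1 * (\<bar>w $ k\<bar> + m * \<rho>\<^sup>2)) + m * \<rho>\<^sup>2 * Ml"
        using ww M1 \<epsilon> by (intro add_right_mono add_left_mono mult_left_mono) auto
      also have "\<dots> = \<rho>\<^sup>2 * (1 + m * Ml) + \<epsilon> * (M1 * m * \<rho>\<^sup>2) + (M1 * \<epsilon>) * \<bar>w $ k\<bar>" by (simp add: algebra_simps)
      also have "\<dots> \<le> \<rho>\<^sup>2 * (1 + m * Ml) + 1 * (M1 * m * \<rho>\<^sup>2) + (lk / 2) * \<bar>w $ k\<bar>"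
        using \<epsilon>l \<epsilon>(2) M1 Ml(1) by (intro add_mono mult_right_mono) (auto simp: m_def)
      finally have "\<bar>w $ k\<bar> * lk \<le> 2 * \<rho>\<^sup>2 * (1 + m * Ml + m * M1)" by (simp add: algebra_simps)
      then have "\<bar>w $ k\<bar> \<le> 2 * \<rho>\<^sup>2 * (1 + m * Ml + m * M1) / lk" using lk0 by (simp add: le_divide_eq)
      with ww have "norm w \<le> 2 * \<rho>\<^sup>2 * (1 + m * Ml + m * M1) / lk + m * \<rho>\<^sup>2" by simp
      also have "\<dots> = Kt * \<rho>\<^sup>2" by (simp add: Kt_def algebra_simps)
      finally show "dist y y' \<le> Kt * \<rho>\<^sup>2" by (simp add: w_def dist_norm)
    qed
    then show "\<exists>B\<in>sets borel. {x\<in>E. f x \<in> C} \<subseteq> B \<and> emeasure lborel B \<le> ennreal (K * \<rho> ^ (CARD('m) + 1))"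
      by (simp add: A_def K_def)
  qed
qed

text \<open>A cover may contain sets of diameter 0, whereas the measure estimate for pieces requires
  a positive scale. Each diameter is therefore increased slightly, with total cost e/2 by a
  geometric series; starting from diameters at most 1/2 leaves room below 1.\<close>

lemma hausdorff_measure_zero_cover:
  fixes d :: "'a \<Rightarrow> 'a \<Rightarrow> real"
  assumes H: "hausdorff_measure_wrt d (real k) S = 0" and k: "k > 0" and e: "e > 0"
  shows "\<exists>C \<rho>. S \<subseteq> (\<Union>i. C i) \<and> (\<forall>i::nat. 0 < \<rho> i \<and> \<rho> i \<le> 1 \<and> (\<forall>p\<in>C i. \<forall>q\<in>C i. d p q \<le> \<rho> i)) \<and>
    (\<Sum>i. ennreal (\<rho> i ^ k)) \<le> ennreal e"
proof -
  have "hausdorff_pre d (real k) (1/2) S \<le> hausdorff_measure_wrt d (real k) S"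
    unfolding hausdorff_measure_wrt_def by (rule SUP_upper) simp
  then have "hausdorff_pre d (real k) (1/2) S = 0" using H by simp
  then have "hausdorff_pre d (real k) (1/2) S < ennreal (e / 2)" using e by simp
  then obtain C where C: "S \<subseteq> (\<Union>i. C i)" "\<And>i. diam_wrt d (C i) \<le> ennreal (1/2)"
    and sumC: "(\<Sum>i. ennreal (enn2real (diam_wrt d (C i)) powr real k)) < ennreal (e / 2)"
    unfolding hausdorff_pre_def INF_less_iff by blast
  define D where "D i = enn2real (diam_wrt d (C i))" for i
  have D: "ennreal (D i) = diam_wrt d (C i)" "0 \<le> D i" "D i \<le> 1/2" for i
  proof -
    show "ennreal (D i) = diam_wrt d (C i)" unfolding D_def using le_less_trans[OF C(2)[of i] ennreal_less_top] by (intro ennreal_enn2real)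
    then have "ennreal (D i) \<le> ennreal (1/2)" using C(2)[of i] by simp
    then show "D i \<le> 1/2" by (subst (asm) ennreal_le_iff) auto
  qed (simp add: D_def)
  have dD: "d p q \<le> D i" if "p \<in> C i" "q \<in> C i" for p q i
  proof -
    have "ennreal (d p q) \<le> diam_wrt d (C i)" unfolding diam_wrt_def
      using that by (intro order_trans[OF SUP_upper[of q "C i"] SUP_upper[of p "C i"]]) auto
    then have "ennreal (d p q) \<le> ennreal (D i)" using D by simp
    then show ?thesis using D(2) by (simp add: ennreal_le_iff)
  qed
  have "\<exists>r. D i < r \<and> r \<le> 1 \<and> r ^ k \<le> D i ^ k + e / 2 * (1 / 2) ^ Suc i" for i
  proof -
    have "((\<lambda>r. r ^ k) \<longlongrightarrow> D i ^ k) (at_right (D i))" by (intro tendsto_intros)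
    moreover have "D i ^ k < D i ^ k + e / 2 * (1 / 2) ^ Suc i" using e by simp
    ultimately have "eventually (\<lambda>r. r ^ k < D i ^ k + e / 2 * (1 / 2) ^ Suc i) (at_right (D i))"
      by (rule order_tendstoD(2))
    moreover have "eventually (\<lambda>r. r < 1) (at_right (D i))"
      by (rule eventually_at_rightI[of "D i" 1]) (use D(3)[of i] in auto)
    moreover have "eventually (\<lambda>r. D i < r) (at_right (D i))" by (rule eventually_at_right_less)
    ultimately have ev: "eventually (\<lambda>r. D i < r \<and> r \<le> 1 \<and> r ^ k \<le> D i ^ k + e / 2 * (1 / 2) ^ Suc i) (at_right (D i))"
      by eventually_elim auto
    have "at_right (D i) \<noteq> bot" by simp
    from eventually_happens'[OF this ev] show ?thesis .
  qed
  then have "\<forall>i. \<exists>r. D i < r \<and> r \<le> 1 \<and> r ^ k \<le> D i ^ k + e / 2 * (1 / 2) ^ Suc i" by blast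
  from choice[OF this] obtain \<rho> where "\<forall>i. D i < \<rho> i \<and> \<rho> i \<le> 1 \<and> \<rho> i ^ k \<le> D i ^ k + e / 2 * (1 / 2) ^ Suc i" by blast
  then have \<rho>: "\<And>i. D i < \<rho> i" "\<And>i. \<rho> i \<le> 1" "\<And>i. \<rho> i ^ k \<le> D i ^ k + e / 2 * (1 / 2) ^ Suc i" by blast+
  have Dp: "D i powr real k = D i ^ k" for i
    using D(2)[of i] k by (cases "D i = 0") (auto simp: powr_realpow)
  have "(\<Sum>i. ennreal (\<rho> i ^ k)) \<le> (\<Sum>i. ennreal (D i powr real k) + ennreal (e / 2 * (1 / 2) ^ Suc i))"
  proof (rule suminf_le)
    show "ennreal (\<rho> i ^ k) \<le> ennreal (D i powr real k) + ennreal (e / 2 * (1 / 2) ^ Suc i)" for i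
      using \<rho>(3)[of i] D(2)[of i] e by (simp only: Dp ennreal_plus[symmetric] zero_le_power) (auto simp: ennreal_plus[symmetric] intro!: ennreal_leI simp del: ennreal_plus)
  qed auto
  also have "\<dots> = (\<Sum>i. ennreal (D i powr real k)) + (\<Sum>i. ennreal (e / 2 * (1 / 2) ^ Suc i))"
    by (rule suminf_add[symmetric]) auto
  also have "(\<Sum>i. ennreal (e / 2 * (1 / 2) ^ Suc i)) = ennreal (e / 2)"
  proof -
    have "(\<lambda>i. e / 2 * (1 / 2) ^ Suc i) sums (e / 2 * 1)"
      by (rule sums_mult[OF power_half_series])
    then show ?thesis using e by (subst suminf_ennreal2) (auto simp: sums_iff)
  qed
  also have "(\<Sum>i. ennreal (D i powr real k)) + ennreal (e / 2) \<le> ennreal (e / 2) + ennreal (e / 2)"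
    using sumC unfolding D_def by (intro add_right_mono) simp
  also have "\<dots> = ennreal e" using e by (simp add: ennreal_plus[symmetric] del: ennreal_plus)
  finally have "(\<Sum>i. ennreal (\<rho> i ^ k)) \<le> ennreal e" .
  moreover have "0 < \<rho> i \<and> \<rho> i \<le> 1 \<and> (\<forall>p\<in>C i. \<forall>q\<in>C i. d p q \<le> \<rho> i)" for i
    using \<rho>(1,2)[of i] D(2)[of i] dD[of _ i] by force
  ultimately show ?thesis using C(1) by (intro exI[of _ C] exI[of _ \<rho>]) blast
qed

text \<open>Records a tolerance at which null image forces null domain, for arbitrary maps near L
  and arbitrary sets E. In this form the tolerance can be rounded down to 1/(n+1), giving countably
  many cases.\<close>

definition noncontact_gap :: "(real^'m \<Rightarrow> 'n::finite heis) \<Rightarrow> (real^'n) \<times> (real^'n) \<Rightarrow> real \<Rightarrow> bool" where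
  "noncontact_gap L z0 \<epsilon> \<longleftrightarrow> (\<forall>(f :: real^'m \<Rightarrow> 'n heis) E.
    (\<forall>x\<in>E. norm (hpart (f x) - z0) \<le> \<epsilon>) \<and> (\<forall>x\<in>E. \<forall>y\<in>E. norm (f x - f y - L (x - y)) \<le> \<epsilon> * norm (x - y)) \<and>
    hausdorff_measure_wrt cc_dist (real CARD('m) + 1) (f ` E) = 0 \<longrightarrow> negligible E)"

text \<open>A cover of the image with sum of rho^(m+1) at most e/(K+1) pulls back to Borel sets
  covering E of total measure at most e. Measuring E from outside suffices for
  negligibility.\<close>

theorem noncontact_gap_exists:
  fixes L :: "real^'m \<Rightarrow> 'n::finite heis"
  assumes L: "linear L" "inj L" and \<lambda>: "vpart (L (axis k 1)) \<noteq> sympl z0 (hpart (L (axis k 1)))"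
  shows "\<exists>\<epsilon>>0. noncontact_gap L z0 \<epsilon>"
proof -
  from noncontact_cover[OF L \<lambda>]
  obtain \<epsilon> K where \<epsilon>: "\<epsilon> > 0" and K: "K \<ge> 0" and cov: "\<forall>(f :: real^'m \<Rightarrow> 'n heis) E C \<rho>.
    (\<forall>x\<in>E. norm (hpart (f x) - z0) \<le> \<epsilon>) \<and> (\<forall>x\<in>E. \<forall>y\<in>E. norm (f x - f y - L (x - y)) \<le> \<epsilon> * norm (x - y)) \<and>
    0 < \<rho> \<and> \<rho> \<le> 1 \<and> (\<forall>p\<in>C. \<forall>q\<in>C. cc_dist p q \<le> \<rho>) \<longrightarrow>
    (\<exists>B\<in>sets borel. {x\<in>E. f x \<in> C} \<subseteq> B \<and> emeasure lborel B \<le> ennreal (K * \<rho> ^ (CARD('m) + 1)))"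
    by (elim exE conjE) (rule that)
  show ?thesis unfolding noncontact_gap_def
  proof (rule exI[of _ \<epsilon>], rule conjI[OF \<epsilon>], intro allI impI, elim conjE)
    fix f :: "real^'m \<Rightarrow> 'n heis" and E
    assume f: "\<forall>x\<in>E. norm (hpart (f x) - z0) \<le> \<epsilon>" "\<forall>x\<in>E. \<forall>y\<in>E. norm (f x - f y - L (x - y)) \<le> \<epsilon> * norm (x - y)"
      and H: "hausdorff_measure_wrt cc_dist (real CARD('m) + 1) (f ` E) = 0"
    have H': "hausdorff_measure_wrt cc_dist (real (CARD('m) + 1)) (f ` E) = 0" using H by (simp add: add.commute)
    show "negligible E"
      unfolding negligible_outer_le
    proof (intro allI impI)
      fix e :: real assume e: "e > 0"
      define e' where "e' = e / (K + 1)"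
      have e': "e' > 0" "K * e' \<le> e" using e K by (auto simp: e'_def field_simps)
      obtain C \<rho> where C: "f ` E \<subseteq> (\<Union>i. C i)" and
        \<rho>: "\<And>i::nat. 0 < \<rho> i \<and> \<rho> i \<le> 1 \<and> (\<forall>p\<in>C i. \<forall>q\<in>C i. cc_dist p q \<le> \<rho> i)"
        and sum: "(\<Sum>i. ennreal (\<rho> i ^ (CARD('m) + 1))) \<le> ennreal e'"
        using hausdorff_measure_zero_cover[OF H' _ e'(1)] by auto
      have "\<exists>B\<in>sets borel. {x\<in>E. f x \<in> C i} \<subseteq> B \<and> emeasure lborel B \<le> ennreal (K * \<rho> i ^ (CARD('m) + 1))" for i
        by (rule cov[rule_format]) (intro conjI f \<rho>[of i, THEN conjunct1] \<rho>[of i, THEN conjunct2, THEN conjunct1] \<rho>[of i, THEN conjunct2, THEN conjunct2])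
      then have "\<forall>i. \<exists>B. B \<in> sets borel \<and> {x\<in>E. f x \<in> C i} \<subseteq> B \<and> emeasure lborel B \<le> ennreal (K * \<rho> i ^ (CARD('m) + 1))" by blast
      from choice[OF this] obtain B where B: "\<And>i. B i \<in> sets borel" "\<And>i. {x\<in>E. f x \<in> C i} \<subseteq> B i"
        "\<And>i. emeasure lborel (B i) \<le> ennreal (K * \<rho> i ^ (CARD('m) + 1))" by blast
      have "emeasure lborel (\<Union>i. B i) \<le> (\<Sum>i. emeasure lborel (B i))"
        using B(1) by (intro emeasure_subadditive_countably) auto
      also have "\<dots> \<le> (\<Sum>i. ennreal K * ennreal (\<rho> i ^ (CARD('m) + 1)))"
        using B(3) K by (intro suminf_le) (auto simp: ennreal_mult'[symmetric])
      also have "\<dots> = ennreal K * (\<Sum>i. ennreal (\<rho> i ^ (CARD('m) + 1)))" by (rule ennreal_suminf_cmult)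
      also have "\<dots> \<le> ennreal K * ennreal e'" using sum by (rule mult_left_mono) simp
      also have "\<dots> \<le> ennreal e" using e'(2) K by (simp add: ennreal_mult'[symmetric] ennreal_leI)
      finally have le: "emeasure lebesgue (\<Union>i. B i) \<le> ennreal e" using B(1) by (simp add: sets.countable_UN)
      have "(\<Union>i. B i) \<in> lmeasurable"
        using B(1) le by (intro fmeasurableI) (auto intro: le_less_trans)
      moreover have "measure lebesgue (\<Union>i. B i) \<le> e"
        using le e by (simp add: measure_def enn2real_leI)
      moreover have "E \<subseteq> (\<Union>i. B i)" using C B(2) by blast
      ultimately show "\<exists>T. E \<subseteq> T \<and> T \<in> lmeasurable \<and> measure lebesgue T \<le> e" by blast
    qed
  qed
qed

subsection \<open>Integrating the contact equation around small loops\<close>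

lemma AE_lborel_swap:
  fixes P :: "'a::euclidean_space \<Rightarrow> 'b::euclidean_space \<Rightarrow> bool"
  assumes "Measurable.pred (lborel \<Otimes>\<^sub>M lborel) (\<lambda>z. P (fst z) (snd z))"
    and "\<And>s. AE x in lborel. P x s"
  shows "AE x in lborel. AE s in lborel. P x s"
  using lborel_pair.AE_commute[of P] assms by (simp add: case_prod_unfold pred_def space_pair_measure)

text \<open>The substitution \<open>\<tau>\<close> = s \<open>\<sigma>\<close> identifies the
  fundamental theorem for the vector s v with an integral over the initial part [0,s] of the segment
  along v.\<close>

lemma integral_initial_segment:
  fixes h :: "real \<Rightarrow> 'b::euclidean_space"
  assumes h: "integrable lborel (\<lambda>s. indicator {0..1} s *\<^sub>R h s)" and s: "0 < s" "s \<le> 1"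
  shows "integrable lborel (\<lambda>\<tau>. indicator {0..s} \<tau> *\<^sub>R h \<tau>)"
    and "(\<integral>\<sigma>. indicator {0..1} \<sigma> *\<^sub>R s *\<^sub>R h (\<sigma> * s) \<partial>lborel) = (\<integral>\<tau>. indicator {0..s} \<tau> *\<^sub>R h \<tau> \<partial>lborel)"
proof -
  have "integrable lborel (\<lambda>\<tau>. indicator {0..s} \<tau> *\<^sub>R indicator {0..1} \<tau> *\<^sub>R h \<tau>)"
    by (rule integrable_bounded_mult[OF h, where B=1]) auto
  also have "(\<lambda>\<tau>. indicator {0..s} \<tau> *\<^sub>R indicator {0..1} \<tau> *\<^sub>R h \<tau>) = (\<lambda>\<tau>. indicator {0..s} \<tau> *\<^sub>R h \<tau>)"
    using s by (auto simp: indicator_def)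
  finally show "integrable lborel (\<lambda>\<tau>. indicator {0..s} \<tau> *\<^sub>R h \<tau>)" .
  have "(\<integral>\<tau>. indicator {0..s} \<tau> *\<^sub>R h \<tau> \<partial>lborel) = \<bar>s\<bar> *\<^sub>R (\<integral>\<sigma>. indicator {0..s} (0 + s * \<sigma>) *\<^sub>R h (0 + s * \<sigma>) \<partial>lborel)"
    using s by (intro lborel_integral_real_affine) auto
  also have "\<dots> = s *\<^sub>R (\<integral>\<sigma>. indicator {0..1} \<sigma> *\<^sub>R h (\<sigma> * s) \<partial>lborel)"
  proof -
    have "indicator {0..s} (0 + s * \<sigma>) = (indicator {0..1} \<sigma> :: real)" for \<sigma>
      using s by (auto simp: indicator_def zero_le_mult_iff)
    then show ?thesis using s by (simp add: mult.commute)
  qed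
  also have "\<dots> = (\<integral>\<sigma>. s *\<^sub>R indicator {0..1} \<sigma> *\<^sub>R h (\<sigma> * s) \<partial>lborel)" by (simp only: integral_scaleR_right)
  finally show "(\<integral>\<sigma>. indicator {0..1} \<sigma> *\<^sub>R s *\<^sub>R h (\<sigma> * s) \<partial>lborel) = (\<integral>\<tau>. indicator {0..s} \<tau> *\<^sub>R h \<tau> \<partial>lborel)"
    by (simp add: mult.commute)
qed

definition weak_directional :: "'a::euclidean_space set \<Rightarrow> 'a \<Rightarrow> ('a \<Rightarrow> 'b::euclidean_space) \<Rightarrow> ('a \<Rightarrow> 'b) \<Rightarrow> bool" where
  "weak_directional U v F D \<longleftrightarrow> (\<forall>\<phi>. test_fun U \<phi> \<longrightarrow>
    (\<integral>x. frechet_derivative \<phi> (at x) v *\<^sub>R F x \<partial>lborel) = - (\<integral>x. \<phi> x *\<^sub>R D x \<partial>lborel))"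

lemma test_fun_linear_derivative: "test_fun U \<phi> \<Longrightarrow> linear (frechet_derivative \<phi> (at x))"
  by (metis test_fun_def smooth_fun_def iter_deriv.simps(1) linear_frechet_derivative)

lemma weak_directional_scale:
  assumes "weak_directional U v F D"
  shows "weak_directional U (s *\<^sub>R v) F (\<lambda>x. s *\<^sub>R D x)"
  unfolding weak_directional_def
proof (intro allI impI)
  fix \<phi> assume t: "test_fun U \<phi>"
  have "(\<integral>x. frechet_derivative \<phi> (at x) (s *\<^sub>R v) *\<^sub>R F x \<partial>lborel) = (\<integral>x. s *\<^sub>R (frechet_derivative \<phi> (at x) v *\<^sub>R F x) \<partial>lborel)"
    by (simp add: linear_scale[OF test_fun_linear_derivative[OF t]])
  also have "\<dots> = s *\<^sub>R (\<integral>x. frechet_derivative \<phi> (at x) v *\<^sub>R F x \<partial>lborel)" by (rule integral_scaleR_right)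
  also have "\<dots> = - (s *\<^sub>R (\<integral>x. \<phi> x *\<^sub>R D x \<partial>lborel))" using assms t by (simp add: weak_directional_def)
  also have "\<dots> = - (\<integral>x. s *\<^sub>R \<phi> x *\<^sub>R D x \<partial>lborel)" by (simp only: integral_scaleR_right)
  finally show "(\<integral>x. frechet_derivative \<phi> (at x) (s *\<^sub>R v) *\<^sub>R F x \<partial>lborel) = - (\<integral>x. \<phi> x *\<^sub>R s *\<^sub>R D x \<partial>lborel)"
    by (simp add: mult.commute)
qed

text \<open>Along the edge, the displacement of z is s \<open>hpart Lv\<close> plus
  \<open>\<alpha>\<close> with |\<open>\<alpha>\<close>| at most E for almost every s, and the
  horizontal part of D is \<open>hpart Lv\<close> plus \<open>\<beta>\<close> whose norm has
  integral at most E. In the contact equation the leading term vanishes by antisymmetry; the rest is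
  linear in \<open>Lv\<close> or pairs the bounded \<open>\<alpha>\<close> with the integrable
  \<open>\<beta>\<close>. As E is quantified inside, one null set serves all tolerances.\<close>

lemma contact_edge_estimate:
  fixes F D :: "'a::euclidean_space \<Rightarrow> 'n::finite heis" and Lv :: "'n heis"
  assumes F: "integrable lborel F" and D: "integrable lborel D"
    and weak: "weak_directional U v F D"
    and U: "convex U" "open U"
    and contact: "AE x in lborel. x \<in> U \<longrightarrow> vpart (D x) = sympl (hpart (F x)) (hpart (D x))"
  shows "AE x in lborel. x \<in> U \<and> x + v \<in> U \<longrightarrow>
    (\<forall>E\<ge>0. (\<integral>\<^sup>+s. ennreal (norm (D (x + s *\<^sub>R v) - Lv)) * indicator {0..1::real} s \<partial>lborel) \<le> ennreal E \<longrightarrow>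
      norm (hpart (F (x + v)) - hpart (F x) - hpart Lv) \<le> E \<and>
      \<bar>vpart (F (x + v)) - vpart (F x) - sympl (hpart (F x)) (hpart (F (x + v)))\<bar> \<le> 2 * norm Lv * E + E\<^sup>2)"
proof -
  have Fm[measurable]: "F \<in> borel_measurable borel" using F by (simp add: borel_measurable_integrable)
  have Dm[measurable]: "D \<in> borel_measurable borel" using D by (simp add: borel_measurable_integrable)
  have [measurable]: "U \<in> sets borel" using U by simp
  have [measurable]: "hpart \<in> borel_measurable borel" "vpart \<in> borel_measurable borel"
    by (auto intro!: borel_measurable_continuous_onI linear_continuous_on bounded_linear_hpart bounded_linear_vpart)
  have smeas[measurable]: "(\<lambda>x. sympl (f x) (g x)) \<in> borel_measurable M"
    if [measurable]: "f \<in> borel_measurable M" "g \<in> borel_measurable M" for f g :: "'c \<Rightarrow> (real^'n) \<times> (real^'n)" and M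
    using that by (rule borel_measurable_continuous_Pair) (intro sympl.continuous_on continuous_intros)
  have ftc: "AE x in lborel. x \<in> U \<and> x + s *\<^sub>R v \<in> U \<longrightarrow>
    F (x + s *\<^sub>R v) - F x = (\<integral>\<sigma>. indicator {0..1} \<sigma> *\<^sub>R (s *\<^sub>R D (x + \<sigma> *\<^sub>R (s *\<^sub>R v))) \<partial>lborel)" for s
  proof (rule weak_derivative_AE_FTC[OF F _ _ U])
    show "integrable lborel (\<lambda>x. s *\<^sub>R D x)" using D by simp
    fix \<phi> assume "test_fun U \<phi>"
    then show "(\<integral>x. frechet_derivative \<phi> (at x) (s *\<^sub>R v) *\<^sub>R F x \<partial>lborel) = - (\<integral>x. \<phi> x *\<^sub>R s *\<^sub>R D x \<partial>lborel)"
      using weak_directional_scale[OF weak, of s] unfolding weak_directional_def by blast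
  qed
  \<comment> \<open>Equality is expressed as a vanishing norm, so that the condition is visibly
    jointly measurable in x and s and Fubini applies.\<close>
  have ftc': "AE x in lborel. AE s in lborel. x \<in> U \<and> x + s *\<^sub>R v \<in> U \<longrightarrow>
    norm (F (x + s *\<^sub>R v) - F x - (\<integral>\<sigma>. indicator {0..1} \<sigma> *\<^sub>R (s *\<^sub>R D (x + \<sigma> *\<^sub>R (s *\<^sub>R v))) \<partial>lborel)) \<le> 0"
  proof (rule AE_lborel_swap)
    fix s :: real
    show "AE x in lborel. x \<in> U \<and> x + s *\<^sub>R v \<in> U \<longrightarrow>
      norm (F (x + s *\<^sub>R v) - F x - (\<integral>\<sigma>. indicator {0..1} \<sigma> *\<^sub>R (s *\<^sub>R D (x + \<sigma> *\<^sub>R (s *\<^sub>R v))) \<partial>lborel)) \<le> 0"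
      using ftc[of s] by eventually_elim simp
  qed measurable
  have contact': "AE x in lborel. AE s in lborel. x + s *\<^sub>R v \<in> U \<longrightarrow>
    \<bar>vpart (D (x + s *\<^sub>R v)) - sympl (hpart (F (x + s *\<^sub>R v))) (hpart (D (x + s *\<^sub>R v)))\<bar> \<le> 0"
  proof (rule AE_lborel_swap)
    fix s :: real
    show "AE x in lborel. x + s *\<^sub>R v \<in> U \<longrightarrow>
      \<bar>vpart (D (x + s *\<^sub>R v)) - sympl (hpart (F (x + s *\<^sub>R v))) (hpart (D (x + s *\<^sub>R v)))\<bar> \<le> 0"
      using AE_translate[OF contact, of "s *\<^sub>R v"] by eventually_elim simp
  qed measurable
  have int: "AE x in lborel. integrable lborel (\<lambda>s. indicator {0..1::real} s *\<^sub>R D (x + s *\<^sub>R v))"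
    by (rule lborel_pair.AE_integrable_fst[OF integrable_segment[OF D, of v]])
  show ?thesis
    using ftc[of 1] ftc' contact' int
  proof eventually_elim
    case (elim x)
    show ?case
    proof (intro impI allI conjI)
      assume xU: "x \<in> U \<and> x + v \<in> U"
      fix E :: real assume E: "0 \<le> E"
        and leE: "(\<integral>\<^sup>+s. ennreal (norm (D (x + s *\<^sub>R v) - Lv)) * indicator {0..1::real} s \<partial>lborel) \<le> ennreal E"
      note int = elim(4)
      have sU: "x + s *\<^sub>R v \<in> U" if "s \<in> {0..1}" for s
      proof -
        have "(1 - s) *\<^sub>R x + s *\<^sub>R (x + v) \<in> U" using U(1) xU that by (intro convexD) auto
        then show ?thesis by (simp add: algebra_simps)
      qed
      have dev: "norm (F (x + s *\<^sub>R v) - F x - s *\<^sub>R Lv) \<le> E" if s: "0 < s" "s \<le> 1"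
        and eq: "F (x + s *\<^sub>R v) - F x = (\<integral>\<sigma>. indicator {0..1} \<sigma> *\<^sub>R (s *\<^sub>R D (x + \<sigma> *\<^sub>R (s *\<^sub>R v))) \<partial>lborel)" for s
      proof -
        note seg = integral_initial_segment[OF int s]
        have "F (x + s *\<^sub>R v) - F x = (\<integral>\<tau>. indicator {0..s} \<tau> *\<^sub>R D (x + \<tau> *\<^sub>R v) \<partial>lborel)"
          using eq seg(2) by simp
        moreover have intc: "integrable lborel (\<lambda>\<tau>. indicator {0..s} \<tau> *\<^sub>R Lv)" "(\<integral>\<tau>. indicator {0..s} \<tau> *\<^sub>R Lv \<partial>lborel) = s *\<^sub>R Lv"
          using s by (auto intro!: integrable_scaleR_left)
        ultimately have eqs: "F (x + s *\<^sub>R v) - F x - s *\<^sub>R Lv = (\<integral>\<tau>. indicator {0..s} \<tau> *\<^sub>R (D (x + \<tau> *\<^sub>R v) - Lv) \<partial>lborel)"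
          using seg(1) by (simp add: scaleR_diff_right Bochner_Integration.integral_diff)
        have "ennreal (norm (F (x + s *\<^sub>R v) - F x - s *\<^sub>R Lv)) \<le> (\<integral>\<^sup>+\<tau>. ennreal (norm (indicator {0..s} \<tau> *\<^sub>R (D (x + \<tau> *\<^sub>R v) - Lv))) \<partial>lborel)"
          unfolding eqs using seg(1) intc(1) by (intro integral_norm_bound_ennreal) (simp add: scaleR_diff_right)
        also have "\<dots> \<le> (\<integral>\<^sup>+s. ennreal (norm (D (x + s *\<^sub>R v) - Lv)) * indicator {0..1::real} s \<partial>lborel)"
          using s by (intro nn_integral_mono) (auto simp: indicator_def)
        also note leE
        finally show ?thesis using E by (simp only: ennreal_le_iff)
      qed
      have eq1: "F (x + v) - F x = (\<integral>s. indicator {0..1} s *\<^sub>R D (x + s *\<^sub>R v) \<partial>lborel)"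
        using elim(1) xU by simp
      have "norm (F (x + v) - F x - Lv) \<le> E" using dev[of 1] eq1 by simp
      then show "norm (hpart (F (x + v)) - hpart (F x) - hpart Lv) \<le> E"
        using norm_hpart_le[of "F (x + v) - F x - Lv"] by simp
      define z0 where "z0 = hpart (F x)"
      \<comment> \<open>The contact form frozen at the initial point. Being linear it passes through
        the integral, and by the contact equation its value on D at parameter s pairs the horizontal
        displacement with the horizontal part of D.\<close>
      define k where "k = (\<lambda>y::'n heis. vpart y - sympl z0 (hpart y))"
      have blk: "bounded_linear k" unfolding k_def
        by (rule bounded_linear_sub[OF bounded_linear_vpart bounded_linear_compose[OF sympl.bounded_linear_right bounded_linear_hpart]])
      have "vpart (F (x + v)) - vpart (F x) - sympl (hpart (F x)) (hpart (F (x + v))) = k (F (x + v) - F x)"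
        by (simp add: k_def z0_def sympl.diff_right)
      also have "\<dots> = (\<integral>s. k (indicator {0..1} s *\<^sub>R D (x + s *\<^sub>R v)) \<partial>lborel)"
        unfolding eq1 by (rule integral_bounded_linear[OF blk int, symmetric])
      finally have T: "vpart (F (x + v)) - vpart (F x) - sympl (hpart (F x)) (hpart (F (x + v)))
        = (\<integral>s. k (indicator {0..1} s *\<^sub>R D (x + s *\<^sub>R v)) \<partial>lborel)" .
      have "ennreal \<bar>\<integral>s. k (indicator {0..1} s *\<^sub>R D (x + s *\<^sub>R v)) \<partial>lborel\<bar> \<le>
        (\<integral>\<^sup>+s. ennreal (norm (k (indicator {0..1} s *\<^sub>R D (x + s *\<^sub>R v)))) \<partial>lborel)"
        using integral_norm_bound_ennreal[OF integrable_bounded_linear[OF blk int]] by simp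
      also have "\<dots> \<le> (\<integral>\<^sup>+s. ennreal (E * norm Lv) * indicator {0..1} s +
          ennreal (norm Lv + E) * (ennreal (norm (D (x + s *\<^sub>R v) - Lv)) * indicator {0..1} s) \<partial>lborel)"
      proof (rule nn_integral_mono_AE)
        have "AE s in lborel. s \<noteq> (0::real)" by (rule AE_lborel_singleton)
        then show "AE s in lborel. ennreal (norm (k (indicator {0..1} s *\<^sub>R D (x + s *\<^sub>R v)))) \<le>
          ennreal (E * norm Lv) * indicator {0..1} s +
          ennreal (norm Lv + E) * (ennreal (norm (D (x + s *\<^sub>R v) - Lv)) * indicator {0..1} s)"
          using elim(2) elim(3)
        proof eventually_elim
          case (elim s)
          show ?case
          proof (cases "s \<in> {0..1}")
            case True
            then have s: "0 < s" "s \<le> 1" using elim(1) by auto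
            define y where "y = D (x + s *\<^sub>R v)"
            define \<alpha> where "\<alpha> = hpart (F (x + s *\<^sub>R v)) - z0 - s *\<^sub>R hpart Lv"
            define \<beta> where "\<beta> = hpart (y - Lv)"
            have "norm (F (x + s *\<^sub>R v) - F x - s *\<^sub>R Lv) \<le> E"
              using elim(2) xU sU[OF True] by (intro dev[OF s]) auto
            then have \<alpha>: "norm \<alpha> \<le> E"
              using norm_hpart_le[of "F (x + s *\<^sub>R v) - F x - s *\<^sub>R Lv"] by (simp add: \<alpha>_def z0_def)
            have \<beta>: "norm \<beta> \<le> norm (y - Lv)" unfolding \<beta>_def by (rule norm_hpart_le)
            have "k y = sympl (hpart (F (x + s *\<^sub>R v)) - z0) (hpart y)"
              using elim(3) sU[OF True] by (simp add: k_def y_def sympl.diff_left)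
            also have "hpart (F (x + s *\<^sub>R v)) - z0 = s *\<^sub>R hpart Lv + \<alpha>" by (simp add: \<alpha>_def)
            also have "hpart y = hpart Lv + \<beta>" by (simp add: \<beta>_def)
            also have "sympl (s *\<^sub>R hpart Lv + \<alpha>) (hpart Lv + \<beta>) = s * sympl (hpart Lv) \<beta> + sympl \<alpha> (hpart Lv) + sympl \<alpha> \<beta>"
              by (simp add: sympl.add_left sympl.add_right sympl.scaleR_left)
            also have "\<bar>\<dots>\<bar> \<le> \<bar>s * sympl (hpart Lv) \<beta>\<bar> + \<bar>sympl \<alpha> (hpart Lv)\<bar> + \<bar>sympl \<alpha> \<beta>\<bar>" by linarith
            also have "\<dots> \<le> norm Lv * norm (y - Lv) + E * norm Lv + E * norm (y - Lv)"
            proof (intro add_mono)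
              have "\<bar>s * sympl (hpart Lv) \<beta>\<bar> \<le> 1 * (norm (hpart Lv) * norm \<beta>)"
                unfolding abs_mult using s abs_sympl_le[of "hpart Lv" \<beta>] by (intro mult_mono) auto
              also have "\<dots> \<le> norm Lv * norm (y - Lv)"
                using \<beta> norm_hpart_le[of Lv] by (simp add: mult_mono)
              finally show "\<bar>s * sympl (hpart Lv) \<beta>\<bar> \<le> norm Lv * norm (y - Lv)" .
              show "\<bar>sympl \<alpha> (hpart Lv)\<bar> \<le> E * norm Lv"
                by (rule order_trans[OF abs_sympl_le]) (use \<alpha> norm_hpart_le[of Lv] E in \<open>intro mult_mono, auto\<close>)
              show "\<bar>sympl \<alpha> \<beta>\<bar> \<le> E * norm (y - Lv)"
                by (rule order_trans[OF abs_sympl_le]) (use \<alpha> \<beta> E in \<open>intro mult_mono, auto\<close>)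
            qed
            also have "\<dots> = E * norm Lv + (norm Lv + E) * norm (y - Lv)" by (simp add: algebra_simps)
            finally have "ennreal (norm (k y)) \<le> ennreal (E * norm Lv + (norm Lv + E) * norm (y - Lv))"
              by (intro ennreal_leI) simp
            then show ?thesis using True E by (simp add: y_def ennreal_mult)
          qed (simp add: linear_0[OF bounded_linear.linear[OF blk]])
        qed
      qed
      also have "\<dots> = ennreal (E * norm Lv) +
          ennreal (norm Lv + E) * (\<integral>\<^sup>+s. ennreal (norm (D (x + s *\<^sub>R v) - Lv)) * indicator {0..1::real} s \<partial>lborel)"
        by (subst nn_integral_add) (auto simp: nn_integral_cmult nn_integral_cmult_indicator)
      also have "\<dots> \<le> ennreal (E * norm Lv) + ennreal (norm Lv + E) * ennreal E"
        by (intro add_left_mono mult_left_mono leE) simp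
      also have "\<dots> = ennreal (2 * norm Lv * E + E\<^sup>2)"
        using E by (simp add: ennreal_mult[symmetric] ennreal_plus[symmetric] power2_eq_square del: ennreal_plus) (simp add: algebra_simps)
      finally show "\<bar>vpart (F (x + v)) - vpart (F x) - sympl (hpart (F x)) (hpart (F (x + v)))\<bar> \<le> 2 * norm Lv * E + E\<^sup>2"
        unfolding T using E by (subst (asm) ennreal_le_iff) auto
    qed
  qed
qed

text \<open>Going around the parallelogram with edges along \<open>v\<close> and \<open>w\<close>, the vertical increments cancel,
  so the enclosed symplectic area vanishes up to the edge errors.\<close>

lemma symplectic_area_loop:
  fixes z0 z1 z2 z3 A B :: "(real^'n::finite) \<times> (real^'n)"
  assumes d: "norm (z1 - z0 - A) \<le> e" "norm (z2 - z1 - B) \<le> e" "norm (z3 - z0 - B) \<le> e"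
    and T: "\<bar>t1 - t0 - sympl z0 z1\<bar> \<le> c" "\<bar>t2 - t1 - sympl z1 z2\<bar> \<le> c" "\<bar>t2 - t3 - sympl z3 z2\<bar> \<le> c" "\<bar>t3 - t0 - sympl z0 z3\<bar> \<le> c"
    and N: "norm A + norm B \<le> N"
  shows "2 * \<bar>sympl A B\<bar> \<le> 4 * c + 4 * N * e + 4 * e\<^sup>2"
proof -
  define a1 where "a1 = z1 - z0 - A"
  define a2 where "a2 = z2 - z0 - A - B"
  define a3 where "a3 = z3 - z0 - B"
  have z: "z1 = z0 + (A + a1)" "z2 = z0 + (A + B + a2)" "z3 = z0 + (B + a3)" by (simp_all add: a1_def a2_def a3_def)
  have e0: "0 \<le> e" using d(1) norm_ge_zero order_trans by blast
  have N0: "0 \<le> N" using N norm_ge_zero[of A] norm_ge_zero[of B] by linarith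
  have a2: "norm a2 \<le> 2 * e"
    using norm_triangle_ineq[of "z1 - z0 - A" "z2 - z1 - B"] d by (simp add: a2_def algebra_simps)
  have a13: "norm (a1 - a3) \<le> 2 * e" using norm_triangle_ineq4[of a1 a3] d by (simp add: a1_def a3_def)
  \<comment> \<open>All terms containing the base point cancel. The exact parallelogram contributes
    \<open>2 * sympl A B\<close>; the corner deviations a1, a2, a3 contribute the remainder.\<close>
  have "sympl z0 z1 + sympl z1 z2 - sympl z3 z2 - sympl z0 z3 = 2 * sympl A B + sympl (A - B) a2 + sympl (a1 - a3) (A + B) + sympl (a1 - a3) a2"
    unfolding z
    by (simp add: sympl.add_left sympl.add_right sympl.diff_left sympl_commute[of B A] sympl_commute[of _ z0])
  moreover have "\<bar>sympl z0 z1 + sympl z1 z2 - sympl z3 z2 - sympl z0 z3\<bar> \<le> 4 * c"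
    using T by linarith
  moreover have "\<bar>sympl (A - B) a2\<bar> \<le> N * (2 * e)"
    by (rule order_trans[OF abs_sympl_le]) (use N a2 e0 N0 norm_triangle_ineq4[of A B] in \<open>intro mult_mono, auto\<close>)
  moreover have "\<bar>sympl (a1 - a3) (A + B)\<bar> \<le> (2 * e) * N"
    by (rule order_trans[OF abs_sympl_le]) (use N a13 e0 N0 norm_triangle_ineq[of A B] in \<open>intro mult_mono, auto\<close>)
  moreover have "\<bar>sympl (a1 - a3) a2\<bar> \<le> (2 * e) * (2 * e)"
    by (rule order_trans[OF abs_sympl_le]) (use a13 a2 e0 in \<open>intro mult_mono, auto\<close>)
  moreover have "N * (2 * e) = 2 * (N * e)" "2 * e * N = 2 * (N * e)" "2 * e * (2 * e) = 4 * e\<^sup>2" "4 * N * e = 4 * (N * e)"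
    by (simp_all add: power2_eq_square)
  ultimately show ?thesis by linarith
qed

text \<open>For every s the translation by \<open>a + s *\<^sub>R v\<close> has length at most 2 r,
  so the ball of radius r lands in the concentric ball of radius 3 r.\<close>

lemma segment_average_le:
  fixes g :: "'a::euclidean_space \<Rightarrow> ennreal"
  assumes [measurable]: "g \<in> borel_measurable borel" and a: "norm a \<le> r" and v: "norm v \<le> r"
  shows "(\<integral>\<^sup>+x\<in>cball x0 r. (\<integral>\<^sup>+s\<in>{0..1::real}. g (x + a + s *\<^sub>R v) \<partial>lborel) \<partial>lborel) \<le> (\<integral>\<^sup>+y\<in>cball x0 (3 * r). g y \<partial>lborel)"
proof -
  have [measurable]: "cball (z::'a) t \<in> sets borel" for z t by simp
  have "(\<integral>\<^sup>+x\<in>cball x0 r. (\<integral>\<^sup>+s\<in>{0..1::real}. g (x + a + s *\<^sub>R v) \<partial>lborel) \<partial>lborel)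
    = (\<integral>\<^sup>+x. (\<integral>\<^sup>+s. g (x + a + s *\<^sub>R v) * indicator {0..1::real} s * indicator (cball x0 r) x \<partial>lborel) \<partial>lborel)"
    by (intro nn_integral_cong nn_integral_multc[symmetric]) measurable
  also have "\<dots> = (\<integral>\<^sup>+s. (\<integral>\<^sup>+x. g (x + a + s *\<^sub>R v) * indicator {0..1::real} s * indicator (cball x0 r) x \<partial>lborel) \<partial>lborel)"
    by (rule lborel_pair.Fubini'[symmetric]) measurable
  also have "\<dots> \<le> (\<integral>\<^sup>+s. (\<integral>\<^sup>+y\<in>cball x0 (3 * r). g y \<partial>lborel) * indicator {0..1::real} s \<partial>lborel)"
  proof (rule nn_integral_mono)
    fix s :: real
    show "(\<integral>\<^sup>+x. g (x + a + s *\<^sub>R v) * indicator {0..1::real} s * indicator (cball x0 r) x \<partial>lborel)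
      \<le> (\<integral>\<^sup>+y\<in>cball x0 (3 * r). g y \<partial>lborel) * indicator {0..1::real} s"
    proof (cases "s \<in> {0..1}")
      case True
      have "(\<integral>\<^sup>+x. g (x + a + s *\<^sub>R v) * indicator {0..1::real} s * indicator (cball x0 r) x \<partial>lborel)
        \<le> (\<integral>\<^sup>+x. g (x + (a + s *\<^sub>R v)) * indicator (cball x0 (3 * r)) (x + (a + s *\<^sub>R v)) \<partial>lborel)"
      proof (rule nn_integral_mono)
        fix x
        have "x + (a + s *\<^sub>R v) \<in> cball x0 (3 * r)" if "x \<in> cball x0 r"
        proof -
          have "norm (s *\<^sub>R v) \<le> 1 * r" using True v by (simp only: norm_scaleR) (intro mult_mono, auto)
          then have "norm ((x - x0) + a + s *\<^sub>R v) \<le> r + r + r"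
            using that a by (intro norm_triangle_le add_mono) (auto simp: dist_norm norm_minus_commute)
          moreover have "x0 - (x + (a + s *\<^sub>R v)) = - ((x - x0) + a + s *\<^sub>R v)" by simp
          ultimately show ?thesis by (simp only: mem_cball dist_norm norm_minus_cancel)
        qed
        then show "g (x + a + s *\<^sub>R v) * indicator {0..1::real} s * indicator (cball x0 r) x
          \<le> g (x + (a + s *\<^sub>R v)) * indicator (cball x0 (3 * r)) (x + (a + s *\<^sub>R v))"
          using True by (auto simp: indicator_def add.assoc simp del: mem_cball)
      qed
      also have "\<dots> = (\<integral>\<^sup>+y\<in>cball x0 (3 * r). g y \<partial>lborel)"
        by (rule nn_integral_translate[of "\<lambda>y. g y * indicator (cball x0 (3 * r)) y"]) measurable
      finally show ?thesis using True by simp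
    qed simp
  qed
  also have "\<dots> = (\<integral>\<^sup>+y\<in>cball x0 (3 * r). g y \<partial>lborel)" by (simp add: nn_integral_cmult_indicator)
  finally show ?thesis .
qed

text \<open>The edge estimates may fail at x0 itself, so the base point of the loop is moved within
  a small ball around it. On average over that ball all four edges see derivatives close to those at
  x0; dividing the loop inequality by r^2 leaves an error that vanishes with the tolerance
  \<open>\<kappa>\<close>.\<close>

theorem contact_symplectic_orthogonal:
  fixes F Dv Dw :: "'a::euclidean_space \<Rightarrow> 'n::finite heis"
  assumes F: "integrable lborel F" and D: "integrable lborel Dv" "integrable lborel Dw"
    and weak: "weak_directional U v F Dv" "weak_directional U w F Dw"
    and U: "convex U" "open U"
    and contact: "AE x in lborel. x \<in> U \<longrightarrow> vpart (Dv x) = sympl (hpart (F x)) (hpart (Dv x))"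
      "AE x in lborel. x \<in> U \<longrightarrow> vpart (Dw x) = sympl (hpart (F x)) (hpart (Dw x))"
    and x0: "x0 \<in> U" and vw: "norm v \<le> 1" "norm w \<le> 1"
    and leb: "lebesgue_point Dv x0" "lebesgue_point Dw x0"
  shows "sympl (hpart (Dv x0)) (hpart (Dw x0)) = 0"
proof -
  have Dm[measurable]: "Dv \<in> borel_measurable borel" "Dw \<in> borel_measurable borel"
    using D by (simp_all add: borel_measurable_integrable)
  have [measurable]: "cball (z::'a) t \<in> sets borel" for z t by simp
  define N where "N = norm (Dv x0) + norm (Dw x0)"
  have N0: "N \<ge> 0" by (simp add: N_def)
  define gv where "gv y = ennreal (norm (Dv y - Dv x0))" for y
  define gw where "gw y = ennreal (norm (Dw y - Dw x0))" for y
  have [measurable]: "gv \<in> borel_measurable borel" "gw \<in> borel_measurable borel" unfolding gv_def gw_def by measurable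
  have main: "\<bar>sympl (hpart (Dv x0)) (hpart (Dw x0))\<bar> \<le> 6 * N * \<kappa> + 4 * \<kappa>\<^sup>2" if \<kappa>: "\<kappa> > 0" for \<kappa>
  proof -
    \<comment> \<open>Tripling the radius costs 3^\<open>DIM('a)\<close> and there are four edges,
      so the mean total error is at most 4/5 of \<open>\<kappa>\<close>, strictly below it.\<close>
    define e where "e = \<kappa> / (5 * 3 ^ DIM('a))"
    have e: "e > 0" using \<kappa> by (simp add: e_def)
    obtain R1 where R1: "R1 > 0" "\<And>r. 0 < r \<Longrightarrow> r < R1 \<Longrightarrow> (\<integral>\<^sup>+y\<in>cball x0 r. gv y \<partial>lborel) \<le> ennreal e * emeasure lborel (cball x0 r)"
      using leb(1) e unfolding lebesgue_point_def gv_def by blast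
    obtain R2 where R2: "R2 > 0" "\<And>r. 0 < r \<Longrightarrow> r < R2 \<Longrightarrow> (\<integral>\<^sup>+y\<in>cball x0 r. gw y \<partial>lborel) \<le> ennreal e * emeasure lborel (cball x0 r)"
      using leb(2) e unfolding lebesgue_point_def gw_def by blast
    obtain R3 where R3: "R3 > 0" "ball x0 R3 \<subseteq> U" using U(2) x0 open_contains_ball by blast
    \<comment> \<open>The moved base point is within r of x0 and the corners within a further 2 r,
      so everything happens at radius 3 r, strictly inside all three bounds.\<close>
    define r where "r = min R1 (min R2 R3) / 6"
    have r: "0 < r" "3 * r < R1" "3 * r < R2" "3 * r < R3" using R1 R2 R3 by (auto simp: r_def)
    have nr: "norm (r *\<^sub>R v) \<le> r" "norm (r *\<^sub>R w) \<le> r" using vw r by (simp_all add: mult_left_le)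
    define Iv where "Iv x = (\<integral>\<^sup>+s. gv (x + s *\<^sub>R (r *\<^sub>R v)) * indicator {0..1::real} s \<partial>lborel)" for x
    define Iw where "Iw x = (\<integral>\<^sup>+s. gw (x + s *\<^sub>R (r *\<^sub>R w)) * indicator {0..1::real} s \<partial>lborel)" for x
    have [measurable]: "Iv \<in> borel_measurable borel" "Iw \<in> borel_measurable borel" unfolding Iv_def Iw_def by measurable
    have Imeas[measurable]: "(\<lambda>x. Iv (x + a)) \<in> borel_measurable borel" "(\<lambda>x. Iw (x + a)) \<in> borel_measurable borel" for a
      by measurable
    have scale: "emeasure lborel (cball x0 (3 * r)) = ennreal (3 ^ DIM('a)) * emeasure lborel (cball x0 r)"
      using r by (intro emeasure_cball_scale) auto
    have Ivle: "(\<integral>\<^sup>+x\<in>cball x0 r. Iv (x + a) \<partial>lborel) \<le> ennreal (e * 3 ^ DIM('a)) * emeasure lborel (cball x0 r)"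
      and Iwle: "(\<integral>\<^sup>+x\<in>cball x0 r. Iw (x + a) \<partial>lborel) \<le> ennreal (e * 3 ^ DIM('a)) * emeasure lborel (cball x0 r)"
      if a: "norm a \<le> r" for a
    proof -
      have "(\<integral>\<^sup>+x\<in>cball x0 r. Iv (x + a) \<partial>lborel) \<le> ennreal e * emeasure lborel (cball x0 (3 * r))"
        unfolding Iv_def using r by (intro order_trans[OF segment_average_le[OF _ a nr(1)] R1(2)]) auto
      then show "(\<integral>\<^sup>+x\<in>cball x0 r. Iv (x + a) \<partial>lborel) \<le> ennreal (e * 3 ^ DIM('a)) * emeasure lborel (cball x0 r)"
        using e by (simp add: scale ennreal_mult mult.assoc)
      have "(\<integral>\<^sup>+x\<in>cball x0 r. Iw (x + a) \<partial>lborel) \<le> ennreal e * emeasure lborel (cball x0 (3 * r))"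
        unfolding Iw_def using r by (intro order_trans[OF segment_average_le[OF _ a nr(2)] R2(2)]) auto
      then show "(\<integral>\<^sup>+x\<in>cball x0 r. Iw (x + a) \<partial>lborel) \<le> ennreal (e * 3 ^ DIM('a)) * emeasure lborel (cball x0 r)"
        using e by (simp add: scale ennreal_mult mult.assoc)
    qed
    define S where "S x = (Iv (x + 0) + Iw (x + r *\<^sub>R v)) + (Iv (x + r *\<^sub>R w) + Iw (x + 0))" for x
    have Sint: "(\<integral>\<^sup>+x\<in>cball x0 r. S x \<partial>lborel) \<le> ennreal (4 * (e * 3 ^ DIM('a))) * emeasure lborel (cball x0 r)"
    proof -
      have addi: "(\<integral>\<^sup>+x\<in>cball x0 r. (p x + q x) \<partial>lborel) = (\<integral>\<^sup>+x\<in>cball x0 r. p x \<partial>lborel) + (\<integral>\<^sup>+x\<in>cball x0 r. q x \<partial>lborel)"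
        if [measurable]: "p \<in> borel_measurable borel" "q \<in> borel_measurable borel" for p q :: "'a \<Rightarrow> ennreal"
        unfolding distrib_right by (rule nn_integral_add) measurable
      note I2 = borel_measurable_add[OF Imeas(1)[of 0] Imeas(2)[of "r *\<^sub>R v"]] borel_measurable_add[OF Imeas(1)[of "r *\<^sub>R w"] Imeas(2)[of 0]]
      have "(\<integral>\<^sup>+x\<in>cball x0 r. S x \<partial>lborel) =
        ((\<integral>\<^sup>+x\<in>cball x0 r. Iv (x + 0) \<partial>lborel) + (\<integral>\<^sup>+x\<in>cball x0 r. Iw (x + r *\<^sub>R v) \<partial>lborel)) +
        ((\<integral>\<^sup>+x\<in>cball x0 r. Iv (x + r *\<^sub>R w) \<partial>lborel) + (\<integral>\<^sup>+x\<in>cball x0 r. Iw (x + 0) \<partial>lborel))"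
        unfolding S_def addi[OF I2] addi[OF Imeas(1) Imeas(2)] ..
      also have "\<dots> \<le> (ennreal (e * 3 ^ DIM('a)) * emeasure lborel (cball x0 r) + ennreal (e * 3 ^ DIM('a)) * emeasure lborel (cball x0 r)) +
        (ennreal (e * 3 ^ DIM('a)) * emeasure lborel (cball x0 r) + ennreal (e * 3 ^ DIM('a)) * emeasure lborel (cball x0 r))"
      proof -
        have "norm (0::'a) \<le> r" using r by simp
        note 1 = Ivle[OF this] and 2 = Iwle[OF nr(1)] and 3 = Ivle[OF nr(2)] and 4 = Iwle[OF this]
        show ?thesis by (rule add_mono[OF add_mono[OF 1 2] add_mono[OF 3 4]])
      qed
      also have "\<dots> = ennreal (4 * (e * 3 ^ DIM('a))) * emeasure lborel (cball x0 r)"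
      proof -
        have "ennreal (4 * t) = (ennreal t + ennreal t) + (ennreal t + ennreal t)" if "t \<ge> 0" for t
          using that by (simp add: ennreal_plus[symmetric] del: ennreal_plus)
        from this[of "e * 3 ^ DIM('a)"] e
        have "ennreal (4 * (e * 3 ^ DIM('a))) = (ennreal (e * 3 ^ DIM('a)) + ennreal (e * 3 ^ DIM('a))) + (ennreal (e * 3 ^ DIM('a)) + ennreal (e * 3 ^ DIM('a)))"
          by simp
        then show ?thesis by (simp only: distrib_right)
      qed
      finally show ?thesis .
    qed
    define Q where "Q x a Da \<longleftrightarrow> (x \<in> U \<and> x + r *\<^sub>R a \<in> U \<longrightarrow>
      (\<forall>E\<ge>0. (\<integral>\<^sup>+s. ennreal (norm (r *\<^sub>R Da (x + s *\<^sub>R (r *\<^sub>R a)) - r *\<^sub>R Da x0)) * indicator {0..1::real} s \<partial>lborel) \<le> ennreal E \<longrightarrow>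
      norm (hpart (F (x + r *\<^sub>R a)) - hpart (F x) - hpart (r *\<^sub>R Da x0)) \<le> E \<and>
      \<bar>vpart (F (x + r *\<^sub>R a)) - vpart (F x) - sympl (hpart (F x)) (hpart (F (x + r *\<^sub>R a)))\<bar> \<le> 2 * norm (r *\<^sub>R Da x0) * E + E\<^sup>2))"
      for x a and Da :: "'a \<Rightarrow> 'n heis"
    have QAE: "AE x in lborel. Q x a Da" if "integrable lborel Da" "weak_directional U a F Da"
      "AE x in lborel. x \<in> U \<longrightarrow> vpart (Da x) = sympl (hpart (F x)) (hpart (Da x))" for a Da
      unfolding Q_def
    proof (rule contact_edge_estimate[OF F _ weak_directional_scale[OF that(2)] U])
      show "integrable lborel (\<lambda>x. r *\<^sub>R Da x)" using that(1) by simp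
      show "AE x in lborel. x \<in> U \<longrightarrow> vpart (r *\<^sub>R Da x) = sympl (hpart (F x)) (hpart (r *\<^sub>R Da x))"
        using that(3) by eventually_elim (simp add: sympl.scaleR_right)
    qed
    \<comment> \<open>A Chebyshev argument: if S exceeded \<open>\<kappa>\<close> at almost every
      point of the ball, its mean would be at least \<open>\<kappa>\<close>. The four edge estimates
      hold almost everywhere, so one point satisfies everything at once.\<close>
    have "\<exists>x\<in>cball x0 r. S x \<le> ennreal \<kappa> \<and> Q x v Dv \<and> Q (x + r *\<^sub>R v) w Dw \<and> Q (x + r *\<^sub>R w) v Dv \<and> Q x w Dw"
    proof (rule ccontr)
      assume neg: "\<not> ?thesis"
      have "AE x in lborel. ennreal \<kappa> * indicator (cball x0 r) x \<le> S x * indicator (cball x0 r) x"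
        using QAE[OF D(1) weak(1) contact(1)] QAE[OF D(2) weak(2) contact(2)]
          AE_translate[OF QAE[OF D(1) weak(1) contact(1)], of "r *\<^sub>R w"] AE_translate[OF QAE[OF D(2) weak(2) contact(2)], of "r *\<^sub>R v"]
      proof eventually_elim
        case (elim x)
        then show ?case using neg by (cases "x \<in> cball x0 r") (auto simp: not_le less_imp_le simp del: mem_cball)
      qed
      then have "(\<integral>\<^sup>+x. ennreal \<kappa> * indicator (cball x0 r) x \<partial>lborel) \<le> (\<integral>\<^sup>+x\<in>cball x0 r. S x \<partial>lborel)"
        by (rule nn_integral_mono_AE)
      then have le: "ennreal \<kappa> * emeasure lborel (cball x0 r) \<le> ennreal (4 * (e * 3 ^ DIM('a))) * emeasure lborel (cball x0 r)"
        using Sint by (simp add: nn_integral_cmult_indicator)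
      obtain m where m: "m > 0" "emeasure lborel (cball x0 r) = ennreal m"
        using r that[of "measure lborel (cball x0 r)"] by (auto simp: emeasure_cball content_cball)
      from le have "\<kappa> * m \<le> 4 * (e * 3 ^ DIM('a)) * m"
        unfolding m using m(1) e \<kappa> by (simp add: ennreal_mult[symmetric])
      then have "\<kappa> \<le> 4 * (e * 3 ^ DIM('a))" using m(1) by simp
      then show False using \<kappa> by (simp add: e_def)
    qed
    then obtain x where x: "x \<in> cball x0 r" "S x \<le> ennreal \<kappa>" "Q x v Dv" "Q (x + r *\<^sub>R v) w Dw" "Q (x + r *\<^sub>R w) v Dv" "Q x w Dw"
      by blast
    have inU: "x + a \<in> U" if "norm a \<le> 2 * r" for a
    proof -
      have "norm (x0 - (x + a)) \<le> norm (x0 - x) + norm a" using norm_triangle_ineq4[of "x0 - x" a] by (simp add: algebra_simps)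
      also have "\<dots> < R3" using x(1) that r by (simp add: dist_norm)
      finally show ?thesis using R3 by (auto simp: dist_norm)
    qed
    have xU: "x \<in> U" "x + r *\<^sub>R v \<in> U" "x + r *\<^sub>R w \<in> U" "x + r *\<^sub>R v + r *\<^sub>R w \<in> U" "x + r *\<^sub>R w + r *\<^sub>R v \<in> U"
      using inU[of 0] inU[of "r *\<^sub>R v"] inU[of "r *\<^sub>R w"] inU[of "r *\<^sub>R v + r *\<^sub>R w"] nr r norm_triangle_ineq[of "r *\<^sub>R v" "r *\<^sub>R w"]
      by (simp_all add: add_ac)
    have SI: "Iv x \<le> ennreal \<kappa>" "Iw (x + r *\<^sub>R v) \<le> ennreal \<kappa>" "Iv (x + r *\<^sub>R w) \<le> ennreal \<kappa>" "Iw x \<le> ennreal \<kappa>"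
    proof -
      have *: "p \<le> (p + q) + (u + t)" "q \<le> (p + q) + (u + t)" "u \<le> (p + q) + (u + t)" "t \<le> (p + q) + (u + t)" for p q u t :: ennreal
        by (rule add_increasing2[OF _ add_increasing2[OF _ order_refl]], simp, simp)
          (rule add_increasing2[OF _ add_increasing[OF _ order_refl]], simp, simp,
           rule add_increasing[OF _ add_increasing2[OF _ order_refl]], simp, simp,
           rule add_increasing[OF _ add_increasing[OF _ order_refl]], simp, simp)
      have "Iv (x + 0) \<le> ennreal \<kappa>" "Iw (x + 0) \<le> ennreal \<kappa>"
        by (rule order_trans[OF _ x(2)], unfold S_def, rule *)+
      then show "Iv x \<le> ennreal \<kappa>" "Iw x \<le> ennreal \<kappa>" by simp_all
      show "Iw (x + r *\<^sub>R v) \<le> ennreal \<kappa>" "Iv (x + r *\<^sub>R w) \<le> ennreal \<kappa>"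
        by (rule order_trans[OF _ x(2)], unfold S_def, rule *)+
    qed
    have edge: "norm (hpart (F (y + r *\<^sub>R a)) - hpart (F y) - r *\<^sub>R hpart (Da x0)) \<le> r * \<kappa>"
      "\<bar>vpart (F (y + r *\<^sub>R a)) - vpart (F y) - sympl (hpart (F y)) (hpart (F (y + r *\<^sub>R a)))\<bar> \<le> 2 * (r * norm (Da x0)) * (r * \<kappa>) + (r * \<kappa>)\<^sup>2"
      if "Q y a Da" "y \<in> U" "y + r *\<^sub>R a \<in> U"
        "(\<integral>\<^sup>+s. ennreal (norm (Da (y + s *\<^sub>R (r *\<^sub>R a)) - Da x0)) * indicator {0..1::real} s \<partial>lborel) \<le> ennreal \<kappa>"
        and [measurable]: "Da \<in> borel_measurable borel" for y a and Da :: "'a \<Rightarrow> 'n heis"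
    proof -
      have "(\<integral>\<^sup>+s. ennreal (norm (r *\<^sub>R Da (y + s *\<^sub>R (r *\<^sub>R a)) - r *\<^sub>R Da x0)) * indicator {0..1::real} s \<partial>lborel)
        = (\<integral>\<^sup>+s. ennreal r * (ennreal (norm (Da (y + s *\<^sub>R (r *\<^sub>R a)) - Da x0)) * indicator {0..1::real} s) \<partial>lborel)"
        using r by (intro nn_integral_cong) (simp add: scaleR_diff_right[symmetric] ennreal_mult mult.assoc)
      also have "\<dots> = ennreal r * (\<integral>\<^sup>+s. ennreal (norm (Da (y + s *\<^sub>R (r *\<^sub>R a)) - Da x0)) * indicator {0..1::real} s \<partial>lborel)"
        by (rule nn_integral_cmult) measurable
      also have "\<dots> \<le> ennreal r * ennreal \<kappa>" by (intro mult_left_mono that) simp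
      also have "\<dots> = ennreal (r * \<kappa>)" using r \<kappa> by (simp add: ennreal_mult)
      finally have le: "(\<integral>\<^sup>+s. ennreal (norm (r *\<^sub>R Da (y + s *\<^sub>R (r *\<^sub>R a)) - r *\<^sub>R Da x0)) * indicator {0..1::real} s \<partial>lborel) \<le> ennreal (r * \<kappa>)" .
      have "0 \<le> r * \<kappa>" using r \<kappa> by simp
      from that(1)[unfolded Q_def, rule_format, OF conjI[OF that(2,3)] this le]
      show "norm (hpart (F (y + r *\<^sub>R a)) - hpart (F y) - r *\<^sub>R hpart (Da x0)) \<le> r * \<kappa>"
        "\<bar>vpart (F (y + r *\<^sub>R a)) - vpart (F y) - sympl (hpart (F y)) (hpart (F (y + r *\<^sub>R a)))\<bar> \<le> 2 * (r * norm (Da x0)) * (r * \<kappa>) + (r * \<kappa>)\<^sup>2"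
        using r by simp_all
    qed
    have c: "2 * (r * norm (Dv x0)) * (r * \<kappa>) + (r * \<kappa>)\<^sup>2 \<le> r\<^sup>2 * (2 * N * \<kappa> + \<kappa>\<^sup>2)"
      "2 * (r * norm (Dw x0)) * (r * \<kappa>) + (r * \<kappa>)\<^sup>2 \<le> r\<^sup>2 * (2 * N * \<kappa> + \<kappa>\<^sup>2)"
    proof -
      have *: "2 * (r * t) * (r * \<kappa>) + (r * \<kappa>)\<^sup>2 \<le> r\<^sup>2 * (2 * N * \<kappa> + \<kappa>\<^sup>2)" if "t \<le> N" for t
      proof -
        have "r\<^sup>2 * (2 * t * \<kappa> + \<kappa>\<^sup>2) \<le> r\<^sup>2 * (2 * N * \<kappa> + \<kappa>\<^sup>2)"
          using that \<kappa> by (intro mult_left_mono add_right_mono mult_right_mono) auto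
        then show ?thesis by (simp add: power2_eq_square algebra_simps)
      qed
      show "2 * (r * norm (Dv x0)) * (r * \<kappa>) + (r * \<kappa>)\<^sup>2 \<le> r\<^sup>2 * (2 * N * \<kappa> + \<kappa>\<^sup>2)"
        "2 * (r * norm (Dw x0)) * (r * \<kappa>) + (r * \<kappa>)\<^sup>2 \<le> r\<^sup>2 * (2 * N * \<kappa> + \<kappa>\<^sup>2)"
        by (intro *; simp add: N_def)+
    qed
    note e01 = edge[OF x(3) xU(1,2) SI(1)[unfolded Iv_def gv_def] Dm(1)]
    note e12 = edge[OF x(4) xU(2,4) SI(2)[unfolded Iw_def gw_def] Dm(2)]
    note e32 = edge[OF x(5) xU(3,5) SI(3)[unfolded Iv_def gv_def] Dm(1)]
    note e03 = edge[OF x(6) xU(1,3) SI(4)[unfolded Iw_def gw_def] Dm(2)]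
    have comm: "x + r *\<^sub>R w + r *\<^sub>R v = x + r *\<^sub>R v + r *\<^sub>R w" by simp
    have "2 * \<bar>sympl (r *\<^sub>R hpart (Dv x0)) (r *\<^sub>R hpart (Dw x0))\<bar> \<le> 4 * (r\<^sup>2 * (2 * N * \<kappa> + \<kappa>\<^sup>2)) + 4 * (r * N) * (r * \<kappa>) + 4 * (r * \<kappa>)\<^sup>2"
    proof (rule symplectic_area_loop[OF e01(1) e12(1) e03(1)])
      show "\<bar>vpart (F (x + r *\<^sub>R v)) - vpart (F x) - sympl (hpart (F x)) (hpart (F (x + r *\<^sub>R v)))\<bar> \<le> r\<^sup>2 * (2 * N * \<kappa> + \<kappa>\<^sup>2)"
        by (rule order_trans[OF e01(2) c(1)])
      show "\<bar>vpart (F (x + r *\<^sub>R v + r *\<^sub>R w)) - vpart (F (x + r *\<^sub>R v)) - sympl (hpart (F (x + r *\<^sub>R v))) (hpart (F (x + r *\<^sub>R v + r *\<^sub>R w)))\<bar> \<le> r\<^sup>2 * (2 * N * \<kappa> + \<kappa>\<^sup>2)"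
        by (rule order_trans[OF e12(2) c(2)])
      show "\<bar>vpart (F (x + r *\<^sub>R v + r *\<^sub>R w)) - vpart (F (x + r *\<^sub>R w)) - sympl (hpart (F (x + r *\<^sub>R w))) (hpart (F (x + r *\<^sub>R v + r *\<^sub>R w)))\<bar> \<le> r\<^sup>2 * (2 * N * \<kappa> + \<kappa>\<^sup>2)"
        by (rule order_trans[OF e32(2)[unfolded comm] c(1)])
      show "\<bar>vpart (F (x + r *\<^sub>R w)) - vpart (F x) - sympl (hpart (F x)) (hpart (F (x + r *\<^sub>R w)))\<bar> \<le> r\<^sup>2 * (2 * N * \<kappa> + \<kappa>\<^sup>2)"
        by (rule order_trans[OF e03(2) c(2)])
      show "norm (r *\<^sub>R hpart (Dv x0)) + norm (r *\<^sub>R hpart (Dw x0)) \<le> r * N"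
        using r norm_hpart_le[of "Dv x0"] norm_hpart_le[of "Dw x0"] by (simp add: N_def distrib_left add_mono)
    qed
    then have "r\<^sup>2 * (2 * \<bar>sympl (hpart (Dv x0)) (hpart (Dw x0))\<bar>) \<le> r\<^sup>2 * (12 * N * \<kappa> + 8 * \<kappa>\<^sup>2)"
      using r by (simp add: sympl.scaleR_left sympl.scaleR_right abs_mult power2_eq_square algebra_simps)
    then have "2 * \<bar>sympl (hpart (Dv x0)) (hpart (Dw x0))\<bar> \<le> 12 * N * \<kappa> + 8 * \<kappa>\<^sup>2"
      using r by (subst (asm) mult_le_cancel_left_pos) auto
    then show ?thesis by simp
  qed
  show ?thesis
  proof (rule ccontr)
    assume "\<not> ?thesis"
    then have \<sigma>: "\<bar>sympl (hpart (Dv x0)) (hpart (Dw x0))\<bar> > 0" (is "?\<sigma> > 0") by simp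
    \<comment> \<open>With \<open>\<kappa>\<close> at most 1 the error is at most (6 N + 4)
      \<open>\<kappa>\<close>, here at most half of the supposed nonzero value.\<close>
    define \<kappa> where "\<kappa> = min 1 (?\<sigma> / (2 * (6 * N + 4)))"
    have \<kappa>: "\<kappa> > 0" "\<kappa> \<le> 1" using \<sigma> N0 by (auto simp: \<kappa>_def)
    have "?\<sigma> \<le> 6 * N * \<kappa> + 4 * \<kappa>\<^sup>2" by (rule main[OF \<kappa>(1)])
    also have "\<dots> \<le> 6 * N * \<kappa> + 4 * \<kappa>" using \<kappa> by (simp add: power2_eq_square mult_left_le)
    also have "\<dots> = (6 * N + 4) * \<kappa>" by (simp add: algebra_simps)
    also have "\<dots> \<le> (6 * N + 4) * (?\<sigma> / (2 * (6 * N + 4)))" using N0 by (intro mult_left_mono) (auto simp: \<kappa>_def)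
    also have "\<dots> = ?\<sigma> / 2" using N0 by (simp add: divide_simps)
    finally show False using \<sigma> by simp
  qed
qed

subsection \<open>Proof of the theorem\<close>

lemma hausdorff_measure_wrt_mono:
  assumes "S \<subseteq> T" shows "hausdorff_measure_wrt d s S \<le> hausdorff_measure_wrt d s T"
  unfolding hausdorff_measure_wrt_def
proof (rule SUP_mono)
  fix \<delta> :: real assume "\<delta> \<in> {0<..}"
  moreover have "hausdorff_pre d s \<delta> S \<le> hausdorff_pre d s \<delta> T"
    unfolding hausdorff_pre_def by (rule INF_superset_mono) (use assms in auto)
  ultimately show "\<exists>m\<in>{0<..}. hausdorff_pre d s \<delta> S \<le> hausdorff_pre d s m T" by blast
qed

section \<open>Borel representatives and localised weak derivatives\<close>

lemma lebesgue_ex_borel: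
  fixes h :: "'a::euclidean_space \<Rightarrow> 'b::euclidean_space"
  assumes "h \<in> borel_measurable lebesgue"
  shows "\<exists>H\<in>borel_measurable borel. AE x in lborel. h x = H x"
proof -
  have "\<exists>g\<in>borel_measurable lborel. AE x in lborel. h x \<bullet> b = g x" for b
    using borel_measurable_inner[OF assms, of "\<lambda>_. b"] by (intro completion_ex_borel_measurable_real) simp
  then obtain g where g: "\<And>b. g b \<in> borel_measurable lborel" "\<And>b. AE x in lborel. h x \<bullet> b = g b x" by metis
  have "AE x in lborel. \<forall>b\<in>Basis. h x \<bullet> b = g b x" using g(2) by (intro AE_finite_allI) auto
  then have "AE x in lborel. h x = (\<Sum>b\<in>Basis. g b x *\<^sub>R b)"
  proof eventually_elim
    case (elim x)
    have "h x = (\<Sum>b\<in>Basis. (h x \<bullet> b) *\<^sub>R b)" by (rule euclidean_representation[symmetric])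
    then show ?case using elim by simp
  qed
  moreover have "(\<lambda>x. \<Sum>b\<in>Basis. g b x *\<^sub>R b) \<in> borel_measurable borel"
    using g(1) by (intro borel_measurable_sum borel_measurable_scaleR) simp_all
  ultimately show ?thesis by (intro bexI)
qed

lemma set_integrable_lebesgue_ex_borel:
  fixes h :: "'a::euclidean_space \<Rightarrow> 'b::euclidean_space"
  assumes "set_integrable lebesgue K h"
  shows "\<exists>H. integrable lborel H \<and> (AE x in lborel. indicator K x *\<^sub>R h x = H x)"
proof -
  have i: "integrable lebesgue (\<lambda>x. indicator K x *\<^sub>R h x)" using assms by (simp add: set_integrable_def)
  obtain H where H: "H \<in> borel_measurable borel" "AE x in lborel. indicator K x *\<^sub>R h x = H x"
    using lebesgue_ex_borel[of "\<lambda>x. indicator K x *\<^sub>R h x"] i by (auto dest: borel_measurable_integrable)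
  have "AE x in lebesgue. indicator K x *\<^sub>R h x = H x" using H(2) by (rule AE_completion)
  then have "integrable lebesgue H"
  proof -
    have "H \<in> borel_measurable lebesgue" using H(1) by (simp add: measurable_completion)
    from integrable_cong_AE[OF borel_measurable_integrable[OF i] this] show "AE x in lebesgue. indicator K x *\<^sub>R h x = H x \<Longrightarrow> ?thesis"
      using i by blast
  qed
  then have "integrable lborel H" using H(1) by (simp add: integrable_completion)
  with H(2) show ?thesis by blast
qed

lemma test_fun_derivative:
  assumes "test_fun U \<phi>"
  shows "continuous_on UNIV (\<lambda>x. frechet_derivative \<phi> (at x) v)" "continuous_on UNIV \<phi>"
    and "\<And>x. x \<notin> U \<Longrightarrow> frechet_derivative \<phi> (at x) v = 0" "\<And>x. x \<notin> U \<Longrightarrow> \<phi> x = 0"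
    and "\<exists>B. \<forall>x. \<bar>frechet_derivative \<phi> (at x) v\<bar> \<le> B" "\<exists>B. \<forall>x. \<bar>\<phi> x\<bar> \<le> B"
proof -
  let ?S = "closure {x. \<phi> x \<noteq> 0}"
  have t: "smooth_fun \<phi>" "compact ?S" "?S \<subseteq> U" using assms by (auto simp: test_fun_def)
  have "iter_deriv [v] \<phi> differentiable (at x)" "iter_deriv [] \<phi> differentiable (at x)" for x
    using t(1) unfolding smooth_fun_def by blast+
  then show c: "continuous_on UNIV (\<lambda>x. frechet_derivative \<phi> (at x) v)" "continuous_on UNIV \<phi>"
    by (auto intro!: continuous_at_imp_continuous_on differentiable_imp_continuous_within)
  have z: "frechet_derivative \<phi> (at x) v = 0" "\<phi> x = 0" if "x \<notin> ?S" for x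
  proof -
    have nz: "\<phi> y = 0" if "y \<notin> ?S" for y using that closure_subset[of "{x. \<phi> x \<noteq> 0}"] by blast
    have "((\<lambda>_. 0) has_derivative (\<lambda>_. 0)) (at x)" by simp
    then have "(\<phi> has_derivative (\<lambda>_. 0)) (at x)"
    proof (rule has_derivative_transform_within_open[of _ _ _ UNIV "- ?S"])
      show "x \<in> - ?S" using that by blast
      show "0 = \<phi> y" if "y \<in> - ?S" for y by (rule nz[symmetric]) (use that in blast)
    qed (rule open_Compl, rule closed_closure)
    from frechet_derivative_at[OF this] show "frechet_derivative \<phi> (at x) v = 0" by metis
    show "\<phi> x = 0" using that closure_subset[of "{x. \<phi> x \<noteq> 0}"] by blast
  qed
  then show "\<And>x. x \<notin> U \<Longrightarrow> frechet_derivative \<phi> (at x) v = 0" "\<And>x. x \<notin> U \<Longrightarrow> \<phi> x = 0" using t(3) by blast+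
  have bd: "\<exists>B. \<forall>x. \<bar>q x\<bar> \<le> B" if "continuous_on UNIV q" "\<And>x. x \<notin> ?S \<Longrightarrow> q x = 0" for q :: "'a \<Rightarrow> real"
  proof -
    have "bounded (q ` ?S)"
      by (intro compact_imp_bounded compact_continuous_image t(2) continuous_on_subset[OF that(1)]) auto
    then obtain B where B: "B > 0" "\<And>x. x \<in> ?S \<Longrightarrow> \<bar>q x\<bar> \<le> B" by (auto simp: bounded_pos)
    have "\<bar>q x\<bar> \<le> B" for x using B(1) B(2)[of x] that(2)[of x] by (cases "x \<in> ?S") auto
    then show ?thesis by blast
  qed
  show "\<exists>B. \<forall>x. \<bar>frechet_derivative \<phi> (at x) v\<bar> \<le> B" using c(1) z(1) by (rule bd)
  show "\<exists>B. \<forall>x. \<bar>\<phi> x\<bar> \<le> B" using c(2) z(2) by (rule bd)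
qed

text \<open>A test function on U and its derivative vanish outside U, which lies in K. Cutting f and
  g off by the indicator of K and changing them on a null set therefore alters neither side of the
  weak identity.\<close>

lemma weak_directional_borel:
  fixes f :: "real^'m \<Rightarrow> 'b::euclidean_space"
  assumes weak: "weak_partial \<Omega> f j g" and U: "U \<subseteq> K" "K \<subseteq> \<Omega>"
    and F: "integrable lborel F" "AE x in lborel. indicator K x *\<^sub>R f x = F x"
    and G: "integrable lborel G" "AE x in lborel. indicator K x *\<^sub>R g x = G x"
    and fg: "set_integrable lebesgue K f" "set_integrable lebesgue K g"
  shows "weak_directional U (axis j 1) F G"
  unfolding weak_directional_def
proof (intro allI impI)
  fix \<phi> assume t: "test_fun U \<phi>"
  then have "test_fun \<Omega> \<phi>" using U by (auto simp: test_fun_def)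
  then have eq: "integral\<^sup>L lebesgue (\<lambda>x. frechet_derivative \<phi> (at x) (axis j 1) *\<^sub>R f x)
        = - integral\<^sup>L lebesgue (\<lambda>x. \<phi> x *\<^sub>R g x)" using weak by (simp add: weak_partial_def)
  have conv: "integral\<^sup>L lebesgue (\<lambda>x. c x *\<^sub>R h x) = (\<integral>x. c x *\<^sub>R H x \<partial>lborel)"
    if c: "c \<in> borel_measurable borel" "\<And>x. x \<notin> U \<Longrightarrow> c x = 0" and H: "H \<in> borel_measurable borel" "AE x in lborel. indicator K x *\<^sub>R h x = H x"
      and h: "set_integrable lebesgue K h" for c and h H :: "real^'m \<Rightarrow> 'b"
  proof -
    have "(\<lambda>x. c x *\<^sub>R h x) = (\<lambda>x. c x *\<^sub>R indicator K x *\<^sub>R h x)"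
      using c(2) U(1) by (auto simp: indicator_def fun_eq_iff)
    moreover have AE: "AE x in lebesgue. c x *\<^sub>R indicator K x *\<^sub>R h x = c x *\<^sub>R H x"
      using AE_completion[OF H(2)] by eventually_elim simp
    moreover have m: "(\<lambda>x. c x *\<^sub>R H x) \<in> borel_measurable borel" using c(1) H(1) by measurable
    then have mL: "(\<lambda>x. c x *\<^sub>R H x) \<in> borel_measurable lebesgue" by (simp add: measurable_completion)
    moreover have "(\<lambda>x. c x *\<^sub>R indicator K x *\<^sub>R h x) \<in> borel_measurable lebesgue"
    proof (rule borel_measurable_scaleR)
      show "c \<in> borel_measurable lebesgue" using c(1) by (simp add: measurable_completion)
      show "(\<lambda>x. indicator K x *\<^sub>R h x) \<in> borel_measurable lebesgue"
        using h by (auto simp: set_integrable_def dest: borel_measurable_integrable)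
    qed
    ultimately have "integral\<^sup>L lebesgue (\<lambda>x. c x *\<^sub>R h x) = integral\<^sup>L lebesgue (\<lambda>x. c x *\<^sub>R H x)"
      using integral_cong_AE[of "\<lambda>x. c x *\<^sub>R indicator K x *\<^sub>R h x" lebesgue "\<lambda>x. c x *\<^sub>R H x"] by simp
    then show ?thesis using m by (simp add: integral_completion)
  qed
  show "(\<integral>x. frechet_derivative \<phi> (at x) (axis j 1) *\<^sub>R F x \<partial>lborel) = - (\<integral>x. \<phi> x *\<^sub>R G x \<partial>lborel)"
  proof -
    have "F \<in> borel_measurable borel" "G \<in> borel_measurable borel"
      using F(1) G(1) by (simp_all add: borel_measurable_integrable)
    note 1 = conv[OF borel_measurable_continuous_onI[OF test_fun_derivative(1)[OF t, of "axis j 1"]] test_fun_derivative(3)[OF t] this(1) F(2) fg(1)]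
      and 2 = conv[OF borel_measurable_continuous_onI[OF test_fun_derivative(2)[OF t]] test_fun_derivative(4)[OF t] this(2) G(2) fg(2)]
    show ?thesis by (rule trans[OF 1[symmetric] trans[OF eq arg_cong[of _ _ uminus, OF 2]]])
  qed
qed

lemma weak_directional_sum:
  fixes F :: "real^'m \<Rightarrow> 'b::euclidean_space"
  assumes F: "integrable lborel F" and G: "\<And>j. integrable lborel (G j)"
    and weak: "\<And>j. weak_directional U (axis j 1) F (G j)"
  shows "weak_directional U v F (\<lambda>x. \<Sum>j\<in>UNIV. v $ j *\<^sub>R G j x)"
  unfolding weak_directional_def
proof (intro allI impI)
  fix \<phi> :: "real^'m \<Rightarrow> real" assume t: "test_fun U \<phi>"
  note td = test_fun_derivative[OF t]
  have iF: "integrable lborel (\<lambda>x. frechet_derivative \<phi> (at x) w *\<^sub>R F x)" for w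
  proof -
    obtain B where "\<And>x. \<bar>frechet_derivative \<phi> (at x) w\<bar> \<le> B" using td(5)[of w] by blast
    then show ?thesis using td(1)[of w] by (intro integrable_bounded_mult[OF F]) (auto intro: borel_measurable_continuous_onI)
  qed
  have iG: "integrable lborel (\<lambda>x. \<phi> x *\<^sub>R G j x)" for j
  proof -
    obtain B where "\<And>x. \<bar>\<phi> x\<bar> \<le> B" using td(6) by blast
    then show ?thesis using td(2) by (intro integrable_bounded_mult[OF G]) (auto intro: borel_measurable_continuous_onI)
  qed
  have "frechet_derivative \<phi> (at x) v = (\<Sum>j\<in>UNIV. v $ j * frechet_derivative \<phi> (at x) (axis j 1))" for x
  proof -
    have l: "linear (frechet_derivative \<phi> (at x))" by (rule test_fun_linear_derivative[OF t])
    have "frechet_derivative \<phi> (at x) v = frechet_derivative \<phi> (at x) (\<Sum>j\<in>UNIV. v $ j *\<^sub>R axis j 1)"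
      using basis_expansion[of v] by (simp add: scalar_mult_eq_scaleR)
    also have "\<dots> = (\<Sum>j\<in>UNIV. v $ j * frechet_derivative \<phi> (at x) (axis j 1))"
      by (simp add: linear_sum[OF l] linear_scale[OF l])
    finally show ?thesis .
  qed
  then have "(\<integral>x. frechet_derivative \<phi> (at x) v *\<^sub>R F x \<partial>lborel) = (\<integral>x. (\<Sum>j\<in>UNIV. v $ j *\<^sub>R frechet_derivative \<phi> (at x) (axis j 1) *\<^sub>R F x) \<partial>lborel)"
    by (simp add: scaleR_sum_left)
  also have "\<dots> = (\<Sum>j\<in>UNIV. v $ j *\<^sub>R (\<integral>x. frechet_derivative \<phi> (at x) (axis j 1) *\<^sub>R F x \<partial>lborel))"
    by (subst Bochner_Integration.integral_sum) (auto intro: iF integrable_scaleR_right simp only: integral_scaleR_right)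
  also have "\<dots> = (\<Sum>j\<in>UNIV. v $ j *\<^sub>R - (\<integral>x. \<phi> x *\<^sub>R G j x \<partial>lborel))"
    using weak t by (simp add: weak_directional_def)
  also have "\<dots> = - (\<Sum>j\<in>UNIV. (\<integral>x. v $ j *\<^sub>R \<phi> x *\<^sub>R G j x \<partial>lborel))"
    by (simp only: integral_scaleR_right scaleR_minus_right sum_negf)
  also have "\<dots> = - (\<integral>x. (\<Sum>j\<in>UNIV. v $ j *\<^sub>R \<phi> x *\<^sub>R G j x) \<partial>lborel)"
    by (subst Bochner_Integration.integral_sum) (rule integrable_scaleR_right, rule iG, rule refl)
  finally show "(\<integral>x. frechet_derivative \<phi> (at x) v *\<^sub>R F x \<partial>lborel) = - (\<integral>x. \<phi> x *\<^sub>R (\<Sum>j\<in>UNIV. v $ j *\<^sub>R G j x) \<partial>lborel)"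
    by (simp add: scaleR_sum_right mult.commute)
qed

text \<open>The span V of the horizontal parts is isotropic, hence orthogonal to its image under the
  complex structure J. Both have the same dimension inside dimension 2n. The contact equation places
  S on the graph of a linear function over V, so the vertical coordinate adds no dimension.\<close>

lemma isotropic_dim_le:
  fixes S :: "'n::finite heis set"
  assumes contact: "\<And>p. p \<in> S \<Longrightarrow> vpart p = sympl z0 (hpart p)"
    and iso: "\<And>p q. p \<in> S \<Longrightarrow> q \<in> S \<Longrightarrow> sympl (hpart p) (hpart q) = 0"
  shows "dim S \<le> CARD('n)"
proof -
  define V where "V = span (hpart ` S)"
  define J :: "(real^'n) \<times> (real^'n) \<Rightarrow> (real^'n) \<times> (real^'n)" where "J v = (snd v, - fst v)" for v
  have sJ: "sympl u v = u \<bullet> J v" for u v by (simp add: sympl_def J_def inner_prod_def)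
  have linJ: "linear J" by (auto simp: linear_iff J_def)
  have injJ: "inj_on J (span V)" by (auto simp: inj_on_def J_def prod_eq_iff)
  have 1: "sympl u (hpart q) = 0" if "u \<in> V" "q \<in> S" for u q
  proof -
    have "V \<subseteq> {u. sympl u (hpart q) = 0}" unfolding V_def
    proof (rule span_minimal)
      show "hpart ` S \<subseteq> {u. sympl u (hpart q) = 0}" using iso that(2) by blast
      show "subspace {u. sympl u (hpart q) = 0}" by (auto simp: subspace_def sympl.add_left sympl.scaleR_left sympl.zero_left)
    qed
    then show ?thesis using that(1) by blast
  qed
  have 2: "sympl u w = 0" if "u \<in> V" "w \<in> V" for u w
  proof -
    have "V \<subseteq> {w. sympl u w = 0}" unfolding V_def
    proof (rule span_minimal)
      show "hpart ` S \<subseteq> {w. sympl u w = 0}" using 1[OF that(1)] by blast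
      show "subspace {w. sympl u w = 0}" by (auto simp: subspace_def sympl.add_right sympl.scaleR_right sympl.zero_right)
    qed
    then show ?thesis using that(2) by blast
  qed
  have subJ: "subspace (J ` V)" unfolding V_def by (intro linear_subspace_image linJ subspace_span)
  have "V \<subseteq> {y \<in> UNIV. \<forall>x\<in>J ` V. orthogonal x y}"
    using 2 by (auto simp: orthogonal_def sJ inner_commute)
  then have "dim V + dim (J ` V) \<le> dim {y \<in> UNIV. \<forall>x\<in>J ` V. orthogonal x y} + dim (J ` V)"
    by (intro add_right_mono dim_subset)
  also have "\<dots> = dim (UNIV :: ((real^'n) \<times> (real^'n)) set)"
    by (intro dim_subspace_orthogonal_to_vectors subJ) auto
  also have "\<dots> = 2 * CARD('n)" by simp
  also have "dim (J ` V) = dim V" by (rule dim_image_eq[OF linJ injJ])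
  finally have dV: "dim V \<le> CARD('n)" by simp
  define \<psi> :: "(real^'n) \<times> (real^'n) \<Rightarrow> 'n heis" where "\<psi> h = (fst h, snd h, sympl z0 h)" for h
  have lin\<psi>: "linear \<psi>" by (auto simp: linear_iff \<psi>_def sympl.add_right sympl.scaleR_right)
  have "p = \<psi> (hpart p)" if "p \<in> S" for p
    using contact[OF that] by (simp add: \<psi>_def hpart_def vpart_def prod_eq_iff)
  then have "S \<subseteq> \<psi> ` V" unfolding V_def using span_superset by fastforce
  then have "dim S \<le> dim (\<psi> ` V)" by (rule dim_subset)
  also have "\<dots> \<le> dim V" by (rule dim_image_le[OF lin\<psi>])
  finally show ?thesis using dV by simp
qed

lemma inj_of_full_rank:
  fixes D :: "'m::finite \<Rightarrow> 'b::euclidean_space"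
  assumes "dim (range D) = CARD('m)"
  shows "linear (\<lambda>v :: real^'m. \<Sum>j\<in>UNIV. v $ j *\<^sub>R D j)" "inj (\<lambda>v :: real^'m. \<Sum>j\<in>UNIV. v $ j *\<^sub>R D j)"
proof -
  show lin: "linear (\<lambda>v :: real^'m. \<Sum>j\<in>UNIV. v $ j *\<^sub>R D j)"
    by (rule linearI) (auto simp: scaleR_left_distrib sum.distrib scaleR_sum_right)
  \<comment> \<open>The dimension of \<open>range D\<close> sees only the set of columns. Full
    dimension forces the columns to be pairwise distinct as well as independent, and both are used
    for injectivity.\<close>
  have "card (range D) \<le> CARD('m)" by (rule card_image_le) simp
  moreover have "dim (range D) \<le> card (range D)" by (rule dim_le_card') simp
  ultimately have card: "card (range D) = CARD('m)" using assms by simp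
  then have inj: "inj D" by (intro eq_card_imp_inj_on) auto
  have ind: "independent (range D)"
    by (rule card_le_dim_spanning[of "range D" "range D"]) (use assms card in \<open>auto intro: span_superset[THEN subsetD]\<close>)
  show "inj (\<lambda>v :: real^'m. \<Sum>j\<in>UNIV. v $ j *\<^sub>R D j)"
  proof (subst linear_injective_0[OF lin], intro allI impI)
    fix v :: "real^'m" assume z: "(\<Sum>j\<in>UNIV. v $ j *\<^sub>R D j) = 0"
    have "(\<Sum>b\<in>range D. (v $ inv D b) *\<^sub>R b) = (\<Sum>j\<in>UNIV. v $ j *\<^sub>R D j)"
      by (subst sum.reindex[OF inj]) (simp add: inj)
    then have "(\<Sum>b\<in>range D. (v $ inv D b) *\<^sub>R b) = 0" using z by simp
    then have "v $ inv D b = 0" if "b \<in> range D" for b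
      using independentD[OF ind, of "range D" "\<lambda>b. v $ inv D b" b] that by simp
    then have "v $ j = 0" for j using inj by (metis inv_f_f rangeI)
    then show "v = 0" by (simp add: vec_eq_iff)
  qed
qed

text \<open>Subtracting the linear map with columns c replaces the weak derivative by
  \<open>G j - c j\<close>, so the summed column deviations serve as the bound along segments. The
  null set may depend on c, so c has to be fixed before the exceptional set is removed.\<close>

lemma lipschitz_defect:
  fixes F :: "real^'m \<Rightarrow> 'b::euclidean_space" and c :: "'m \<Rightarrow> 'b"
  assumes F: "integrable lborel F" and G: "\<And>j. integrable lborel (G j)"
    and weak: "\<And>j. weak_directional U (axis j 1) F (G j)" and U: "convex U" "open U"
  defines "L \<equiv> \<lambda>v :: real^'m. \<Sum>j\<in>UNIV. v $ j *\<^sub>R c j"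
  shows "\<exists>N. N \<in> null_sets lborel \<and> (\<forall>\<eta> R x y. x \<notin> N \<and> y \<notin> N \<and> 0 \<le> \<eta> \<and> dist x y < R \<and>
      ball x R \<subseteq> U \<and> ball y R \<subseteq> U \<and>
      averages_le (\<lambda>z. (\<Sum>j\<in>UNIV. ennreal (norm (G j z - c j)))) x \<eta> R \<and>
      averages_le (\<lambda>z. (\<Sum>j\<in>UNIV. ennreal (norm (G j z - c j)))) y \<eta> R
      \<longrightarrow> norm (F x - F y - L (x - y)) \<le> 2 ^ (CARD('m) + 1) * \<eta> * dist x y)"
proof -
  have [measurable]: "F \<in> borel_measurable borel" using F by (simp add: borel_measurable_integrable)
  have Gm[measurable]: "G j \<in> borel_measurable borel" for j using G[of j] by (simp add: borel_measurable_integrable)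
  have linL: "linear L" unfolding L_def
    by (rule linearI) (auto simp: scaleR_left_distrib sum.distrib scaleR_sum_right)
  then have Lm[measurable]: "L \<in> borel_measurable borel"
    by (intro borel_measurable_continuous_onI linear_continuous_on) (simp add: linear_conv_bounded_linear)
  define u where "u x = F x - L x" for x
  have um: "u \<in> borel_measurable borel" unfolding u_def by measurable
  define g where "g z = (\<Sum>j\<in>UNIV. ennreal (norm (G j z - c j)))" for z
  have gm[measurable]: "g \<in> borel_measurable borel" unfolding g_def by measurable
  define D where "D v x = (\<Sum>j\<in>UNIV. v $ j *\<^sub>R G j x)" for v :: "real^'m" and x
  have Di: "integrable lborel (D v)" for v unfolding D_def using G by simp
  have DL: "ennreal (norm (D v z - L v)) \<le> ennreal (norm v) * g z" for v z
  proof -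
    have "norm (D v z - L v) = norm (\<Sum>j\<in>UNIV. v $ j *\<^sub>R (G j z - c j))"
      by (simp add: D_def L_def scaleR_diff_right sum_subtractf)
    also have "\<dots> \<le> (\<Sum>j\<in>UNIV. norm v * norm (G j z - c j))"
      by (rule sum_norm_le) (auto intro!: mult_right_mono component_le_norm_cart)
    finally have "ennreal (norm (D v z - L v)) \<le> ennreal (norm v * (\<Sum>j\<in>UNIV. norm (G j z - c j)))"
      by (intro ennreal_leI) (simp add: sum_distrib_left)
    then show ?thesis by (simp add: g_def ennreal_mult sum_nonneg)
  qed
  have seg: "AE x in lborel. x \<in> U \<and> x + v \<in> U \<longrightarrow>
      ennreal (norm (u (x + v) - u x)) \<le> ennreal (norm v) * (\<integral>\<^sup>+s\<in>{0..1::real}. g (x + s *\<^sub>R v) \<partial>lborel)" for v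
  proof -
    have "weak_directional U v F (D v)" unfolding D_def by (rule weak_directional_sum[OF F G weak])
    then have "AE x in lborel. x \<in> U \<and> x + v \<in> U \<longrightarrow>
      F (x + v) - F x = (\<integral>s. indicator {0..1} s *\<^sub>R D v (x + s *\<^sub>R v) \<partial>lborel)"
      unfolding weak_directional_def by (intro weak_derivative_AE_FTC[OF F Di _ U]) blast
    moreover have "AE x in lborel. integrable lborel (\<lambda>s. indicator {0..1::real} s *\<^sub>R D v (x + s *\<^sub>R v))"
      by (rule lborel_pair.AE_integrable_fst[OF integrable_segment[OF Di, of v]])
    ultimately show ?thesis
    proof eventually_elim
      case (elim x)
      show ?case
      proof
        assume xU: "x \<in> U \<and> x + v \<in> U"
        have c: "integrable lborel (\<lambda>s. indicator {0..1::real} s *\<^sub>R L v)" "(\<integral>s. indicator {0..1::real} s *\<^sub>R L v \<partial>lborel) = L v"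
          by (auto intro!: integrable_scaleR_left)
        have "u (x + v) - u x = (F (x + v) - F x) - L v" by (simp add: u_def linear_add[OF linL])
        also have "\<dots> = (\<integral>s. indicator {0..1} s *\<^sub>R (D v (x + s *\<^sub>R v) - L v) \<partial>lborel)"
          using elim xU c by (simp add: scaleR_diff_right Bochner_Integration.integral_diff)
        finally have eq: "u (x + v) - u x = (\<integral>s. indicator {0..1} s *\<^sub>R (D v (x + s *\<^sub>R v) - L v) \<partial>lborel)" .
        have "ennreal (norm (u (x + v) - u x)) \<le> (\<integral>\<^sup>+s. ennreal (norm (indicator {0..1::real} s *\<^sub>R (D v (x + s *\<^sub>R v) - L v))) \<partial>lborel)"
          unfolding eq using elim(2) c(1) by (intro integral_norm_bound_ennreal) (simp add: scaleR_diff_right)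
        also have "\<dots> \<le> (\<integral>\<^sup>+s. ennreal (norm v) * (g (x + s *\<^sub>R v) * indicator {0..1::real} s) \<partial>lborel)"
          using DL by (intro nn_integral_mono) (auto simp: indicator_def)
        also have "\<dots> = ennreal (norm v) * (\<integral>\<^sup>+s\<in>{0..1::real}. g (x + s *\<^sub>R v) \<partial>lborel)"
          by (rule nn_integral_cmult) measurable
        finally show "ennreal (norm (u (x + v) - u x)) \<le> ennreal (norm v) * (\<integral>\<^sup>+s\<in>{0..1::real}. g (x + s *\<^sub>R v) \<partial>lborel)" .
      qed
    qed
  qed
  have uu: "F x - F y - L (x - y) = u x - u y" for x y by (simp add: u_def linear_diff[OF linL])
  show ?thesis
    using lipschitz_of_segment_bound[OF um gm U(2) seg] unfolding uu g_def by simp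
qed

section \<open>Countable decompositions and the set of noncontact points\<close>

lemma negligible_countable_cover:
  assumes "\<And>x. x \<in> W \<Longrightarrow> \<exists>i\<in>I. x \<in> E i" and "countable I" and "\<And>i. i \<in> I \<Longrightarrow> negligible (E i)"
  shows "negligible W"
proof -
  have "(\<Union>i\<in>I. E i) \<in> null_sets lebesgue"
    using assms(2,3) by (intro null_sets_UN') (auto simp: negligible_iff_null_sets)
  then have "negligible (\<Union>i\<in>I. E i)" by (simp add: negligible_iff_null_sets)
  then show ?thesis by (rule negligible_subset) (use assms(1) in blast)
qed

text \<open>The preimages under \<open>\<Phi>\<close> of the balls of radius
  \<open>\<delta>\<close>/2 about a countable dense set form a countable cover of W by pieces on
  which \<open>\<Phi>\<close> oscillates by less than \<open>\<delta>\<close>.\<close>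

lemma negligible_small_pieces:
  fixes \<Phi> :: "'a::euclidean_space \<Rightarrow> 'b::euclidean_space"
  assumes "\<delta> > 0" and "\<And>E. E \<subseteq> W \<Longrightarrow> (\<And>x y. x \<in> E \<Longrightarrow> y \<in> E \<Longrightarrow> dist (\<Phi> x) (\<Phi> y) < \<delta>) \<Longrightarrow> negligible E"
  shows "negligible W"
proof -
  obtain Q :: "'b set" where Q: "countable Q" "\<And>X. open X \<Longrightarrow> X \<noteq> {} \<Longrightarrow> \<exists>d\<in>Q. d \<in> X"
    using countable_dense_exists by blast
  show ?thesis
  proof (rule negligible_countable_cover[OF _ Q(1)])
    fix x assume x: "x \<in> W"
    have "ball (\<Phi> x) (\<delta> / 2) \<noteq> {}" using assms(1) by simp
    then obtain q where "q \<in> Q" "q \<in> ball (\<Phi> x) (\<delta> / 2)" using Q(2)[OF open_ball] by blast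
    then show "\<exists>q\<in>Q. x \<in> {x\<in>W. \<Phi> x \<in> ball q (\<delta> / 2)}" using x by (auto simp: dist_commute)
  next
    fix q
    show "negligible {x\<in>W. \<Phi> x \<in> ball q (\<delta> / 2)}"
    proof (rule assms(2))
      fix x y assume "x \<in> {x\<in>W. \<Phi> x \<in> ball q (\<delta> / 2)}" "y \<in> {x\<in>W. \<Phi> x \<in> ball q (\<delta> / 2)}"
      then have "dist q (\<Phi> x) < \<delta> / 2" "dist q (\<Phi> y) < \<delta> / 2" by auto
      then show "dist (\<Phi> x) (\<Phi> y) < \<delta>"
        using dist_triangle3[of "\<Phi> x" "\<Phi> y" q] by linarith
    qed auto
  qed
qed

lemma noncontact_gapD:
  assumes "noncontact_gap L z0 \<epsilon>" "\<And>x. x \<in> E \<Longrightarrow> norm (hpart (f x) - z0) \<le> \<epsilon>"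
    and "\<And>x y. x \<in> E \<Longrightarrow> y \<in> E \<Longrightarrow> norm (f x - f y - L (x - y)) \<le> \<epsilon> * norm (x - y)"
    and "hausdorff_measure_wrt cc_dist (real CARD('m) + 1) (f ` E) = 0"
  shows "negligible (E :: (real^'m) set)"
  using assms unfolding noncontact_gap_def by blast

lemma noncontact_gap_mono:
  assumes "noncontact_gap L z0 \<epsilon>" "\<epsilon>' \<le> \<epsilon>"
  shows "noncontact_gap L z0 \<epsilon>'"
  unfolding noncontact_gap_def
proof (intro allI impI, elim conjE)
  fix f :: "real^'a \<Rightarrow> 'b heis" and E
  assume 1: "\<forall>x\<in>E. norm (hpart (f x) - z0) \<le> \<epsilon>'" and 2: "\<forall>x\<in>E. \<forall>y\<in>E. norm (f x - f y - L (x - y)) \<le> \<epsilon>' * norm (x - y)"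
    and 3: "hausdorff_measure_wrt cc_dist (real CARD('a) + 1) (f ` E) = 0"
  show "negligible E"
  proof (rule noncontact_gapD[OF assms(1) _ _ 3])
    fix x assume "x \<in> E" then show "norm (hpart (f x) - z0) \<le> \<epsilon>" using 1 assms(2) order_trans by blast
  next
    fix x y assume "x \<in> E" "y \<in> E"
    then have "norm (f x - f y - L (x - y)) \<le> \<epsilon>' * norm (x - y)" using 2 by blast
    also have "\<dots> \<le> \<epsilon> * norm (x - y)" using assms(2) by (intro mult_right_mono) auto
    finally show "norm (f x - f y - L (x - y)) \<le> \<epsilon> * norm (x - y)" .
  qed
qed

text \<open>The admissible error and the radius depend on the point. Splitting into countably many pieces makes them uniform;
  the pieces need not be measurable, since negligibility is stable under arbitrary countable covers.\<close>

lemma negligible_noncontact_points: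
  fixes F :: "real^'m \<Rightarrow> 'n::finite heis" and k :: 'm
  assumes F: "integrable lborel F" and G: "\<And>j. integrable lborel (G j)"
    and weak: "\<And>j. weak_directional U (axis j 1) F (G j)" and U: "convex U" "open U"
    and H: "hausdorff_measure_wrt cc_dist (real CARD('m) + 1) \<Sigma> = 0"
  shows "negligible {x \<in> U. dim (range (\<lambda>j. G j x)) = CARD('m) \<and> F x \<in> \<Sigma> \<and> (\<forall>j. lebesgue_point (G j) x) \<and>
    vpart (G k x) \<noteq> sympl (hpart (F x)) (hpart (G k x))}" (is "negligible ?W")
proof -
  have Gm[measurable]: "G j \<in> borel_measurable borel" for j using G[of j] by (simp add: borel_measurable_integrable)
  define m where "m = real CARD('m)"
  have m: "m > 0" by (simp add: m_def)
  define L where "L x v = (\<Sum>j\<in>UNIV. v $ j *\<^sub>R G j x)" for x and v :: "real^'m"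
  \<comment> \<open>Chosen so that the final Lipschitz constant 2^(m+1) * 2 m *
    \<open>\<eta> n\<close> equals 1/(n+1). The factor m sums the columns, and the extra 2 pays for
    measuring the oscillation against a fixed x0.\<close>
  define \<eta> where "\<eta> n = 1 / (real (Suc n) * (2 ^ (CARD('m) + 2) * m))" for n
  have \<eta>: "\<eta> n > 0" for n using m by (simp add: \<eta>_def)
  define W where "W = (\<lambda>(n, l). {x \<in> ?W. noncontact_gap (L x) (hpart (F x)) (1 / Suc n) \<and> ball x (1 / Suc l) \<subseteq> U \<and>
    (\<forall>j r. 0 < r \<and> r < 1 / Suc l \<longrightarrow>
      (\<integral>\<^sup>+y\<in>cball x r. ennreal (norm (G j y - G j x)) \<partial>lborel) \<le> ennreal (\<eta> n) * emeasure lborel (cball x r))})"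
  show ?thesis
  proof (rule negligible_countable_cover[where E = W and I = UNIV])
    fix x assume x: "x \<in> ?W"
    have Lk: "L x (axis k 1) = G k x"
    proof -
      have "L x (axis k 1) = (\<Sum>j\<in>UNIV. if j = k then G j x else 0)"
        unfolding L_def by (intro sum.cong) (auto simp: axis_def)
      then show ?thesis by simp
    qed
    have "linear (L x)" "inj (L x)" unfolding L_def using x by (auto intro: inj_of_full_rank)
    then obtain \<epsilon> where \<epsilon>: "\<epsilon> > 0" "noncontact_gap (L x) (hpart (F x)) \<epsilon>"
      using noncontact_gap_exists[of "L x" k "hpart (F x)"] x Lk by auto
    obtain n where n: "1 / real (Suc n) < \<epsilon>" using nat_approx_posE[OF \<epsilon>(1)] by auto
    have gap: "noncontact_gap (L x) (hpart (F x)) (1 / Suc n)" by (rule noncontact_gap_mono[OF \<epsilon>(2)]) (use n in simp)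
    have "\<forall>j. \<exists>R>0. averages_le (\<lambda>y. ennreal (norm (G j y - G j x))) x (\<eta> n) R"
      using x \<eta>[of n] unfolding lebesgue_point_def by blast
    from choice[OF this] obtain R where R: "\<And>j. R j > 0" "\<And>j r. 0 < r \<Longrightarrow> r < R j \<Longrightarrow>
      (\<integral>\<^sup>+y\<in>cball x r. ennreal (norm (G j y - G j x)) \<partial>lborel) \<le> ennreal (\<eta> n) * emeasure lborel (cball x r)"
      by blast
    obtain R0 where R0: "R0 > 0" "ball x R0 \<subseteq> U" using x U(2) open_contains_ball by blast
    define R1 where "R1 = Min (insert R0 (range R))"
    have "finite (insert R0 (range R))" by simp
    then have R1: "R1 > 0" "R1 \<le> R0" "\<And>j. R1 \<le> R j"
      unfolding R1_def using R(1) R0(1) by (auto intro!: Min_le simp del: Min_insert)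
    obtain l where l: "1 / real (Suc l) < R1" using nat_approx_posE[OF R1(1)] by auto
    have "ball x (1 / Suc l) \<subseteq> U" using R0(2) l R1(2) by (auto simp: subset_eq)
    moreover have "\<forall>j r. 0 < r \<and> r < 1 / Suc l \<longrightarrow>
      (\<integral>\<^sup>+y\<in>cball x r. ennreal (norm (G j y - G j x)) \<partial>lborel) \<le> ennreal (\<eta> n) * emeasure lborel (cball x r)"
    proof (intro allI impI)
      fix j r assume "0 < r \<and> r < 1 / real (Suc l)"
      then have "0 < r" "r < R j" using l R1(3)[of j] by linarith+
      then show "(\<integral>\<^sup>+y\<in>cball x r. ennreal (norm (G j y - G j x)) \<partial>lborel) \<le> ennreal (\<eta> n) * emeasure lborel (cball x r)"
        by (rule R(2))
    qed
    ultimately have "x \<in> W (n, l)" using x gap unfolding W_def by blast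
    then show "\<exists>i\<in>UNIV. x \<in> W i" by blast
  next
    fix i :: "nat \<times> nat"
    obtain n l where i: "i = (n, l)" by (cases i)
    define \<delta> where "\<delta> = Min {\<eta> n, 1 / Suc n, 1 / Suc l}"
    have \<delta>: "\<delta> > 0" "\<delta> \<le> \<eta> n" "\<delta> \<le> 1 / Suc n" "\<delta> \<le> 1 / Suc l" using \<eta>[of n] by (auto simp: \<delta>_def)
    \<comment> \<open>Position, value and derivative are recorded together, so one smallness
      condition lets the linear map and the gap at a single x0 serve the whole piece.\<close>
    define \<Phi> where "\<Phi> x = (x, F x, (\<chi> j. G j x))" for x
    have Wi: "x \<in> ?W" "noncontact_gap (L x) (hpart (F x)) (1 / Suc n)" "ball x (1 / Suc l) \<subseteq> U"
      "\<And>j r. 0 < r \<Longrightarrow> r < 1 / Suc l \<Longrightarrow>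
      (\<integral>\<^sup>+y\<in>cball x r. ennreal (norm (G j y - G j x)) \<partial>lborel) \<le> ennreal (\<eta> n) * emeasure lborel (cball x r)"
      if "x \<in> W i" for x
      using that unfolding W_def i by auto
    show "negligible (W i)"
    proof (rule negligible_small_pieces[OF \<delta>(1), where \<Phi> = \<Phi>])
      fix E assume E: "E \<subseteq> W i" and small: "\<And>x y. x \<in> E \<Longrightarrow> y \<in> E \<Longrightarrow> dist (\<Phi> x) (\<Phi> y) < \<delta>"
      show "negligible E"
      proof (cases "E = {}")
        case False
        then obtain x0 where x0: "x0 \<in> E" by blast
        have close: "dist x y < \<delta>" "norm (F x - F y) < \<delta>" "norm (G j x - G j y) < \<delta>" if "x \<in> E" "y \<in> E" for x y j
        proof -
          have *: "dist (\<Phi> x) (\<Phi> y) < \<delta>" using small that by blast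
          have "dist (fst (\<Phi> x)) (fst (\<Phi> y)) \<le> dist (\<Phi> x) (\<Phi> y)" by (rule dist_fst_le)
          then show "dist x y < \<delta>" using * by (simp add: \<Phi>_def)
          have s: "dist (snd (\<Phi> x)) (snd (\<Phi> y)) \<le> dist (\<Phi> x) (\<Phi> y)" by (rule dist_snd_le)
          have "dist (fst (snd (\<Phi> x))) (fst (snd (\<Phi> y))) \<le> dist (snd (\<Phi> x)) (snd (\<Phi> y))" by (rule dist_fst_le)
          then show "norm (F x - F y) < \<delta>" using * s by (simp add: \<Phi>_def dist_norm)
          have "dist (snd (snd (\<Phi> x))) (snd (snd (\<Phi> y))) \<le> dist (snd (\<Phi> x)) (snd (\<Phi> y))" by (rule dist_snd_le)
          moreover have "dist (snd (snd (\<Phi> x)) $ j) (snd (snd (\<Phi> y)) $ j) \<le> dist (snd (snd (\<Phi> x))) (snd (snd (\<Phi> y)))"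
            by (rule dist_vec_nth_le)
          ultimately show "norm (G j x - G j y) < \<delta>" using * s by (simp add: \<Phi>_def dist_norm)
        qed
        obtain N where N: "N \<in> null_sets lborel" and lip: "\<forall>\<eta> R x y. x \<notin> N \<and> y \<notin> N \<and> 0 \<le> \<eta> \<and> dist x y < R \<and>
          ball x R \<subseteq> U \<and> ball y R \<subseteq> U \<and>
          averages_le (\<lambda>z. (\<Sum>j\<in>UNIV. ennreal (norm (G j z - G j x0)))) x \<eta> R \<and>
          averages_le (\<lambda>z. (\<Sum>j\<in>UNIV. ennreal (norm (G j z - G j x0)))) y \<eta> R
          \<longrightarrow> norm (F x - F y - L x0 (x - y)) \<le> 2 ^ (CARD('m) + 1) * \<eta> * dist x y"
          using lipschitz_defect[OF F G weak U, of "\<lambda>j. G j x0"] by (elim exE conjE) (rule that, assumption, unfold L_def, assumption)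
        have avg: "(\<integral>\<^sup>+z\<in>cball x r. (\<Sum>j\<in>UNIV. ennreal (norm (G j z - G j x0))) \<partial>lborel) \<le> ennreal (2 * m * \<eta> n) * emeasure lborel (cball x r)"
          if x: "x \<in> E" and r: "0 < r" "r < 1 / Suc l" for x r
        proof -
          have [measurable]: "cball x r \<in> sets borel" by simp
          have "(\<integral>\<^sup>+z\<in>cball x r. (\<Sum>j\<in>UNIV. ennreal (norm (G j z - G j x0))) \<partial>lborel)
            = (\<Sum>j\<in>UNIV. (\<integral>\<^sup>+z\<in>cball x r. ennreal (norm (G j z - G j x0)) \<partial>lborel))"
            unfolding sum_distrib_right by (rule nn_integral_sum) measurable
          also have "\<dots> \<le> (\<Sum>j\<in>(UNIV :: 'm set). ennreal (2 * \<eta> n) * emeasure lborel (cball x r))"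
          proof (rule sum_mono)
            fix j
            have "(\<integral>\<^sup>+z\<in>cball x r. ennreal (norm (G j z - G j x0)) \<partial>lborel)
              \<le> (\<integral>\<^sup>+z. ennreal (norm (G j z - G j x)) * indicator (cball x r) z + ennreal (\<eta> n) * indicator (cball x r) z \<partial>lborel)"
            proof (rule nn_integral_mono)
              fix z
              have "norm (G j z - G j x0) \<le> norm (G j z - G j x) + \<eta> n"
                using norm_triangle_ineq[of "G j z - G j x" "G j x - G j x0"] close(3)[OF x x0, of j] \<delta>(2) by simp
              then show "ennreal (norm (G j z - G j x0)) * indicator (cball x r) z
                \<le> ennreal (norm (G j z - G j x)) * indicator (cball x r) z + ennreal (\<eta> n) * indicator (cball x r) z"
                using \<eta>[of n] by (auto simp: indicator_def ennreal_plus[symmetric] simp del: ennreal_plus intro!: ennreal_leI)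
            qed
            also have "\<dots> = (\<integral>\<^sup>+z\<in>cball x r. ennreal (norm (G j z - G j x)) \<partial>lborel) + ennreal (\<eta> n) * emeasure lborel (cball x r)"
              by (subst nn_integral_add) (measurable, simp add: nn_integral_cmult_indicator)
            also have "\<dots> \<le> ennreal (\<eta> n) * emeasure lborel (cball x r) + ennreal (\<eta> n) * emeasure lborel (cball x r)"
              using x E r by (intro add_right_mono Wi(4)) auto
            also have "\<dots> = ennreal (2 * \<eta> n) * emeasure lborel (cball x r)"
            proof -
              have "ennreal (2 * \<eta> n) = ennreal (\<eta> n) + ennreal (\<eta> n)"
                using \<eta>[of n] by (simp add: ennreal_plus[symmetric] del: ennreal_plus)
              then show ?thesis by (simp only: distrib_right)
            qed
            finally show "(\<integral>\<^sup>+z\<in>cball x r. ennreal (norm (G j z - G j x0)) \<partial>lborel) \<le> ennreal (2 * \<eta> n) * emeasure lborel (cball x r)" .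
          qed
          also have "\<dots> = ennreal m * (ennreal (2 * \<eta> n) * emeasure lborel (cball x r))"
            by (simp add: m_def ennreal_of_nat_eq_real_of_nat)
          also have "\<dots> = ennreal (2 * m * \<eta> n) * emeasure lborel (cball x r)"
            using m \<eta>[of n] by (simp add: ennreal_mult[symmetric] mult.assoc[symmetric] mult.commute[of m])
          finally show ?thesis .
        qed
        \<comment> \<open>The null set N belongs to the linear map at x0, hence to the piece E. It
          is removed here and restored afterwards.\<close>
        have "negligible (E - N)"
        proof (rule noncontact_gapD[OF Wi(2), where f = F])
          show "x0 \<in> W i" using x0 E by blast
          fix x assume x: "x \<in> E - N"
          then have "norm (F x - F x0) < \<delta>" using close(2) x0 by blast
          then show "norm (hpart (F x) - hpart (F x0)) \<le> 1 / Suc n"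
            using norm_hpart_le[of "F x - F x0"] \<delta>(3) by simp
        next
          fix x y assume xy: "x \<in> E - N" "y \<in> E - N"
          have "norm (F x - F y - L x0 (x - y)) \<le> 2 ^ (CARD('m) + 1) * (2 * m * \<eta> n) * dist x y"
          proof (rule lip[rule_format], intro conjI allI impI)
            show "dist x y < 1 / Suc l" using close(1)[of x y] xy \<delta>(4) by auto
            show "ball x (1 / Suc l) \<subseteq> U" "ball y (1 / Suc l) \<subseteq> U" using Wi(3) xy E by blast+
            show "0 \<le> 2 * m * \<eta> n" using m \<eta>[of n] by simp
          qed (use xy avg in auto)
          also have "2 ^ (CARD('m) + 1) * (2 * m * \<eta> n) = 1 / Suc n" using m by (simp add: \<eta>_def)
          finally show "norm (F x - F y - L x0 (x - y)) \<le> 1 / Suc n * norm (x - y)" by (simp add: dist_norm)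
        next
          have "F ` (E - N) \<subseteq> \<Sigma>" using Wi(1) E by blast
          then show "hausdorff_measure_wrt cc_dist (real CARD('m) + 1) (F ` (E - N)) = 0"
            using hausdorff_measure_wrt_mono[of "F ` (E - N)" \<Sigma> cc_dist "real CARD('m) + 1"] H by simp
        qed
        moreover have "negligible N" using N by (simp add: negligible_iff_null_sets null_sets_completionI)
        ultimately have "negligible ((E - N) \<union> N)" by (rule negligible_Un)
        then show ?thesis by (rule negligible_subset) blast
      qed simp
    qed
  qed auto
qed

theorem theorem1p2:
  fixes \<Omega> :: "(real^'m) set"
    and f :: "real^'m \<Rightarrow> 'n::finite heis"
    and Df :: "real^'m \<Rightarrow> 'm \<Rightarrow> 'n heis"
  assumes "open \<Omega>" and "\<Omega> \<noteq> {}"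
    and "CARD('n) < CARD('m)" and "CARD('m) \<le> 2 * CARD('n)"
    and "W11_loc_weak_jacobian \<Omega> f Df"
    and "AE x in lebesgue. x \<in> \<Omega> \<longrightarrow> jacobian_rank Df x = CARD('m)"
  shows "hausdorff_measure_wrt cc_dist (real CARD('m) + 1) (f ` \<Omega>) > 0"
proof (rule ccontr)
  assume "\<not> ?thesis"
  then have H: "hausdorff_measure_wrt cc_dist (real CARD('m) + 1) (f ` \<Omega>) = 0"
    by (simp add: not_less)
  obtain x1 where "x1 \<in> \<Omega>" using assms(2) by blast
  then obtain \<rho> where \<rho>: "\<rho> > 0" "cball x1 \<rho> \<subseteq> \<Omega>" using assms(1) open_contains_cball by blast
  \<comment> \<open>The open ball is convex, as the segment arguments require; its closure is a
    compact subset of \<open>\<Omega>\<close>, which turns local integrability into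
    integrability.\<close>
  define U where "U = ball x1 \<rho>"
  define K where "K = cball x1 \<rho>"
  have U: "convex U" "open U" "U \<subseteq> K" "K \<subseteq> \<Omega>" "U \<noteq> {}" "compact K"
    using \<rho> ball_subset_cball by (auto simp: U_def K_def)
  have fK: "set_integrable lebesgue K f" and DK: "set_integrable lebesgue K (\<lambda>x. Df x j)" for j
    using assms(5) U by (auto simp: W11_loc_weak_jacobian_def locally_integrable_def)
  have wp: "weak_partial \<Omega> f j (\<lambda>x. Df x j)" for j using assms(5) by (simp add: W11_loc_weak_jacobian_def)
  obtain F where F: "integrable lborel F" "AE x in lborel. indicator K x *\<^sub>R f x = F x"
    using set_integrable_lebesgue_ex_borel[OF fK] by blast
  have "\<forall>j. \<exists>G. integrable lborel G \<and> (AE x in lborel. indicator K x *\<^sub>R Df x j = G x)"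
    using set_integrable_lebesgue_ex_borel[OF DK] by blast
  from choice[OF this] obtain G where G: "\<And>j. integrable lborel (G j)" "\<And>j. AE x in lborel. indicator K x *\<^sub>R Df x j = G j x"
    by blast
  have weak: "weak_directional U (axis j 1) F (G j)" for j
    by (rule weak_directional_borel[OF wp U(3,4) F G fK DK])
  have GAE: "AE x in lborel. \<forall>j. indicator K x *\<^sub>R Df x j = G j x"
    using AE_finite_allI[of UNIV "\<lambda>j x. indicator K x *\<^sub>R Df x j = G j x" lborel] G(2) by simp
  have leb: "AE x in lborel. \<forall>j. lebesgue_point (G j) x"
    using AE_finite_allI[of UNIV "\<lambda>j x. lebesgue_point (G j) x" lborel] lebesgue_differentiation[OF G(1)] by simp
  have "AE x in lborel. x \<in> \<Omega> \<longrightarrow> jacobian_rank Df x = CARD('m)"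
    using assms(6) by (simp add: AE_completion_iff)
  \<comment> \<open>Changing representatives keeps \<open>F x\<close> in the image of f for almost
    every x in U. This is how the null image assumption reaches F.\<close>
  then have good: "AE x in lborel. x \<in> U \<longrightarrow> dim (range (\<lambda>j. G j x)) = CARD('m) \<and> F x \<in> f ` \<Omega> \<and> (\<forall>j. lebesgue_point (G j) x)"
    using F(2) GAE leb
  proof eventually_elim
    case (elim x)
    show ?case
    proof
      assume xU: "x \<in> U"
      then have "x \<in> K" "x \<in> \<Omega>" using U by auto
      then have "F x = f x" and GD: "(\<lambda>j. G j x) = Df x" using elim by (auto simp: fun_eq_iff)
      then show "dim (range (\<lambda>j. G j x)) = CARD('m) \<and> F x \<in> f ` \<Omega> \<and> (\<forall>j. lebesgue_point (G j) x)"
        unfolding GD using elim \<open>x \<in> \<Omega>\<close> by (auto simp: jacobian_rank_def)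
    qed
  qed
  have contact: "AE x in lborel. x \<in> U \<longrightarrow> vpart (G k x) = sympl (hpart (F x)) (hpart (G k x))" for k
  proof -
    let ?W = "{x \<in> U. dim (range (\<lambda>j. G j x)) = CARD('m) \<and> F x \<in> f ` \<Omega> \<and> (\<forall>j. lebesgue_point (G j) x) \<and>
      vpart (G k x) \<noteq> sympl (hpart (F x)) (hpart (G k x))}"
    have "?W \<in> null_sets lebesgue"
      using negligible_noncontact_points[OF F(1) G(1) weak U(1,2) H, of k] by (simp add: negligible_iff_null_sets)
    then have "AE x in lebesgue. x \<notin> ?W" by (rule AE_not_in)
    then have "AE x in lborel. x \<notin> ?W" by (simp only: AE_completion_iff)
    then show ?thesis using good by eventually_elim blast
  qed
  have "AE x in lborel. \<forall>k. x \<in> U \<longrightarrow> vpart (G k x) = sympl (hpart (F x)) (hpart (G k x))"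
    using AE_finite_allI[of UNIV "\<lambda>k x. x \<in> U \<longrightarrow> vpart (G k x) = sympl (hpart (F x)) (hpart (G k x))" lborel] contact by simp
  then have all: "AE x in lborel. x \<in> U \<longrightarrow> dim (range (\<lambda>j. G j x)) = CARD('m) \<and> (\<forall>j. lebesgue_point (G j) x) \<and>
    (\<forall>k. vpart (G k x) = sympl (hpart (F x)) (hpart (G k x)))"
    using good by eventually_elim blast
  have "\<exists>x0\<in>U. dim (range (\<lambda>j. G j x0)) = CARD('m) \<and> (\<forall>j. lebesgue_point (G j) x0) \<and>
    (\<forall>k. vpart (G k x0) = sympl (hpart (F x0)) (hpart (G k x0)))"
  proof (rule ccontr)
    assume neg: "\<not> ?thesis"
    have "AE x in lborel. x \<notin> U" using all
    proof eventually_elim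
      case (elim x)
      then show ?case using neg by blast
    qed
    then have "emeasure lborel U = 0"
      using U(2) AE_iff_measurable[of U lborel "\<lambda>x. x \<notin> U"] by simp
    then have "measure lborel U = 0" by (simp add: measure_def)
    then show False using \<rho> by (simp add: U_def)
  qed
  then obtain x0 where x0: "x0 \<in> U" "dim (range (\<lambda>j. G j x0)) = CARD('m)" "\<And>j. lebesgue_point (G j) x0"
    "\<And>k. vpart (G k x0) = sympl (hpart (F x0)) (hpart (G k x0))" by blast
  \<comment> \<open>The columns are weak derivatives along unit axis vectors, so the loop argument
    applies to every pair. The range of the Jacobian thus has dimension at most n, against rank m >
    n.\<close>
  have "sympl (hpart (G i x0)) (hpart (G j x0)) = 0" for i j
    by (rule contact_symplectic_orthogonal[OF F(1) G(1) G(1) weak weak U(1,2) contact contact x0(1)])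
      (simp_all add: x0(3))
  then have "dim (range (\<lambda>j. G j x0)) \<le> CARD('n)"
    using x0(4) by (intro isotropic_dim_le[where ?z0.0 = "hpart (F x0)"]) auto
  then show False using x0(2) assms(3) by simp
qed

end
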